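(* Let $\mathbf{X}$ be the $4$-dimensional primitive quasitoric orbifold with model $(P,\Lambda)$. Let $E_2$ be an edge of $P$ with neighboring edges $E_1$ and $E_3$, with characteristic vectors $\lambda_i=\Lambda(E_i)$. Let $\mathbf{Y}$ be the quasitoric orbifold with model $(\widehat P,\widehat\Lambda)$ obtained by deleting $E_2$ and its characteristic vector and extending $E_1$ and $E_3$ until they meet at a new vertex. If $\det[\lambda_1,\lambda_2]=1$ and $0<\det[\lambda_2,\lambda_3]\le\det[\lambda_1,\lambda_3]$, then there exists a continuous map $\rho:X\to Y$ which is a diffeomorphism (of orbifolds) away from the set $\pi^{-1}(E_2)\subset X$.
   Context: **Quasitoric orbifolds.** Let $N=\mathbb{Z}^2$, $T_N=(N\otimes\mathbb{R})/N$. Let $P\subset\mathbb{R}^2$ be a $2$-dimensional convex polytope. A characteristic function $\Lambda$ assigns to each edge $E_i$ a vector $\lambda_i=\Lambda(E_i)\in N$ such that $\lambda_i,\lambda_j$ are linearly independent whenever $E_i,E_j$ meet at a vertex. All $\lambda_i$ are assumed primitive (the orbifold is then called primitive). For a face $F$ of $P$ let $N(F)$ be the submodule of $N$ generated by the $\lambda_i$ with $F\subset E_i$, let $T_{N(F)}=(N(F)\otimes\mathbb{R})/N(F)$, and let $T(N(F))$ be the image of the natural homomorphism $T_{N(F)}\to T_N$. For $p\in P$ let $F(p)$ be the face whose relative interior contains $p$. Put $X=P\times T_N/\sim$, where $(p,t)\sim(q,s)$ iff $p=q$ and $s^{-1}t\in T(N(F(p)))$. $T_N$ acts on $X$ through the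 second factor; let $\pi:X\to P$ be the orbit map. **Orbifold structure.** For a vertex $v$ let $U_v$ be the complement in $P$ of all edges not containing $v$, and $X_v=\pi^{-1}(U_v)$. Put $\widetilde X_v=U_v\times T_{N(v)}/\sim_v$, where $(p,t)\sim_v(q,s)$ iff $p=q$ and $s^{-1}t\in T_{N(F(p))}\subset T_{N(v)}$. The finite group $G_v=N/N(v)=\ker(T_{N(v)}\to T_N)$ acts on $\widetilde X_v$, and $T_{N(v)}\to T_N$ induces $\xi_v:\widetilde X_v\to X_v\cong\widetilde X_v/G_v$. Let the edges at $v$ be $E_i,E_j$; let $p_1(v),p_2(v)$ be affine functions vanishing on $E_i$, $E_j$ respectively and positive on the interior of $P$, and $q_1(v),q_2(v)$ the angular coordinates with respect to the basis $\lambda_i,\lambda_j$ of $N\otimes\mathbb{R}$. The functions $z_a(v)=\sqrt{p_a(v)}\,e^{2\pi\sqrt{-1}q_a(v)}$, $a=1,2$, identify $\widetilde X_v$ with an open subset of $\mathbb{C}^2$ and define its smooth structure. The charts $(\widetilde X_v,G_v,\xi_v)$ define the orbifold $\mathbf{X}$ with underlying space $X$, called the quasitoric orbifold with model $(P,\Lambda)$. Its diffeomorphism type does not change if $P$ is replaced by a polytope diffeomorphic to $P$ with corresponding characteristic vectors. **Deletion of an edge.** The polytope $\widehat P$ is obtained from $P$ by removing the edge $E_2$ and extending its neighboring edges $E_1,E_3$ till they meet at a new vertex $w$; if necessary $P$ is first replaced by a diffeomorphic polytope (with the same characteristic vectors) for which this is possible. This presupposes that $P$ has at least four edges. $\widehat\Lambda$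 is the characteristic function inherited from $\Lambda$ (every remaining edge keeps its characteristic vector); $\mathbf{Y}$ has underlying space $Y$, and the fixed point of $Y$ over $w$ is also denoted $w$. That $\rho$ is a diffeomorphism away from $\pi^{-1}(E_2)$ means that $\rho$ restricts to a diffeomorphism of orbifolds from $\mathbf{X}\setminus\pi^{-1}(E_2)$ onto $\mathbf{Y}\setminus\{w\}$. *)

theory Defs
  imports "HOL-Analysis.Analysis" "HOL-Library.Set_Algebras"
begin

section \<open>Smooth maps\<close>

text \<open>In finite dimension, being $C^k$ on an open set is expressed by iterated directional
  derivatives; this avoids the growing types of iterated Frechet derivatives.\<close>

primrec Ck_on :: "nat \<Rightarrow> 'a::euclidean_space set \<Rightarrow> ('a \<Rightarrow> 'b::euclidean_space) \<Rightarrow> bool" where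
  "Ck_on 0 S f \<longleftrightarrow> continuous_on S f"
| "Ck_on (Suc k) S f \<longleftrightarrow> (\<forall>x\<in>S. f differentiable (at x)) \<and>
     (\<forall>v. Ck_on k S (\<lambda>x. frechet_derivative f (at x) v))"

definition smooth_on :: "'a::euclidean_space set \<Rightarrow> ('a \<Rightarrow> 'b::euclidean_space) \<Rightarrow> bool" where
  "smooth_on S f \<longleftrightarrow> (\<forall>k. Ck_on k S f)"

definition diffeo_on :: "'a::euclidean_space set \<Rightarrow> 'b::euclidean_space set \<Rightarrow> ('a \<Rightarrow> 'b) \<Rightarrow> bool" where
  "diffeo_on S T f \<longleftrightarrow> open S \<and> open T \<and> bij_betw f S T \<and>
     smooth_on S f \<and> smooth_on T (the_inv_into S f)"

text \<open>Smoothness on a set that need not be open: existence of a smooth extension.\<close>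

definition extends_smoothly :: "'a::euclidean_space set \<Rightarrow> ('a \<Rightarrow> 'b::euclidean_space) \<Rightarrow> bool" where
  "extends_smoothly S f \<longleftrightarrow> (\<exists>U g. open U \<and> S \<subseteq> U \<and> smooth_on U g \<and> (\<forall>x\<in>S. g x = f x))"


section \<open>Quotient topology\<close>

definition quot_topology :: "'a topology \<Rightarrow> ('a \<Rightarrow> 'b) \<Rightarrow> 'b topology" where
  "quot_topology T f =
     topology (\<lambda>U. U \<subseteq> f ` topspace T \<and> openin T {x \<in> topspace T. f x \<in> U})"

lemma openin_quot_topology:
  "openin (quot_topology T f) U \<longleftrightarrow>
     U \<subseteq> f ` topspace T \<and> openin T {x \<in> topspace T. f x \<in> U}"
proof -
  have "istopology (\<lambda>U. U \<subseteq> f ` topspace T \<and> openin T {x \<in> topspace T. f x \<in> U})"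
    unfolding istopology_def
  proof (intro conjI allI impI)
    fix S S'
    assume "S \<subseteq> f ` topspace T \<and> openin T {x \<in> topspace T. f x \<in> S}"
      and "S' \<subseteq> f ` topspace T \<and> openin T {x \<in> topspace T. f x \<in> S'}"
    moreover have "{x \<in> topspace T. f x \<in> S \<inter> S'} =
        {x \<in> topspace T. f x \<in> S} \<inter> {x \<in> topspace T. f x \<in> S'}" by auto
    ultimately show "S \<inter> S' \<subseteq> f ` topspace T" "openin T {x \<in> topspace T. f x \<in> S \<inter> S'}"
      by (auto simp: openin_Int)
  next
    fix \<K> assume K: "\<forall>K\<in>\<K>. K \<subseteq> f ` topspace T \<and> openin T {x \<in> topspace T. f x \<in> K}"
    then show "\<Union>\<K> \<subseteq> f ` topspace T" by blast
    have "{x \<in> topspace T. f x \<in> \<Union>\<K>} = (\<Union>K\<in>\<K>. {x \<in> topspace T. f x \<in> K})" by auto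
    then show "openin T {x \<in> topspace T. f x \<in> \<Union>\<K>}" using K by auto
  qed
  then show ?thesis by (simp add: quot_topology_def topology_inverse')
qed

lemma topspace_quot_topology [simp]: "topspace (quot_topology T f) = f ` topspace T"
proof
  show "topspace (quot_topology T f) \<subseteq> f ` topspace T"
    by (metis openin_quot_topology openin_topspace)
  have "{x \<in> topspace T. f x \<in> f ` topspace T} = topspace T" by auto
  then have "openin (quot_topology T f) (f ` topspace T)"
    by (simp add: openin_quot_topology)
  then show "f ` topspace T \<subseteq> topspace (quot_topology T f)" by (rule openin_subset)
qed

lemma quotient_map_quot_topology: "quotient_map T (quot_topology T f) f"
  by (auto simp: quotient_map_def openin_quot_topology)


section \<open>Orbifold charts and diffeomorphisms of orbifolds\<close>

text \<open>A four-dimensional orbifold chart $(D, G, \xi)$: an open set $D$ of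
  $\mathbf{C}^2$, a finite group $G$ of transformations of $D$, given as extensional functions
  (undefined outside $D$), so that $G$ acts effectively by construction, and the folding map $\xi$.\<close>

type_synonym C2 = "complex \<times> complex"
type_synonym 'a ochart = "C2 set \<times> (C2 \<Rightarrow> C2) set \<times> (C2 \<Rightarrow> 'a)"

text \<open>Restriction of a chart to a connected open set whose translates under the group either
  coincide with it or are disjoint from it. Up to isomorphism these are the charts that embed
  into the given one.\<close>

fun subchart :: "'a ochart \<Rightarrow> 'a ochart \<Rightarrow> bool" where
  "subchart (D', G', \<xi>') (D, G, \<xi>) \<longleftrightarrow>
     open D' \<and> connected D' \<and> D' \<noteq> {} \<and> D' \<subseteq> D \<and>
     (\<forall>g\<in>G. g ` D' = D' \<or> g ` D' \<inter> D' = {}) \<and>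
     G' = {restrict g D' | g. g \<in> G \<and> g ` D' = D'} \<and>
     (\<forall>z\<in>D'. \<xi>' z = \<xi> z)"

text \<open>An orbifold is given by its underlying space and an atlas.\<close>

type_synonym 'a orbifold = "'a topology \<times> 'a ochart set"

definition chart_image :: "'a ochart \<Rightarrow> 'a set" where
  "chart_image c = (case c of (D, G, \<xi>) \<Rightarrow> \<xi> ` D)"

definition open_suborbifold :: "'a orbifold \<Rightarrow> 'a set \<Rightarrow> 'a orbifold" where
  "open_suborbifold X A =
     (subtopology (fst X) A, {c. (\<exists>d\<in>snd X. subchart c d) \<and> chart_image c \<subseteq> A})"

text \<open>An equivariant diffeomorphism of charts that lifts \<open>f\<close>. As the groups act effectively, the
  bijection \<open>h\<close> is automatically an isomorphism of groups.\<close>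

fun lifts_to_diffeo :: "('a \<Rightarrow> 'b) \<Rightarrow> 'a ochart \<Rightarrow> 'b ochart \<Rightarrow> bool" where
  "lifts_to_diffeo f (D, G, \<xi>) (D', G', \<xi>') \<longleftrightarrow>
     (\<exists>F h. diffeo_on D D' F \<and> (\<forall>z\<in>D. \<xi>' (F z) = f (\<xi> z)) \<and>
        bij_betw h G G' \<and> (\<forall>g\<in>G. \<forall>z\<in>D. F (g z) = h g (F z)))"

definition orbifold_diffeomorphism :: "'a orbifold \<Rightarrow> 'b orbifold \<Rightarrow> ('a \<Rightarrow> 'b) \<Rightarrow> bool" where
  "orbifold_diffeomorphism X Y f \<longleftrightarrow>
     homeomorphic_map (fst X) (fst Y) f \<and>
     (\<forall>x\<in>topspace (fst X). \<exists>c d. (\<exists>c'\<in>snd X. subchart c c') \<and> (\<exists>d'\<in>snd Y. subchart d d') \<and>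
        x \<in> chart_image c \<and> f x \<in> chart_image d \<and> lifts_to_diffeo f c d)"


section \<open>Lattices and tori\<close>

global_interpretation int_vec: module "(*s) :: int \<Rightarrow> int ^ 2 \<Rightarrow> int ^ 2"
  by unfold_locales (vector algebra_simps)+

definition real_vec :: "int ^ 2 \<Rightarrow> real ^ 2" where
  "real_vec u = (\<chi> i. real_of_int (u $ i))"

definition NN :: "(real ^ 2) set" where
  "NN = range real_vec"

definition primitive_vec :: "int ^ 2 \<Rightarrow> bool" where
  "primitive_vec u \<longleftrightarrow> (\<forall>k u'. u = k *s u' \<longrightarrow> is_unit k)"

text \<open>$\det[u, v]$, with \<open>u\<close> and \<open>v\<close> as columns.\<close>

definition det_cols :: "int ^ 2 \<Rightarrow> int ^ 2 \<Rightarrow> int" where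
  "det_cols u v = det (transpose (vector [u, v] :: int ^ 2 ^ 2))"

text \<open>For a subgroup \<open>L\<close> of the plane generated by linearly independent vectors, the torus
  $(L \otimes \mathbf{R})/L$; its elements are cosets of \<open>L\<close>, its group operation is the sum
  of sets, and inversion is the image under negation.\<close>

definition torus :: "(real ^ 2) set \<Rightarrow> (real ^ 2) set set" where
  "torus L = (\<lambda>x. x +o L) ` span L"

definition torus_topology :: "(real ^ 2) set \<Rightarrow> (real ^ 2) set topology" where
  "torus_topology L = quot_topology (top_of_set (span L)) (\<lambda>x. x +o L)"

text \<open>For $L \subseteq M$ the natural homomorphism from \<open>torus L\<close> to \<open>torus M\<close>.\<close>

definition torus_hom :: "(real ^ 2) set \<Rightarrow> (real ^ 2) set \<Rightarrow> (real ^ 2) set" where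
  "torus_hom M t = t + M"


section \<open>Quasitoric orbifolds over polygons\<close>

type_synonym point = "(real ^ 2) \<times> (real ^ 2) set"

definition polygon :: "(real ^ 2) set \<Rightarrow> bool" where
  "polygon P \<longleftrightarrow> polytope P \<and> aff_dim P = 2"

definition primitive_characteristic :: "(real ^ 2) set \<Rightarrow> ((real ^ 2) set \<Rightarrow> int ^ 2) \<Rightarrow> bool" where
  "primitive_characteristic P \<Lambda> \<longleftrightarrow>
     (\<forall>E. E edge_of P \<longrightarrow> primitive_vec (\<Lambda> E)) \<and>
     (\<forall>E E'. E edge_of P \<longrightarrow> E' edge_of P \<longrightarrow> E \<noteq> E' \<longrightarrow> E \<inter> E' \<noteq> {} \<longrightarrow>
        (\<forall>a b. a *s \<Lambda> E + b *s \<Lambda> E' = 0 \<longrightarrow> a = 0 \<and> b = 0))"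

context
  fixes P :: "(real ^ 2) set" and \<Lambda> :: "(real ^ 2) set \<Rightarrow> int ^ 2"
begin

definition face_lattice :: "(real ^ 2) set \<Rightarrow> (real ^ 2) set" where
  "face_lattice F = real_vec ` int_vec.span (\<Lambda> ` {E. E edge_of P \<and> F \<subseteq> E})"

definition face_at :: "real ^ 2 \<Rightarrow> (real ^ 2) set" where
  "face_at p = (THE F. F face_of P \<and> p \<in> rel_interior F)"

text \<open>The equivalence relation on \<open>U \<times> torus M\<close> that divides the fibre over \<open>p\<close> by the image of
  the torus of \<open>face_at p\<close>; it serves both for $X$ ($U = P$, $M = N$) and for
  $\widetilde X_v$ ($U = U_v$, $M = N(v)$).\<close>

definition fibre_rel :: "(real ^ 2) set \<Rightarrow> (real ^ 2) set \<Rightarrow> point rel" where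
  "fibre_rel U M = {((p, t), (q, s)). p \<in> U \<and> p = q \<and> t \<in> torus M \<and> s \<in> torus M \<and>
     uminus ` s + t \<in> torus_hom M ` torus (face_lattice (face_at p))}"

definition qt_space :: "point set topology" where
  "qt_space = quot_topology (prod_topology (top_of_set P) (torus_topology NN))
     (\<lambda>x. fibre_rel P NN `` {x})"

definition vertex_nbhd :: "real ^ 2 \<Rightarrow> (real ^ 2) set" where
  "vertex_nbhd v = P - \<Union>{E. E edge_of P \<and> v \<notin> E}"

definition vertex_cover :: "real ^ 2 \<Rightarrow> point set set" where
  "vertex_cover v =
     (let U = vertex_nbhd v; M = face_lattice {v} in (U \<times> torus M) // fibre_rel U M)"

definition vertex_group :: "real ^ 2 \<Rightarrow> (real ^ 2) set set" where
  "vertex_group v = {g \<in> torus (face_lattice {v}). torus_hom NN g = NN}"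

definition vertex_action :: "(real ^ 2) set \<Rightarrow> point set \<Rightarrow> point set" where
  "vertex_action g c = (\<lambda>(p, t). (p, g + t)) ` c"

definition vertex_fold :: "point set \<Rightarrow> point set" where
  "vertex_fold c = fibre_rel P NN `` ((\<lambda>(p, t). (p, torus_hom NN t)) ` c)"

definition edge_function :: "(real ^ 2) set \<Rightarrow> (real ^ 2 \<Rightarrow> real) \<Rightarrow> bool" where
  "edge_function E f \<longleftrightarrow> (\<exists>a b. f = (\<lambda>x. a \<bullet> x + b)) \<and>
     (\<forall>x\<in>E. f x = 0) \<and> (\<forall>x\<in>interior P. f x > 0)"

definition angular_coords :: "(real ^ 2) set \<Rightarrow> (real ^ 2) set \<Rightarrow> real ^ 2 \<Rightarrow> real \<times> real" where
  "angular_coords E E' y =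
     (THE q. y = fst q *\<^sub>R real_vec (\<Lambda> E) + snd q *\<^sub>R real_vec (\<Lambda> E'))"

text \<open>The coordinates $(z_1, z_2)$ of a point of $\widetilde X_v$; the value does not depend on
  the representatives \<open>(p, t)\<close> of the class \<open>c\<close> and \<open>y\<close> of the coset \<open>t\<close>.\<close>

definition vertex_coords ::
    "(real ^ 2) set \<Rightarrow> (real ^ 2) set \<Rightarrow> (real ^ 2 \<Rightarrow> real) \<Rightarrow> (real ^ 2 \<Rightarrow> real) \<Rightarrow> point set \<Rightarrow> C2" where
  "vertex_coords E E' f f' c = (THE z. \<exists>p t y. (p, t) \<in> c \<and> y \<in> t \<and>
     z = (sqrt (f p) * exp (2 * pi * \<i> * fst (angular_coords E E' y)),
          sqrt (f' p) * exp (2 * pi * \<i> * snd (angular_coords E E' y))))"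

text \<open>The chart $(\widetilde X_v, G_v, \xi_v)$, transported to $\mathbf{C}^2$ along
  \<open>vertex_coords\<close>.\<close>

definition vertex_chart :: "real ^ 2 \<Rightarrow> (real ^ 2) set \<Rightarrow> (real ^ 2) set \<Rightarrow>
    (real ^ 2 \<Rightarrow> real) \<Rightarrow> (real ^ 2 \<Rightarrow> real) \<Rightarrow> point set ochart" where
  "vertex_chart v E E' f f' =
     (let z = vertex_coords E E' f f'; D = z ` vertex_cover v; r = the_inv_into (vertex_cover v) z
      in (D, (\<lambda>g. restrict (z \<circ> vertex_action g \<circ> r) D) ` vertex_group v, vertex_fold \<circ> r))"

text \<open>The order of the two edges at \<open>v\<close> and the positive factors of the two affine functions
  are not determined by \<open>v\<close>; the atlas contains the charts for all choices.\<close>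

definition qt_atlas :: "point set ochart set" where
  "qt_atlas = {vertex_chart v E E' f f' | v E E' f f'.
     v extreme_point_of P \<and> E edge_of P \<and> E' edge_of P \<and> E \<noteq> E' \<and> v \<in> E \<and> v \<in> E' \<and>
     edge_function E f \<and> edge_function E' f'}"

definition quasitoric_orbifold :: "point set orbifold" where
  "quasitoric_orbifold = (qt_space, qt_atlas)"

end

definition orbit_map :: "point set \<Rightarrow> real ^ 2" where
  "orbit_map c = (THE p. p \<in> fst ` c)"


section \<open>Deletion of an edge\<close>

text \<open>Diffeomorphism of polygons as manifolds with corners. The last condition, that edges
  correspond to edges, follows from the others and is included for convenience.\<close>

definition polygon_diffeo :: "(real ^ 2) set \<Rightarrow> (real ^ 2) set \<Rightarrow> (real ^ 2 \<Rightarrow> real ^ 2) \<Rightarrow> bool" where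
  "polygon_diffeo P P' \<phi> \<longleftrightarrow> bij_betw \<phi> P P' \<and>
     extends_smoothly P \<phi> \<and> extends_smoothly P' (the_inv_into P \<phi>) \<and>
     (\<forall>E. E edge_of P \<longrightarrow> \<phi> ` E edge_of P') \<and>
     (\<forall>E'. E' edge_of P' \<longrightarrow> (\<exists>E. E edge_of P \<and> E' = \<phi> ` E))"

text \<open>The edges \<open>E1 = [c, a]\<close> and \<open>E3 = [d, b]\<close>, neighbours of \<open>E2 = [a, b]\<close>, are extended beyond
  \<open>a\<close> and \<open>b\<close> until they meet at \<open>w\<close>; this adds the triangle \<open>a, b, w\<close> to \<open>P\<close>.\<close>

definition deletes_edge :: "(real ^ 2) set \<Rightarrow> (real ^ 2) set \<Rightarrow> (real ^ 2) set \<Rightarrow> (real ^ 2) set \<Rightarrow>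
    real ^ 2 \<Rightarrow> (real ^ 2) set \<Rightarrow> bool" where
  "deletes_edge P E1 E2 E3 w Q \<longleftrightarrow>
     (\<exists>a b c d. E1 = closed_segment c a \<and> E2 = closed_segment a b \<and> E3 = closed_segment d b \<and>
        a \<in> open_segment c w \<and> b \<in> open_segment d w \<and> Q = P \<union> convex hull {a, b, w})"

text \<open>\<open>(Q, \<Lambda>hat)\<close> arises from \<open>(P, \<Lambda>)\<close> by replacing \<open>P\<close> by a diffeomorphic polygon \<open>P'\<close> and then
  deleting the edge corresponding to \<open>E2\<close>. An edge of \<open>Q\<close> inherits the vector of the edge of \<open>P'\<close>
  that it contains. The case \<open>P' = P\<close>, \<open>\<phi> = id\<close> is allowed.\<close>

definition edge_deletion :: "(real ^ 2) set \<Rightarrow> ((real ^ 2) set \<Rightarrow> int ^ 2) \<Rightarrow>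
    (real ^ 2) set \<Rightarrow> (real ^ 2) set \<Rightarrow> (real ^ 2) set \<Rightarrow>
    real ^ 2 \<Rightarrow> (real ^ 2) set \<Rightarrow> ((real ^ 2) set \<Rightarrow> int ^ 2) \<Rightarrow> bool" where
  "edge_deletion P \<Lambda> E1 E2 E3 w Q \<Lambda>hat \<longleftrightarrow>
     (\<exists>P' \<phi>. polygon P' \<and> polygon_diffeo P P' \<phi> \<and>
        deletes_edge P' (\<phi> ` E1) (\<phi> ` E2) (\<phi> ` E3) w Q \<and>
        (\<forall>E E'. E edge_of P \<longrightarrow> E' edge_of Q \<longrightarrow> \<phi> ` E \<subseteq> E' \<longrightarrow> \<Lambda>hat E' = \<Lambda> E))"

end

theory Submission
  imports Defs
begin

text \<open>The map \<open>\<rho>\<close> is induced by a map \<open>h\<close> of polygons. Replacing \<open>P\<close> by the diffeomorphic polygon of which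
  \<open>Q\<close> is an enlargement, one moves each point along the ray through it from the new vertex \<open>w\<close>, in such a way that the
  edge \<open>E2\<close> collapses to \<open>w\<close>, its complement is mapped diffeomorphically onto \<open>Q - {w}\<close>, and the
  points far from \<open>E2\<close>, among them all edges that do not meet \<open>E2\<close>, stay fixed (\<open>edge_collapse\<close>). Rays from \<open>w\<close>
  preserve the prolonged neighbours of \<open>E2\<close>, so \<open>h\<close> maps every edge other than \<open>E2\<close> into the edge of \<open>Q\<close>
  with the same characteristic vector. Hence the same subtorus is divided out over \<open>p\<close> and
  over \<open>h p\<close> if \<open>p\<close> is not on \<open>E2\<close>. Over \<open>w\<close> the whole torus is divided out: the hypotheses give
  $\det[\lambda_1, \lambda_3] > 0$, so \<open>\<lambda>\<^sub>1\<close> and \<open>\<lambda>\<^sub>3\<close> span the plane. Therefore \<open>(p, t) \<mapsto> (h p, t)\<close>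
  respects the equivalence relations and induces a continuous map, and its inverse does so away from
  \<open>E2\<close> and \<open>w\<close> (\<open>homeomorphic_map_\<rho>\<close>).

  Every point off \<open>E2\<close> lies in the neighbourhood \<open>U\<^sub>v\<close> of a vertex \<open>v\<close> off \<open>E2\<close>, which does not meet
  \<open>E2\<close>, and \<open>h\<close> maps \<open>U\<^sub>v\<close> onto the corresponding neighbourhood of the vertex \<open>h v\<close>. So whole charts are
  mapped to whole charts, with the same lattice and the same group, and the lift keeps the angles and changes the
  radii $\sqrt{p_a}$ to $\sqrt{\hat p_a \circ h}$. It is smooth where $z_a \neq 0$. Near $z_a = 0$,
  Hadamard's lemma applies to $\hat p_a \circ h$, which vanishes together with $p_a$, and
  yields a smooth quotient of the two. The same holds for the inverse of \<open>h\<close>; the product of the two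
  quotients is one, so they have no zeros, and the square root of the quotient is smooth
  (\<open>smooth_positive_quotient\<close>, \<open>lifts_to_diffeo_vertex_charts\<close>).\<close>

section \<open>Calculus of smooth maps\<close>

lemma Ck_on_cong:
  assumes "open S" and "\<And>x. x \<in> S \<Longrightarrow> f x = g x"
  shows "Ck_on k S f \<longleftrightarrow> Ck_on k S g"
  using assms(2)
proof (induction k arbitrary: f g)
  case 0
  then show ?case by (simp cong: continuous_on_cong)
next
  case (Suc k)
  have *: "(f has_derivative D) (at x) \<longleftrightarrow> (g has_derivative D) (at x)" if "x \<in> S" for x D
    using has_derivative_transform_within_open[OF _ \<open>open S\<close> that] Suc.prems by metis
  then have "f differentiable (at x) \<longleftrightarrow> g differentiable (at x)" if "x \<in> S" for x
    using that by (simp add: differentiable_def)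
  moreover have "frechet_derivative f (at x) = frechet_derivative g (at x)" if "x \<in> S" for x
    using * that by (simp add: frechet_derivative_def)
  then have "Ck_on k S (\<lambda>x. frechet_derivative f (at x) v) \<longleftrightarrow>
      Ck_on k S (\<lambda>x. frechet_derivative g (at x) v)" for v
    by (intro Suc.IH) simp
  ultimately show ?case by simp
qed

lemma Ck_on_SucI:
  assumes "open S" and "\<And>x. x \<in> S \<Longrightarrow> (f has_derivative f' x) (at x)"
    and "\<And>v. Ck_on k S (\<lambda>x. f' x v)"
  shows "Ck_on (Suc k) S f"
proof -
  have "frechet_derivative f (at x) = f' x" if "x \<in> S" for x
    using frechet_derivative_at[OF assms(2)[OF that]] by simp
  then have "Ck_on k S (\<lambda>x. frechet_derivative f (at x) v) \<longleftrightarrow> Ck_on k S (\<lambda>x. f' x v)" for v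
    by (intro Ck_on_cong assms(1)) simp
  then show ?thesis using assms(2,3) by (auto simp: differentiable_def)
qed

lemma Ck_on_SucD:
  assumes "Ck_on (Suc k) S f"
  shows "\<And>x. x \<in> S \<Longrightarrow> (f has_derivative frechet_derivative f (at x)) (at x)"
    and "\<And>v. Ck_on k S (\<lambda>x. frechet_derivative f (at x) v)"
  using assms by (auto simp: frechet_derivative_works)

lemma Ck_on_lower: "Ck_on (Suc k) S f \<Longrightarrow> Ck_on k S f"
proof (induction k arbitrary: f)
  case 0
  then show ?case
    by (auto intro!: continuous_at_imp_continuous_on differentiable_imp_continuous_within)
next
  case (Suc k)
  have "Ck_on k S (\<lambda>x. frechet_derivative f (at x) v)" for v
    by (rule Suc.IH) (use Suc.prems in auto)
  then show ?case using Suc.prems by simp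
qed

lemma Ck_on_imp_continuous_on: "Ck_on k S f \<Longrightarrow> continuous_on S f"
  by (induction k) (use Ck_on_lower in \<open>auto simp del: Ck_on.simps(2)\<close>)

lemma Ck_on_subset: "Ck_on k S f \<Longrightarrow> T \<subseteq> S \<Longrightarrow> Ck_on k T f"
  by (induction k arbitrary: f) (auto intro: continuous_on_subset)

lemma Ck_on_local:
  assumes "\<And>x. x \<in> S \<Longrightarrow> \<exists>V. open V \<and> x \<in> V \<and> Ck_on k V f"
  shows "Ck_on k S f"
  using assms
proof (induction k arbitrary: f)
  case 0
  have "isCont f x" if "x \<in> S" for x
    using 0[OF that] by (auto simp: continuous_on_eq_continuous_at)
  then show ?case by (simp add: continuous_at_imp_continuous_on)
next
  case (Suc k)
  have "f differentiable (at x)" if "x \<in> S" for x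
    using Suc.prems[OF that] by auto
  moreover have "Ck_on k S (\<lambda>x. frechet_derivative f (at x) v)" for v
    by (rule Suc.IH) (use Suc.prems in fastforce)
  ultimately show ?case by simp
qed

lemma Ck_on_const: "Ck_on k S (\<lambda>x. c)"
  by (induction k arbitrary: c) auto

lemma Ck_on_bounded_linear:
  assumes "bounded_linear L" "open S"
  shows "Ck_on k S L"
proof (cases k)
  case 0
  then show ?thesis using linear_continuous_on[OF assms(1)] by simp
next
  case (Suc m)
  show ?thesis unfolding Suc
    by (rule Ck_on_SucI[OF assms(2) bounded_linear_imp_has_derivative[OF assms(1)] Ck_on_const])
qed

lemma Ck_on_add:
  assumes "open S" "Ck_on k S f" "Ck_on k S g"
  shows "Ck_on k S (\<lambda>x. f x + g x)"
  using assms(2,3)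
proof (induction k arbitrary: f g)
  case 0
  then show ?case by (simp add: continuous_on_add)
next
  case (Suc k)
  show ?case
    by (rule Ck_on_SucI[OF assms(1) has_derivative_add[OF Ck_on_SucD(1) Ck_on_SucD(1)]])
      (use Suc Ck_on_SucD(2) in blast)+
qed

lemma Ck_on_bounded_bilinear:
  assumes "bounded_bilinear B" and "open S" "Ck_on k S f" "Ck_on k S g"
  shows "Ck_on k S (\<lambda>x. B (f x) (g x))"
  using assms(3,4)
proof (induction k arbitrary: f g)
  case 0
  then show ?case using bounded_bilinear.continuous_on[OF assms(1)] by simp
next
  case (Suc k)
  show ?case
  proof (rule Ck_on_SucI[OF assms(2)
        bounded_bilinear.FDERIV[OF assms(1) Ck_on_SucD(1)[OF Suc.prems(1)] Ck_on_SucD(1)[OF Suc.prems(2)]]])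
    show "Ck_on k S (\<lambda>x. B (f x) (frechet_derivative g (at x) v) +
        B (frechet_derivative f (at x) v) (g x))" for v
      by (intro Ck_on_add assms(2) Suc.IH Ck_on_lower[OF Suc.prems(1)] Ck_on_lower[OF Suc.prems(2)]
        Ck_on_SucD(2)[OF Suc.prems(1)] Ck_on_SucD(2)[OF Suc.prems(2)])
  qed
qed

lemma Ck_on_sum:
  assumes "open S" "\<And>i. i \<in> I \<Longrightarrow> Ck_on k S (f i)"
  shows "Ck_on k S (\<lambda>x. \<Sum>i\<in>I. f i x)"
  using assms(2)
  by (induction I rule: infinite_finite_induct) (auto intro: Ck_on_const Ck_on_add assms(1))

lemma Ck_on_bounded_linear_compose:
  assumes "bounded_linear L" "open S" "Ck_on k S f"
  shows "Ck_on k S (\<lambda>x. L (f x))"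
  using assms(3)
proof (induction k arbitrary: f)
  case 0
  then show ?case using bounded_linear.continuous_on[OF assms(1)] by simp
next
  case (Suc k)
  show ?case
    by (rule Ck_on_SucI[OF assms(2) bounded_linear.has_derivative[OF assms(1) Ck_on_SucD(1)[OF Suc.prems]]])
      (use Suc.IH Ck_on_SucD(2)[OF Suc.prems] in blast)+
qed

text \<open>In coordinates, the chain rule reads
  $D(g \circ f)(x) v = \sum_b \langle Df(x) v, b \rangle\, Dg(f x) b$; this exhibits the directional
  derivatives of a composition as sums of products of maps to which induction applies.\<close>

lemma Ck_on_compose:
  assumes "open S" "open T" "Ck_on k S f" "Ck_on k T g" "f ` S \<subseteq> T"
  shows "Ck_on k S (\<lambda>x. g (f x))"
  using assms(3-5)
proof (induction k arbitrary: f g)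
  case 0
  then show ?case by (auto intro: continuous_on_compose2)
next
  case (Suc k)
  let ?f' = "\<lambda>x. frechet_derivative f (at x)" and ?g' = "\<lambda>x. frechet_derivative g (at x)"
  have f: "Ck_on k S f" by (rule Ck_on_lower) fact
  have D: "((\<lambda>x. g (f x)) has_derivative (\<lambda>v. ?g' (f x) (?f' x v))) (at x)" if "x \<in> S" for x
    using diff_chain_at[OF Ck_on_SucD(1)[OF Suc.prems(1) that] Ck_on_SucD(1)[OF Suc.prems(2)]]
      that Suc.prems(3) by (auto simp: o_def)
  have C: "Ck_on k S (\<lambda>x. ?g' (f x) (?f' x v))" for v
  proof -
    have eq: "(\<Sum>b\<in>Basis. (?f' x v \<bullet> b) *\<^sub>R ?g' (f x) b) = ?g' (f x) (?f' x v)"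
      if "x \<in> S" for x v
    proof -
      have "f x \<in> T" using that Suc.prems(3) by auto
      then have lin: "linear (?g' (f x))"
        using Ck_on_SucD(1)[OF Suc.prems(2)] has_derivative_linear by blast
      have "?g' (f x) (?f' x v) = ?g' (f x) (\<Sum>b\<in>Basis. (?f' x v \<bullet> b) *\<^sub>R b)"
        by (simp add: euclidean_representation)
      then show ?thesis by (simp add: linear_sum[OF lin] linear_cmul[OF lin])
    qed
    have "Ck_on k S (\<lambda>x. \<Sum>b\<in>Basis. (?f' x v \<bullet> b) *\<^sub>R ?g' (f x) b)"
      by (intro Ck_on_sum Ck_on_bounded_bilinear[OF bounded_bilinear_scaleR] assms(1)
          Ck_on_bounded_linear_compose[OF bounded_linear_inner_left] Ck_on_SucD(2)[OF Suc.prems(1)]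
          Suc.IH[OF f Ck_on_SucD(2)[OF Suc.prems(2)] Suc.prems(3)])
    moreover have "Ck_on k S (\<lambda>x. \<Sum>b\<in>Basis. (?f' x v \<bullet> b) *\<^sub>R ?g' (f x) b) \<longleftrightarrow>
        Ck_on k S (\<lambda>x. ?g' (f x) (?f' x v))"
      by (rule Ck_on_cong[OF assms(1)]) (rule eq)
    ultimately show ?thesis by (rule iffD1[rotated])
  qed
  show ?case by (rule Ck_on_SucI[OF assms(1) D C])
qed

lemma smooth_on_imp_continuous_on: "smooth_on S f \<Longrightarrow> continuous_on S f"
  unfolding smooth_on_def using Ck_on.simps(1) by blast

lemma smooth_on_derivative:
  assumes "smooth_on S f"
  shows "\<And>x. x \<in> S \<Longrightarrow> (f has_derivative frechet_derivative f (at x)) (at x)"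
    and "\<And>v. smooth_on S (\<lambda>x. frechet_derivative f (at x) v)"
proof -
  have "Ck_on (Suc k) S f" for k using assms by (simp only: smooth_on_def)
  then show "\<And>x. x \<in> S \<Longrightarrow> (f has_derivative frechet_derivative f (at x)) (at x)"
    and "\<And>v. smooth_on S (\<lambda>x. frechet_derivative f (at x) v)"
    unfolding smooth_on_def using Ck_on_SucD by blast+
qed

lemma smooth_on_subset: "smooth_on S f \<Longrightarrow> T \<subseteq> S \<Longrightarrow> smooth_on T f"
  unfolding smooth_on_def using Ck_on_subset by blast

lemma smooth_on_local:
  assumes "\<And>x. x \<in> S \<Longrightarrow> \<exists>V. open V \<and> x \<in> V \<and> smooth_on V f"
  shows "smooth_on S f"
  using assms unfolding smooth_on_def by (intro allI Ck_on_local) blast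

lemma smooth_on_cong:
  assumes "open S" and "\<And>x. x \<in> S \<Longrightarrow> f x = g x"
  shows "smooth_on S f \<longleftrightarrow> smooth_on S g"
  using Ck_on_cong[OF assms] by (simp add: smooth_on_def)

lemma smooth_on_const: "smooth_on S (\<lambda>x. c)"
  by (simp add: smooth_on_def Ck_on_const)

lemma smooth_on_bounded_linear:
  "bounded_linear L \<Longrightarrow> open S \<Longrightarrow> smooth_on S L"
  by (simp add: smooth_on_def Ck_on_bounded_linear)

lemma smooth_on_bounded_linear_compose:
  "bounded_linear L \<Longrightarrow> open S \<Longrightarrow> smooth_on S f \<Longrightarrow> smooth_on S (\<lambda>x. L (f x))"
  by (simp add: smooth_on_def Ck_on_bounded_linear_compose)

lemma smooth_on_add:
  "open S \<Longrightarrow> smooth_on S f \<Longrightarrow> smooth_on S g \<Longrightarrow> smooth_on S (\<lambda>x. f x + g x)"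
  by (simp add: smooth_on_def Ck_on_add)

lemma smooth_on_bounded_bilinear:
  "bounded_bilinear B \<Longrightarrow> open S \<Longrightarrow> smooth_on S f \<Longrightarrow> smooth_on S g \<Longrightarrow>
    smooth_on S (\<lambda>x. B (f x) (g x))"
  by (simp add: smooth_on_def Ck_on_bounded_bilinear)

lemmas smooth_on_mult = smooth_on_bounded_bilinear[OF bounded_bilinear_mult]
lemmas smooth_on_scaleR = smooth_on_bounded_bilinear[OF bounded_bilinear_scaleR]

lemma smooth_on_diff:
  assumes "open S" "smooth_on S f" "smooth_on S g"
  shows "smooth_on S (\<lambda>x. f x - g x)"
  using smooth_on_add[OF assms(1,2) smooth_on_bounded_linear_compose[OF
      bounded_linear_minus[OF bounded_linear_ident] assms(1,3)]] by simp

lemma smooth_on_compose: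
  "open S \<Longrightarrow> open T \<Longrightarrow> smooth_on S f \<Longrightarrow> smooth_on T g \<Longrightarrow> f ` S \<subseteq> T \<Longrightarrow>
    smooth_on S (\<lambda>x. g (f x))"
  by (simp add: smooth_on_def Ck_on_compose)

lemma smooth_on_Pair:
  assumes "open S" "smooth_on S f" "smooth_on S g"
  shows "smooth_on S (\<lambda>x. (f x, g x))"
  using smooth_on_add[OF assms(1)
      smooth_on_bounded_linear_compose[OF bounded_linear_Pair[OF bounded_linear_ident bounded_linear_zero] assms(1,2)]
      smooth_on_bounded_linear_compose[OF bounded_linear_Pair[OF bounded_linear_zero bounded_linear_ident] assms(1,3)]]
  by simp

lemma affine_imp_smooth_on:
  assumes "open S" shows "smooth_on S (\<lambda>x. a \<bullet> x + b)"
  by (intro smooth_on_add smooth_on_bounded_linear smooth_on_const bounded_linear_inner_right assms)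

lemma Ck_on_SucI_real:
  fixes f :: "real \<Rightarrow> real"
  assumes "open S" "\<And>x. x \<in> S \<Longrightarrow> (f has_real_derivative f' x) (at x)" "Ck_on k S f'"
  shows "Ck_on (Suc k) S f"
proof (rule Ck_on_SucI[OF assms(1)])
  show "(f has_derivative (*) (f' x)) (at x)" if "x \<in> S" for x
    using assms(2)[OF that] by (simp add: has_field_derivative_def)
  show "Ck_on k S (\<lambda>x. f' x * v)" for v
    by (rule Ck_on_bounded_linear_compose[OF bounded_linear_mult_left assms(1,3)])
qed

text \<open>The derivative is a polynomial in the function itself, so that induction on the order of
  differentiability applies.\<close>

lemma smooth_on_inverse: "smooth_on {0<..} (inverse :: real \<Rightarrow> real)"
proof -
  have "Ck_on k {0<..} (inverse :: real \<Rightarrow> real)" for k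
  proof (induction k)
    case 0
    then show ?case by (auto intro!: continuous_intros)
  next
    case (Suc k)
    have "(inverse has_real_derivative - (inverse x * inverse x)) (at x)" if "x \<in> {0<..}" for x :: real
      using that by (auto intro!: derivative_eq_intros simp: power2_eq_square)
    moreover have "Ck_on k {0<..} (\<lambda>x::real. - (inverse x * inverse x))"
      by (intro Ck_on_bounded_linear_compose[OF bounded_linear_minus[OF bounded_linear_ident]]
          Ck_on_bounded_bilinear[OF bounded_bilinear_mult] Suc.IH) auto
    ultimately show ?case by (intro Ck_on_SucI_real) auto
  qed
  then show ?thesis by (simp add: smooth_on_def)
qed

lemma smooth_on_sqrt: "smooth_on {0<..} sqrt"
proof -
  have "Ck_on k {0<..} sqrt" for k
  proof (induction k)
    case 0
    then show ?case by (auto intro!: continuous_intros)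
  next
    case (Suc k)
    have "(sqrt has_real_derivative (inverse (sqrt x) / 2)) (at x)" if "x \<in> {0<..}" for x :: real
      using that by (auto intro!: derivative_eq_intros)
    moreover have "Ck_on k {0<..} (\<lambda>x. inverse (sqrt x) / 2)"
      by (intro Ck_on_bounded_linear_compose[OF bounded_linear_divide]
          Ck_on_compose[of _ "{0<..}" _ sqrt inverse] Suc.IH
          smooth_on_inverse[unfolded smooth_on_def, rule_format]) auto
    ultimately show ?case by (intro Ck_on_SucI_real) auto
  qed
  then show ?thesis by (simp add: smooth_on_def)
qed

lemma smooth_on_divide:
  fixes f g :: "'a::euclidean_space \<Rightarrow> real"
  assumes "open S" "smooth_on S f" "smooth_on S g" "\<And>x. x \<in> S \<Longrightarrow> g x > 0"
  shows "smooth_on S (\<lambda>x. f x / g x)"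
  unfolding divide_inverse
  by (intro smooth_on_mult smooth_on_compose[OF _ _ _ smooth_on_inverse] assms) (use assms in auto)

section \<open>Smooth division by a coordinate\<close>

text \<open>Differentiation under the integral sign costs the integrand one derivative. As \<open>Ck_on\<close> is about two-sided
  derivatives, the integrand is given on a neighbourhood \<open>\<Omega>\<close> of the closed parameter interval.\<close>

lemma Ck_on_parameter_integral:
  fixes K :: "'a::euclidean_space \<Rightarrow> real \<Rightarrow> 'b::euclidean_space"
  assumes "open \<Omega>" "open V" "convex V" "V \<times> {0..1} \<subseteq> \<Omega>"
    and "Ck_on k \<Omega> (\<lambda>(x, s). K x s)"
  shows "Ck_on k V (\<lambda>x. integral {0..1} (K x))"
  using assms(5)
proof (induction k arbitrary: K)
  case 0
  then have "continuous_on (V \<times> cbox 0 1) (\<lambda>(x, s). K x s)"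
    using assms(4) by (auto intro: continuous_on_subset)
  then show ?case using integral_continuous_on_param[of V 0 1 K] by (simp add: cbox_interval)
next
  case (Suc k)
  define K' where "K' x s v = frechet_derivative (\<lambda>(x, s). K x s) (at (x, s)) (v, 0)" for x s v
  have K'_Ck: "Ck_on k \<Omega> (\<lambda>(x, s). K' x s v)" for v
    using Ck_on_SucD(2)[OF Suc.prems, of "(v, 0)"] by (simp add: K'_def case_prod_beta')
  have K': "((\<lambda>x. K x s) has_derivative K' x s) (at x)" if "x \<in> V" "s \<in> {0..1}" for x s
  proof -
    have "(x, s) \<in> \<Omega>" using that assms(4) by auto
    then have *: "((\<lambda>(x, s). K x s) has_derivative frechet_derivative (\<lambda>(x, s). K x s) (at (x, s))) (at (x, s))"
      by (rule Ck_on_SucD(1)[OF Suc.prems])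
    have **: "((\<lambda>x. (x, s)) has_derivative (\<lambda>v. (v, 0))) (at x)"
      by (intro has_derivative_Pair has_derivative_ident has_derivative_const)
    from diff_chain_at[OF ** *] show ?thesis by (simp add: o_def K'_def[abs_def])
  qed
  define L where "L x s = Blinfun (K' x s)" for x s
  have L: "blinfun_apply (L x s) = K' x s" if "x \<in> V" "s \<in> {0..1}" for x s
    unfolding L_def using has_derivative_bounded_linear[OF K'[OF that]] by (rule bounded_linear_Blinfun_apply)
  have contK: "continuous_on (V \<times> {0..1}) (\<lambda>(x, s). K x s)"
    using Ck_on_imp_continuous_on[OF Suc.prems] assms(4) by (rule continuous_on_subset)
  have contK': "continuous_on (V \<times> {0..1}) (\<lambda>(x, s). K' x s v)" for v
    using Ck_on_imp_continuous_on[OF K'_Ck] assms(4) by (rule continuous_on_subset)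
  have contL: "continuous_on (V \<times> cbox 0 1) (\<lambda>(x, s). L x s)"
  proof (rule continuous_on_blinfun_componentwise)
    show "continuous_on (V \<times> cbox 0 1) (\<lambda>p. blinfun_apply (case p of (x, s) \<Rightarrow> L x s) i)" for i
      unfolding cbox_interval using continuous_on_eq[OF contK'[of i]] L by fastforce
  qed
  have intK: "K x integrable_on {0..1}" if "x \<in> V" for x
    using that by (intro integrable_continuous_interval
        continuous_on_compose2[OF contK, of _ "Pair x", simplified]) (auto intro!: continuous_intros)
  have intL: "L x integrable_on {0..1}" if "x \<in> V" for x
    using that by (intro integrable_continuous_interval
        continuous_on_compose2[OF contL, of _ "Pair x", simplified]) (auto intro!: continuous_intros)
  have D: "((\<lambda>x. integral {0..1} (K x)) has_derivative (\<lambda>v. integral {0..1} (\<lambda>s. K' x s v))) (at x)"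
    if x: "x \<in> V" for x
  proof -
    have "((\<lambda>x. integral (cbox 0 1) (K x)) has_derivative integral (cbox 0 1) (L x)) (at x within V)"
      by (rule leibniz_rule[OF _ _ contL x \<open>convex V\<close>])
        (use K' L intK in \<open>auto simp: has_derivative_at_withinI cbox_interval\<close>)
    moreover have "blinfun_apply (integral {0..1} (L x)) v = integral {0..1} (\<lambda>s. K' x s v)" for v
      unfolding blinfun_apply_integral[OF intL[OF x]] by (rule integral_cong) (simp add: L[OF x])
    then have "blinfun_apply (integral {0..1} (L x)) = (\<lambda>v. integral {0..1} (\<lambda>s. K' x s v))"
      by auto
    ultimately show ?thesis using at_within_open[OF x \<open>open V\<close>] by (simp add: cbox_interval)
  qed
  show ?case
    by (rule Ck_on_SucI[OF \<open>open V\<close> D]) (use Suc.IH[OF K'_Ck] in auto)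
qed


text \<open>For $f(x) = a \bullet x + b$ the vector $x - f(x) e$ is the projection of \<open>x\<close> along \<open>e\<close> to the zeros
  of \<open>f\<close>, and the fundamental theorem of calculus on the segment from the projection to \<open>x\<close> gives
  Hadamard's lemma with $u(x) = \int_0^1 \partial_e G(x - s f(x) e)\,ds$. The neighbourhood \<open>V\<close> consists of
  points that lie together with their projection in a ball inside the domain of \<open>G\<close>; by convexity, so
  does the segment.\<close>

lemma Hadamard_division:
  fixes G :: "'a::euclidean_space \<Rightarrow> real"
  assumes "open W" "p \<in> W" "smooth_on W G" "a \<bullet> p + b = 0" "a \<bullet> e = 1"
  obtains V u where "open V" "p \<in> V" "V \<subseteq> W" "smooth_on V u"
    "\<And>x. x \<in> V \<Longrightarrow> x - (a \<bullet> x + b) *\<^sub>R e \<in> W"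
    "\<And>x. x \<in> V \<Longrightarrow> G x - G (x - (a \<bullet> x + b) *\<^sub>R e) = (a \<bullet> x + b) * u x"
proof -
  obtain r where r: "r > 0" "ball p r \<subseteq> W" using assms(1,2) by (meson openE)
  define m where "m = (\<lambda>(x, s::real). x - (s * (a \<bullet> x + b)) *\<^sub>R e)"
  define V where "V = ball p r \<inter> (\<lambda>x. m (x, 1)) -` ball p r"
  have m_smooth: "smooth_on UNIV m"
    unfolding m_def case_prod_beta'
    by (intro smooth_on_diff smooth_on_scaleR smooth_on_mult smooth_on_const smooth_on_add
        smooth_on_bounded_linear_compose[OF bounded_linear_inner_right]
        smooth_on_bounded_linear bounded_linear_fst bounded_linear_snd open_UNIV)
  have m_cont: "continuous_on A m" for A
    using smooth_on_imp_continuous_on[OF m_smooth] continuous_on_subset by blast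
  have "open V" unfolding V_def
    by (intro open_Int open_ball open_vimage continuous_on_compose2[OF m_cont[of UNIV]])
      (auto intro!: continuous_intros)
  have comb: "m (x, s) = (1 - s) *\<^sub>R x + s *\<^sub>R m (x, 1)" for x s
    by (simp add: m_def algebra_simps)
  have "convex V"
  proof -
    have "m ((1 - t) *\<^sub>R x + t *\<^sub>R y, 1) = (1 - t) *\<^sub>R m (x, 1) + t *\<^sub>R m (y, 1)" for x y t
      by (simp add: m_def algebra_simps)
    then show ?thesis
      unfolding V_def convex_alt vimage_def using convexD_alt[OF convex_ball[of p r]] by force
  qed
  define \<Omega> where "\<Omega> = m -` ball p r"
  have "open \<Omega>" unfolding \<Omega>_def by (intro open_vimage open_ball m_cont)
  have VO: "V \<times> {0..1} \<subseteq> \<Omega>"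
  proof clarify
    fix x and s :: real assume "x \<in> V" "s \<in> {0..1}"
    then show "(x, s) \<in> \<Omega>" unfolding \<Omega>_def V_def vimage_def mem_Collect_eq comb[of x s]
      by (intro convexD_alt[OF convex_ball]) auto
  qed
  define G' where "G' x = frechet_derivative G (at x) e" for x
  have G'_smooth: "smooth_on W G'" unfolding G'_def by (rule smooth_on_derivative(2)[OF assms(3)])
  have "Ck_on k \<Omega> (\<lambda>q. G' (m q))" for k
    using smooth_on_compose[OF \<open>open \<Omega>\<close> assms(1) smooth_on_subset[OF m_smooth] G'_smooth] r
    by (auto simp: \<Omega>_def smooth_on_def)
  then have "Ck_on k \<Omega> (\<lambda>(x, s). G' (m (x, s)))" for k by (simp add: case_prod_beta')
  from Ck_on_parameter_integral[OF \<open>open \<Omega>\<close> \<open>open V\<close> \<open>convex V\<close> VO this]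
  have u_smooth: "smooth_on V (\<lambda>x. integral {0..1} (\<lambda>s. G' (m (x, s))))"
    by (simp add: smooth_on_def)
  show thesis
  proof (rule that[OF \<open>open V\<close> _ _ u_smooth])
    show "p \<in> V" using r(1) assms(4) by (simp add: V_def m_def)
    show "V \<subseteq> W" using r(2) by (auto simp: V_def)
    fix x assume x: "x \<in> V"
    show "x - (a \<bullet> x + b) *\<^sub>R e \<in> W" using x r(2) by (auto simp: V_def m_def)
    have "((\<lambda>s. G (m (x, s))) has_vector_derivative - (a \<bullet> x + b) * G' (m (x, s))) (at s within {0..1})"
      if s: "s \<in> {0..1}" for s
    proof -
      have "m (x, s) \<in> ball p r" using subsetD[OF VO, of "(x, s)"] x s by (simp add: \<Omega>_def)
      then have "m (x, s) \<in> W" using r(2) by blast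
      then have D: "(G has_derivative frechet_derivative G (at (m (x, s)))) (at (m (x, s)))"
        by (rule smooth_on_derivative(1)[OF assms(3)])
      have "((\<lambda>s. m (x, s)) has_derivative (\<lambda>h. (h * - (a \<bullet> x + b)) *\<^sub>R e)) (at s)"
      proof -
        define c where "c = - (a \<bullet> x + b)"
        have "bounded_linear (\<lambda>h. (h * c) *\<^sub>R e)"
          by (intro bounded_linear_intros)
        from has_derivative_add[OF has_derivative_const[of x] bounded_linear_imp_has_derivative[OF this]]
        have "((\<lambda>s. x + (s * c) *\<^sub>R e) has_derivative (\<lambda>h. (h * c) *\<^sub>R e)) (at s)" by simp
        moreover have "m (x, s) = x + (s * c) *\<^sub>R e" for s
        proof -
          have "s * c = - (s * (a \<bullet> x + b))" unfolding c_def by (rule mult_minus_right)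
          then show ?thesis by (simp only: m_def prod.case scaleR_minus_left diff_conv_add_uminus)
        qed
        ultimately show ?thesis by (simp only: c_def)
      qed
      from diff_chain_at[OF this D]
      have "((\<lambda>s. G (m (x, s))) has_derivative (\<lambda>h. h *\<^sub>R (- (a \<bullet> x + b) * G' (m (x, s))))) (at s)"
        unfolding o_def linear_cmul[OF has_derivative_linear[OF D]] G'_def[symmetric]
        by (simp only: real_scaleR_def mult.assoc)
      then show ?thesis
        unfolding has_vector_derivative_def by (rule has_derivative_at_withinI)
    qed
    then have "((\<lambda>s. - (a \<bullet> x + b) * G' (m (x, s))) has_integral G (m (x, 1)) - G (m (x, 0))) {0..1}"
      by (intro fundamental_theorem_of_calculus) auto
    then have "integral {0..1} (\<lambda>s. - (a \<bullet> x + b) * G' (m (x, s))) = G (m (x, 1)) - G (m (x, 0))"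
      by (rule integral_unique)
    then have "- (a \<bullet> x + b) * integral {0..1} (\<lambda>s. G' (m (x, s))) = G (m (x, 1)) - G (m (x, 0))"
      by (simp only: integral_mult_right)
    moreover have "m (x, 0) = x" "m (x, 1) = x - (a \<bullet> x + b) *\<^sub>R e" by (simp_all add: m_def)
    ultimately show "G x - G (x - (a \<bullet> x + b) *\<^sub>R e) = (a \<bullet> x + b) * integral {0..1} (\<lambda>s. G' (m (x, s)))"
      by (metis minus_diff_eq mult_minus_left neg_equal_iff_equal)
  qed
qed

section \<open>A reparametrization of the half-line\<close>

text \<open>The functions $t^{-n} e^{-1/t}$, extended by zero to \<open>t \<le> 0\<close>. The powers of \<open>1 / t\<close> are included because they
  arise on differentiation.\<close>

definition flat :: "nat \<Rightarrow> real \<Rightarrow> real" where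
  "flat n t = (if t > 0 then exp (- inverse t) * inverse t ^ n else 0)"

lemma flat_tendsto_0: "((\<lambda>t::real. exp (- inverse t) * inverse t ^ n) \<longlongrightarrow> 0) (at_right 0)"
proof -
  have "((\<lambda>x::real. x ^ n / exp x) \<longlongrightarrow> 0) at_top" by (rule tendsto_power_div_exp_0)
  then have "((\<lambda>x::real. exp (- x) * x ^ n) \<longlongrightarrow> 0) at_top"
    by (simp add: exp_minus divide_inverse mult.commute)
  from filterlim_compose[OF this filterlim_inverse_at_top_right] show ?thesis by simp
qed

lemma flat_has_derivative:
  "(flat n has_real_derivative (flat (n + 2) t - n * flat (n + 1) t)) (at t)"
proof (cases t "0::real" rule: linorder_cases)
  case less
  have "((\<lambda>t. 0) has_real_derivative (flat (n + 2) t - n * flat (n + 1) t)) (at t)"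
    using less by (simp add: flat_def)
  then show ?thesis
    by (rule has_field_derivative_transform_within_open[of _ _ _ "{..<0}"])
      (use less in \<open>auto simp: flat_def\<close>)
next
  case equal
  have "((\<lambda>h. flat n h / h) \<longlongrightarrow> 0) (at 0)"
  proof (rule filterlim_split_at)
    show "((\<lambda>h. flat n h / h) \<longlongrightarrow> 0) (at_left 0)"
      by (rule tendsto_eventually) (auto simp: eventually_at_filter flat_def)
    show "((\<lambda>h. flat n h / h) \<longlongrightarrow> 0) (at_right 0)"
      using flat_tendsto_0[of "Suc n"]
      by (rule Lim_transform_eventually)
        (auto simp: eventually_at_filter flat_def divide_inverse)
  qed
  then show ?thesis by (simp add: equal DERIV_def flat_def)
next
  case greater
  have "((\<lambda>t. exp (- inverse t) * inverse t ^ n) has_real_derivative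
      (exp (- inverse t) * inverse t ^ (n + 2) - n * (exp (- inverse t) * inverse t ^ (n + 1)))) (at t)"
  proof -
    have i: "(inverse has_real_derivative - (inverse t ^ 2)) (at t)"
      using DERIV_inverse[of t] greater by (simp add: numeral_2_eq_2)
    have "real n * inverse t ^ (n - Suc 0) * inverse t ^ 2 = n * inverse t ^ (n + 1)"
      by (cases n) (simp_all add: power2_eq_square)
    then show ?thesis
      by (intro DERIV_cong[OF DERIV_mult[OF DERIV_chain2[OF DERIV_exp DERIV_minus[OF i]] DERIV_power[OF i, of n]]])
        (auto simp: power_add algebra_simps power2_eq_square)
  qed
  then have "((\<lambda>t. exp (- inverse t) * inverse t ^ n) has_real_derivative
      (flat (n + 2) t - n * flat (n + 1) t)) (at t)"
    using greater by (simp add: flat_def)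
  then show ?thesis
    by (rule has_field_derivative_transform_within_open[of _ _ _ "{0<..}"])
      (use greater in \<open>auto simp: flat_def\<close>)
qed

text \<open>The derivative of \<open>flat n\<close> is a combination of functions of the same family; this makes the
  induction work.\<close>

lemma smooth_on_flat: "smooth_on UNIV (flat n)"
proof -
  have "Ck_on k UNIV (flat n)" for k
  proof (induction k arbitrary: n)
    case 0
    show ?case using DERIV_isCont[OF flat_has_derivative]
      by (simp add: continuous_at_imp_continuous_on)
  next
    case (Suc k)
    have "Ck_on k UNIV (\<lambda>t. flat (n + 2) t - n * flat (n + 1) t)"
      using Ck_on_add[OF open_UNIV Suc.IH[of "n + 2"]
          Ck_on_bounded_linear_compose[OF bounded_linear_mult_right[of "- real n"] open_UNIV Suc.IH[of "n + 1"]]]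
      by simp
    then show ?case by (intro Ck_on_SucI_real[OF open_UNIV flat_has_derivative])
  qed
  then show ?thesis by (simp add: smooth_on_def)
qed

text \<open>The derivative of the inverse is again expressed by the inverse, which makes the inverse of a smooth
  bijection with positive derivative smooth by induction.\<close>

lemma smooth_on_real_inverse:
  fixes f g :: "real \<Rightarrow> real"
  assumes "smooth_on UNIV f" "\<And>t. (f has_real_derivative f' t) (at t)" "\<And>t. f' t > 0"
    and "\<And>t. g (f t) = t" "\<And>t. f (g t) = t"
  shows "smooth_on UNIV g"
proof -
  have f'_smooth: "smooth_on UNIV f'"
  proof -
    have "frechet_derivative f (at t) 1 = f' t" for t
      using frechet_derivative_at[of f "(*) (f' t)" t] assms(2)[of t]
      by (metis has_field_derivative_def mult.right_neutral)
    then show ?thesis using smooth_on_derivative(2)[OF assms(1), of 1] by simp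
  qed
  have "continuous_on UNIV f" by (rule smooth_on_imp_continuous_on[OF assms(1)])
  then have cont_f: "isCont f t" for t by (simp add: continuous_on_eq_continuous_at)
  have cont_g: "isCont g t" for t
    using isCont_inverse_function[of 1 "g t" g f] assms(4,5) cont_f by simp
  have D: "(g has_real_derivative inverse (f' (g t))) (at t)" for t
    by (rule DERIV_inverse_function[where a = "t - 1" and b = "t + 1", OF assms(2)])
      (use assms(3)[of "g t"] assms(5) cont_g in auto)
  have "Ck_on k UNIV g" for k
  proof (induction k)
    case 0
    show ?case using cont_g by (simp add: continuous_at_imp_continuous_on)
  next
    case (Suc k)
    have "Ck_on k UNIV (\<lambda>t. inverse (f' (g t)))"
    proof (rule Ck_on_compose[of _ "{0<..}" k "\<lambda>t. f' (g t)" inverse])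
      show "Ck_on k UNIV (\<lambda>t. f' (g t))"
        by (rule Ck_on_compose[OF open_UNIV open_UNIV Suc.IH])
          (use f'_smooth in \<open>auto simp: smooth_on_def\<close>)
    qed (use smooth_on_inverse assms(3) in \<open>auto simp: smooth_on_def\<close>)
    then show ?case by (rule Ck_on_SucI_real[OF open_UNIV D])
  qed
  then show ?thesis by (simp add: smooth_on_def)
qed

text \<open>The function \<open>\<theta> t = t - C exp (- 1 / (L - t))\<close> (for \<open>t < L\<close>) is the identity minus a
  decreasing function, so its derivative is at least one; \<open>C\<close> is chosen so that \<open>\<theta> 1 = 0\<close>.\<close>

lemma reparametrization:
  fixes L :: real
  assumes "L > 1"
  obtains \<theta> \<theta>i :: "real \<Rightarrow> real" where "smooth_on UNIV \<theta>" "smooth_on UNIV \<theta>i"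
    "\<And>t. \<theta>i (\<theta> t) = t" "\<And>t. \<theta> (\<theta>i t) = t" "strict_mono \<theta>" "\<theta> 1 = 0"
    "\<And>t. t \<ge> L \<Longrightarrow> \<theta> t = t" "\<And>t. \<theta> t \<le> t"
proof -
  define C where "C = inverse (flat 0 (L - 1))"
  define \<theta> where "\<theta> t = t - C * flat 0 (L - t)" for t
  have C: "C > 0" "C * flat 0 (L - 1) = 1" using assms by (auto simp: C_def flat_def)
  have flat_nonneg: "flat n t \<ge> 0" for n t by (simp add: flat_def)
  have smooth: "smooth_on UNIV \<theta>"
    unfolding \<theta>_def
    by (intro smooth_on_diff smooth_on_mult smooth_on_const smooth_on_bounded_linear
        smooth_on_compose[OF _ _ _ smooth_on_flat]) (auto intro: bounded_linear_ident)
  define \<theta>' where "\<theta>' t = 1 + C * flat 2 (L - t)" for t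
  have D: "(\<theta> has_real_derivative \<theta>' t) (at t)" for t
    unfolding \<theta>_def \<theta>'_def
    by (rule derivative_eq_intros DERIV_chain'[OF _ flat_has_derivative] refl)+ (simp add: numeral_2_eq_2)
  have pos: "\<theta>' t > 0" for t
    using C(1) flat_nonneg[of 2 "L - t"] by (simp add: \<theta>'_def add_pos_nonneg)
  have le: "\<theta> t \<le> t" for t using C(1) flat_nonneg[of 0 "L - t"] by (simp add: \<theta>_def)
  have id: "\<theta> t = t" if "t \<ge> L" for t using that by (simp add: \<theta>_def flat_def)
  have mono: "strict_mono \<theta>"
    by (rule strict_monoI) (use DERIV_pos_imp_increasing[of _ _ \<theta>] D pos in blast)
  have "surj \<theta>"
    unfolding surj_def
  proof
    fix y
    have "continuous_on UNIV \<theta>" by (rule smooth_on_imp_continuous_on[OF smooth])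
    then have "continuous_on {min y L..max y L} \<theta>" by (rule continuous_on_subset) simp
    then have "\<exists>x\<ge>min y L. x \<le> max y L \<and> \<theta> x = y"
      using le[of "min y L"] id[of "max y L"] IVT'[of \<theta> "min y L" y "max y L"] by force
    then show "\<exists>x. y = \<theta> x" by auto
  qed
  have inj: "inj \<theta>" using strict_mono_imp_inj_on[OF mono] .
  have i1: "inv \<theta> (\<theta> t) = t" and i2: "\<theta> (inv \<theta> t) = t" for t
    using inj \<open>surj \<theta>\<close> by (simp_all add: surj_f_inv_f)
  show thesis
    by (rule that[OF smooth smooth_on_real_inverse[OF smooth D pos i1 i2] i1 i2 mono _ id le])
      (use C in \<open>simp_all add: \<theta>_def\<close>)
qed

section \<open>Convex polygons\<close>

lemma polygon_properties:
  assumes "polygon P"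
  shows polygon_compact: "compact P" and polygon_convex: "convex P" and polygon_closed: "closed P"
    and polygon_polyhedron: "polyhedron P" and polygon_interior: "interior P \<noteq> {}"
    and polygon_rel_interior: "rel_interior P = interior P"
proof -
  have P: "polytope P" "aff_dim P = 2" using assms by (simp_all add: polygon_def)
  show "compact P" "convex P" "polyhedron P" "closed P"
    using P(1) by (simp_all add: polytope_imp_compact polytope_imp_convex polytope_imp_polyhedron
        polytope_imp_closed)
  show *: "rel_interior P = interior P" by (rule interior_rel_interior) (simp add: P)
  have "P \<noteq> {}" using P(2) by auto
  then show "interior P \<noteq> {}" using * \<open>convex P\<close> rel_interior_eq_empty by metis
qed

lemma edge_of_polygon_iff_facet:
  assumes "polygon P" shows "E edge_of P \<longleftrightarrow> E facet_of P"
  using assms by (auto simp: polygon_def edge_of_def facet_of_def)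

lemma finite_edges: "polygon P \<Longrightarrow> finite {E. E edge_of P}"
  using finite_polyhedron_facets[OF polygon_polyhedron] by (simp add: edge_of_polygon_iff_facet)

lemma edge_nontrivial: "E edge_of P \<Longrightarrow> \<exists>x\<in>E. x \<noteq> v"
proof (rule ccontr)
  assume "E edge_of P" and "\<not> (\<exists>x\<in>E. x \<noteq> v)"
  then have "aff_dim E = 1" "E \<subseteq> {v}" by (auto simp: edge_of_def)
  then show False using aff_dim_subset[of E "{v}"] by simp
qed

lemma frontier_point_in_edge:
  assumes "polygon P" "x \<in> P" "x \<notin> interior P"
  obtains E where "E edge_of P" "x \<in> E"
  using rel_boundary_of_polyhedron[OF polygon_polyhedron[OF assms(1)]] assms(2,3)
    polygon_rel_interior[OF assms(1)] edge_of_polygon_iff_facet[OF assms(1)] by blast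

lemma edge_function_affine:
  assumes "edge_function P E f" "u + v = 1"
  shows "f (u *\<^sub>R x + v *\<^sub>R y) = u * f x + v * f y"
proof -
  obtain a b where f: "f = (\<lambda>x. a \<bullet> x + b)" using assms(1) by (auto simp: edge_function_def)
  have "b = (u + v) * b" using assms(2) by simp
  then show ?thesis by (simp add: f inner_add_right algebra_simps)
qed

lemma edge_function_affine3:
  assumes "edge_function P E f" "u + v + t = 1"
  shows "f (u *\<^sub>R x + v *\<^sub>R y + t *\<^sub>R z) = u * f x + v * f y + t * f z"
proof -
  obtain a b where f: "f = (\<lambda>x. a \<bullet> x + b)" using assms(1) by (auto simp: edge_function_def)
  have "b = (u + v + t) * b" using assms(2) by simp
  then show ?thesis by (simp add: f inner_add_right algebra_simps)
qed

lemma edge_function_continuous: "edge_function P E f \<Longrightarrow> continuous_on S f"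
  by (auto simp: edge_function_def intro!: continuous_intros)

lemma edge_function_exists:
  assumes "polygon P" "E edge_of P"
  shows "\<exists>f. edge_function P E f"
proof -
  have "E facet_of P" using assms edge_of_polygon_iff_facet by blast
  with polygon_polyhedron[OF assms(1)] obtain a b where
    ab: "P \<subseteq> {x. a \<bullet> x \<le> b}" "E = P \<inter> {x. a \<bullet> x = b}" by (rule facet_of_polyhedron)
  have "E \<noteq> P" "E face_of P"
    using assms by (auto simp: edge_of_def polygon_def)
  then have "E \<inter> interior P = {}" by (intro face_of_disjoint_interior)
  then have "(- a) \<bullet> x + b > 0" if "x \<in> interior P" for x
    using that ab interior_subset[of P] by force
  then have "edge_function P E (\<lambda>x. (- a) \<bullet> x + b)"
    unfolding edge_function_def using ab(2) by (intro conjI exI[of _ "- a"] exI[of _ b]) auto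
  then show ?thesis by blast
qed

text \<open>A polygon is the closure of its interior, where \<open>f\<close> is positive.\<close>

lemma edge_function_nonneg:
  assumes "polygon P" "edge_function P E f" "x \<in> P"
  shows "f x \<ge> 0"
proof -
  have "closed {x. 0 \<le> f x}"
    by (intro closed_Collect_le continuous_on_const edge_function_continuous[OF assms(2)])
  moreover have "interior P \<subseteq> {x. 0 \<le> f x}" using assms(2) by (auto simp: edge_function_def less_imp_le)
  ultimately have "closure (interior P) \<subseteq> {x. 0 \<le> f x}" by (rule closure_minimal[rotated])
  moreover have "x \<in> closure (interior P)"
    using convex_closure_interior[OF polygon_convex polygon_interior] assms closure_subset by blast
  ultimately show ?thesis by blast
qed

lemma face_of_affine_zeros:
  assumes "convex S" "f = (\<lambda>x. a \<bullet> x + b)" "\<And>x. x \<in> S \<Longrightarrow> f x \<ge> 0"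
  shows "{x \<in> S. f x = 0} face_of S"
proof -
  have "(S \<inter> {x. a \<bullet> x = - b}) face_of S"
    by (rule face_of_Int_supporting_hyperplane_ge[OF assms(1)])
      (use assms(2,3) in fastforce)
  moreover have "{x \<in> S. f x = 0} = S \<inter> {x. a \<bullet> x = - b}"
    by (auto simp: assms(2) eq_neg_iff_add_eq_0)
  ultimately show ?thesis by simp
qed

text \<open>The zeros of \<open>f\<close> in \<open>P\<close> form a proper face of \<open>P\<close> that contains \<open>E\<close>, so that both have dimension one.\<close>

lemma edge_function_zero_iff:
  assumes "polygon P" "E edge_of P" "edge_function P E f" "x \<in> P"
  shows "f x = 0 \<longleftrightarrow> x \<in> E"
proof -
  define C where "C = {x \<in> P. f x = 0}"
  have C: "C face_of P"
    using assms(3) face_of_affine_zeros[OF polygon_convex[OF assms(1)] _ edge_function_nonneg[OF assms(1,3)]]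
    unfolding C_def edge_function_def by auto
  obtain z where "z \<in> interior P" using polygon_interior[OF assms(1)] by blast
  then have "z \<in> P" "z \<notin> C" using assms(3) interior_subset by (auto simp: C_def edge_function_def)
  then have dC: "aff_dim C < 2"
    using face_of_aff_dim_lt[OF polygon_convex[OF assms(1)] C] assms(1) by (auto simp: polygon_def)
  have "E \<subseteq> C"
    using assms(2,3) edge_of_imp_subset by (auto simp: C_def edge_function_def)
  then have "E face_of C"
    using assms(2) C by (auto simp: edge_of_def C_def intro: face_of_subset)
  then have "E = C"
    using face_of_aff_dim_lt[OF face_of_imp_convex[OF C], of E] dC assms(2) by (auto simp: edge_of_def)
  then show ?thesis using assms(4) by (auto simp: C_def)
qed

lemma edge_function_pos_iff:
  assumes "polygon P" "E edge_of P" "edge_function P E f" "x \<in> P"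
  shows "f x > 0 \<longleftrightarrow> x \<notin> E"
  using edge_function_zero_iff[OF assms] edge_function_nonneg[OF assms(1,3,4)] by auto

text \<open>A segment from an interior point to a point outside leaves the polygon through an edge,
  whose edge function is then negative at the outer end.\<close>

lemma polygon_eq_halfplanes:
  assumes "polygon P" "\<And>E. E edge_of P \<Longrightarrow> edge_function P E (fe E)"
  shows "x \<in> P \<longleftrightarrow> (\<forall>E. E edge_of P \<longrightarrow> fe E x \<ge> 0)"
proof (intro iffI allI impI)
  show "fe E x \<ge> 0" if "x \<in> P" "E edge_of P" for E
    using edge_function_nonneg assms that by blast
next
  assume pos: "\<forall>E. E edge_of P \<longrightarrow> fe E x \<ge> 0"
  show "x \<in> P"
  proof (rule ccontr)
    assume x: "x \<notin> P"
    obtain y where y: "y \<in> interior P" using polygon_interior[OF assms(1)] by blast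
    then have "y \<in> P" using interior_subset by blast
    then have "closed_segment y x \<inter> frontier P \<noteq> {}"
      using x by (intro connected_Int_frontier connected_segment) auto
    then obtain z where z: "z \<in> closed_segment y x" "z \<in> P" "z \<notin> interior P"
      using polygon_closed[OF assms(1)] by (auto simp: frontier_def)
    then obtain t where t: "0 \<le> t" "t \<le> 1" "z = (1 - t) *\<^sub>R y + t *\<^sub>R x"
      by (auto simp: closed_segment_def)
    have "t \<noteq> 1" using z(2) x t(3) by auto
    obtain E where E: "E edge_of P" "z \<in> E" by (rule frontier_point_in_edge[OF assms(1) z(2,3)])
    have "0 = fe E z" using edge_function_zero_iff[OF assms(1) E(1) assms(2)[OF E(1)] z(2)] E(2) by simp
    also have "\<dots> = (1 - t) * fe E y + t * fe E x"
      unfolding t(3) by (rule edge_function_affine[OF assms(2)[OF E(1)]]) simp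
    also have "\<dots> > 0"
    proof -
      have "fe E y > 0" using assms(2)[OF E(1)] y by (auto simp: edge_function_def)
      then show ?thesis
        using pos E(1) t(1,2) \<open>t \<noteq> 1\<close> by (intro add_pos_nonneg mult_pos_pos mult_nonneg_nonneg) auto
    qed
    finally show False by simp
  qed
qed

text \<open>If the gradients of the edge functions of two edges that meet were parallel, the functions
  would be positively proportional, since both are positive in the interior, and the edges would
  coincide.\<close>

lemma corner_coordinates:
  assumes "polygon P" "E edge_of P" "E' edge_of P" "E \<noteq> E'" "v \<in> E" "v \<in> E'"
    and "edge_function P E f" "edge_function P E' f'"
  obtains a b a' b' e e' where "f = (\<lambda>x. a \<bullet> x + b)" "f' = (\<lambda>x. a' \<bullet> x + b')"
    "a \<bullet> e = 1" "a \<bullet> e' = 0" "a' \<bullet> e = 0" "a' \<bullet> e' = 1"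
    "\<And>x. x = v + f x *\<^sub>R e + f' x *\<^sub>R e'"
proof -
  obtain a b a' b' where f: "f = (\<lambda>x. a \<bullet> x + b)" and f': "f' = (\<lambda>x. a' \<bullet> x + b')"
    using assms(7,8) by (auto simp: edge_function_def)
  define D where "D = a $ 1 * a' $ 2 - a $ 2 * a' $ 1"
  have v0: "f v = 0" "f' v = 0" using assms(5-8) by (auto simp: edge_function_def)
  have fx: "f x = a $ 1 * (x $ 1 - v $ 1) + a $ 2 * (x $ 2 - v $ 2)"
    and f'x: "f' x = a' $ 1 * (x $ 1 - v $ 1) + a' $ 2 * (x $ 2 - v $ 2)" for x
    using v0 by (simp_all add: f f' inner_vec_def sum_2 algebra_simps)
  have "D \<noteq> 0"
  proof
    assume D: "D = 0"
    obtain y where y: "y \<in> interior P" using polygon_interior[OF assms(1)] by blast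
    then have pos: "f y > 0" "f' y > 0" using assms(7,8) by (auto simp: edge_function_def)
    have "f' y * f x = f y * f' x" for x
    proof -
      have "f' y * f x - f y * f' x =
          D * ((y $ 2 - v $ 2) * (x $ 1 - v $ 1) - (y $ 1 - v $ 1) * (x $ 2 - v $ 2))"
        unfolding fx f'x D_def by (simp add: algebra_simps)
      then show ?thesis using D by simp
    qed
    then have "f x = 0 \<longleftrightarrow> f' x = 0" for x using pos by (metis mult_eq_0_iff less_irrefl)
    then have "E \<subseteq> E'" "E' \<subseteq> E"
      using edge_function_zero_iff[OF assms(1,2,7)] edge_function_zero_iff[OF assms(1,3,8)]
        edge_of_imp_subset[OF assms(2)] edge_of_imp_subset[OF assms(3)] by blast+
    then show False using assms(4) by blast
  qed
  define e :: "real ^ 2" where "e = vector [a' $ 2 / D, - a' $ 1 / D]"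
  define e' :: "real ^ 2" where "e' = vector [- a $ 2 / D, a $ 1 / D]"
  show thesis
  proof (rule that[OF f f'])
    show "a \<bullet> e = 1" "a \<bullet> e' = 0" "a' \<bullet> e = 0" "a' \<bullet> e' = 1"
      using \<open>D \<noteq> 0\<close> by (simp_all add: e_def e'_def inner_vec_def sum_2 field_simps) (simp_all add: D_def algebra_simps)
    show "x = v + f x *\<^sub>R e + f' x *\<^sub>R e'" for x
    proof -
      have "D * (x $ 1 - v $ 1) = f x * a' $ 2 - f' x * a $ 2"
        "D * (x $ 2 - v $ 2) = - f x * a' $ 1 + f' x * a $ 1"
        unfolding fx f'x D_def by (simp_all add: algebra_simps)
      then show ?thesis using \<open>D \<noteq> 0\<close>
        by (simp add: vec_eq_iff forall_2 e_def e'_def field_simps)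
    qed
  qed
qed

lemma edges_meet_at_most_once:
  assumes "polygon P" "E edge_of P" "E' edge_of P" "E \<noteq> E'"
    and "x \<in> E" "x \<in> E'" "y \<in> E" "y \<in> E'"
  shows "x = y"
proof -
  obtain f f' where f: "edge_function P E f" "edge_function P E' f'"
    using edge_function_exists[OF assms(1,2)] edge_function_exists[OF assms(1,3)] by metis
  obtain e e' where "\<And>y. y = x + f y *\<^sub>R e + f' y *\<^sub>R e'"
    using corner_coordinates[OF assms(1-6) f] by metis
  from this[of y] show ?thesis using f assms(7,8) by (simp add: edge_function_def)
qed

lemma edges_meet_in_extreme_point:
  assumes "polygon P" "E edge_of P" "E' edge_of P" "E \<noteq> E'" "v \<in> E" "v \<in> E'"
  shows "v extreme_point_of P"
proof -
  have "E \<inter> E' = {v}" using edges_meet_at_most_once[OF assms(1-4)] assms(5,6) by blast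
  moreover have "(E \<inter> E') face_of P" using assms(2,3) by (auto simp: edge_of_def intro: face_of_Int)
  ultimately show ?thesis by (simp add: face_of_singleton)
qed

text \<open>In the coordinates \<open>(f, f')\<close> of the corner of \<open>E\<close> and \<open>E'\<close>, the edge function of a third edge
  through \<open>v\<close> is \<open>\<alpha> f + \<beta> f'\<close>. Its values on \<open>E\<close> and \<open>E'\<close> would show \<open>\<alpha>, \<beta> > 0\<close>, so that it would vanish only at
  \<open>v\<close>.\<close>

lemma at_most_two_edges_at_point:
  assumes "polygon P" "E edge_of P" "E' edge_of P" "E'' edge_of P" "E \<noteq> E'"
    and "v \<in> E" "v \<in> E'" "v \<in> E''"
  shows "E'' = E \<or> E'' = E'"
proof (rule ccontr)
  assume "\<not> ?thesis"
  then have ne: "E'' \<noteq> E" "E'' \<noteq> E'" by auto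
  obtain f f' f'' where f: "edge_function P E f" "edge_function P E' f'" "edge_function P E'' f''"
    using edge_function_exists[OF assms(1,2)] edge_function_exists[OF assms(1,3)]
      edge_function_exists[OF assms(1,4)] by metis
  obtain e e' where x: "\<And>x. x = v + f x *\<^sub>R e + f' x *\<^sub>R e'"
    using corner_coordinates[OF assms(1-3,5-7) f(1,2)] by metis
  obtain a b where f'': "f'' = (\<lambda>x. a \<bullet> x + b)" using f(3) by (auto simp: edge_function_def)
  define \<alpha> \<beta> where "\<alpha> = a \<bullet> e" and "\<beta> = a \<bullet> e'"
  have "f'' v = 0" using f(3) assms(8) by (auto simp: edge_function_def)
  then have comb: "f'' x = \<alpha> * f x + \<beta> * f' x" for x
  proof -
    have "f'' (v + f x *\<^sub>R e + f' x *\<^sub>R e') = f'' v + \<alpha> * f x + \<beta> * f' x"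
      by (simp add: f'' \<alpha>_def \<beta>_def inner_add_right)
    then show ?thesis using x[of x] \<open>f'' v = 0\<close> by simp
  qed
  have sub: "E \<subseteq> P" "E' \<subseteq> P" "E'' \<subseteq> P" using assms(2-4) edge_of_imp_subset by auto
  note pos = edge_function_pos_iff[OF assms(1,2) f(1)] edge_function_pos_iff[OF assms(1,3) f(2)]
    edge_function_pos_iff[OF assms(1,4) f(3)]
  obtain y where y: "y \<in> E" "y \<noteq> v" using edge_nontrivial[OF assms(2)] by blast
  obtain y' where y': "y' \<in> E'" "y' \<noteq> v" using edge_nontrivial[OF assms(3)] by blast
  obtain y'' where y'': "y'' \<in> E''" "y'' \<noteq> v" using edge_nontrivial[OF assms(4)] by blast
  have once: "F = F'" if "F edge_of P" "F' edge_of P" "v \<in> F" "v \<in> F'" "x \<in> F" "x \<in> F'" "x \<noteq> v" for F F' x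
    using edges_meet_at_most_once[OF assms(1)] that by blast
  have "y \<notin> E'" "y \<notin> E''" using once[of E E' y] once[of E E'' y] y assms(2-8) ne by auto
  then have "f y = 0" "f' y > 0" "f'' y > 0"
    using y(1) f(1) pos sub by (auto simp: edge_function_def)
  then have "\<beta> > 0" using comb[of y] by (simp add: zero_less_mult_iff)
  have "y' \<notin> E" "y' \<notin> E''" using once[of E E' y'] once[of E' E'' y'] y' assms(2-8) ne by auto
  then have "f' y' = 0" "f y' > 0" "f'' y' > 0"
    using y'(1) f(2) pos sub by (auto simp: edge_function_def)
  then have "\<alpha> > 0" using comb[of y'] by (simp add: zero_less_mult_iff)
  have "y'' \<notin> E" "y'' \<notin> E'" using once[of E E'' y''] once[of E' E'' y''] y'' assms(2-8) ne by auto
  then have "f y'' > 0" "f' y'' > 0" "f'' y'' = 0"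
    using y''(1) f(3) pos sub by (auto simp: edge_function_def)
  moreover from this have "\<alpha> * f y'' + \<beta> * f' y'' > 0"
    using \<open>\<alpha> > 0\<close> \<open>\<beta> > 0\<close> by (intro add_pos_pos mult_pos_pos)
  ultimately show False using comb[of y''] by simp
qed

text \<open>If \<open>E\<close> were the only edge at its end point \<open>v\<close>, it could be prolonged beyond \<open>v\<close> inside the
  polygon.\<close>

lemma second_edge_at_end_point:
  assumes "polygon P" "E edge_of P" "v extreme_point_of E"
  obtains E' where "E' edge_of P" "E' \<noteq> E" "v \<in> E'"
proof (rule ccontr)
  assume "\<not> thesis"
  with that have only: "v \<notin> E'" if "E' edge_of P" "E' \<noteq> E" for E' using that by blast
  have "\<forall>F. \<exists>f. F edge_of P \<longrightarrow> edge_function P F f" using edge_function_exists[OF assms(1)] by blast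
  then obtain fe where fe: "F edge_of P \<Longrightarrow> edge_function P F (fe F)" for F by metis
  obtain y where y: "y \<in> E" "y \<noteq> v" using edge_nontrivial[OF assms(2)] by blast
  have vE: "v \<in> E" using assms(3) by (simp add: extreme_point_of_def)
  then have "v \<in> P" using assms(2) edge_of_imp_subset by blast
  define z where "z t = v + t *\<^sub>R (v - y)" for t
  have z: "z t = (1 + t) *\<^sub>R v + (- t) *\<^sub>R y" for t by (simp add: z_def algebra_simps)
  have "eventually (\<lambda>t. fe F (z t) > 0) (at_right 0)" if "F \<in> {F. F edge_of P} - {E}" for F
  proof -
    have "fe F v > 0" using that edge_function_pos_iff[OF assms(1) _ fe \<open>v \<in> P\<close>] only by auto
    moreover have "((\<lambda>t. fe F (z t)) \<longlongrightarrow> fe F (z 0)) (at_right 0)"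
    proof -
      have "continuous_on UNIV (\<lambda>t. fe F (z t))"
      proof (rule continuous_on_compose2[of UNIV "fe F"])
        show "continuous_on UNIV (fe F)" using that edge_function_continuous[OF fe] by blast
      qed (auto simp: z_def intro!: continuous_intros)
      then have "isCont (\<lambda>t. fe F (z t)) 0" by (simp add: continuous_on_eq_continuous_at)
      then show ?thesis by (simp add: isCont_def filterlim_at_split)
    qed
    ultimately show ?thesis by (simp add: order_tendstoD(1) z_def)
  qed
  then have "eventually (\<lambda>t. \<forall>F\<in>{F. F edge_of P} - {E}. fe F (z t) > 0) (at_right 0)"
    using finite_edges[OF assms(1)] by (simp add: eventually_ball_finite)
  moreover have "eventually (\<lambda>t. t > 0) (at_right (0::real))" by (simp add: eventually_at_right_less)
  ultimately have "eventually (\<lambda>t. t > 0 \<and> (\<forall>F\<in>{F. F edge_of P} - {E}. fe F (z t) > 0)) (at_right 0)"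
    by eventually_elim auto
  then obtain t where t: "t > 0" "\<And>F. F edge_of P \<Longrightarrow> F \<noteq> E \<Longrightarrow> fe F (z t) > 0"
    using eventually_happens'[OF trivial_limit_at_right_real] by blast
  have "fe E (z t) = 0"
    unfolding z using edge_function_affine[OF fe[OF assms(2)], of "1 + t" "- t" v y] y(1) vE fe[OF assms(2)]
    by (simp add: edge_function_def)
  moreover from this have "z t \<in> P"
    using t(2) by (subst polygon_eq_halfplanes[OF assms(1), of fe]) (metis fe less_imp_le order_refl)+
  ultimately have "z t \<in> E" using edge_function_zero_iff[OF assms(1,2) fe[OF assms(2)]] by blast
  moreover have "v \<in> open_segment y (z t)"
  proof -
    define u where "u = 1 / (1 + t)"
    have "u > 0" "u < 1" "u * (1 + t) = 1" using t(1) by (auto simp: u_def)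
    have "(1 - u) *\<^sub>R y + u *\<^sub>R z t = ((1 - u) - u * t) *\<^sub>R y + (u * (1 + t)) *\<^sub>R v"
      unfolding z by (simp add: algebra_simps)
    also have "\<dots> = v" using \<open>u * (1 + t) = 1\<close> by (simp add: algebra_simps)
    finally have "v = (1 - u) *\<^sub>R y + u *\<^sub>R z t" by simp
    moreover have "y \<noteq> z t"
    proof
      assume "y = z t"
      then have "(1 + t) *\<^sub>R (y - v) = 0" by (simp add: z_def algebra_simps)
      then show False using t(1) y(2) by simp
    qed
    ultimately show ?thesis using \<open>u > 0\<close> \<open>u < 1\<close> by (auto simp: in_segment)
  qed
  ultimately show False using assms(3) y(1) by (auto simp: extreme_point_of_def)
qed

lemma edge_eq_segment:
  assumes "polygon P" "E edge_of P"
  obtains x y where "x \<noteq> y" "E = closed_segment x y"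
proof -
  have "E face_of P" "aff_dim E = 1" using assms(2) by (auto simp: edge_of_def)
  then have "compact E" "convex E" "collinear E" "E \<noteq> {}"
    using face_of_imp_compact polygon_compact[OF assms(1)] polygon_convex[OF assms(1)]
      face_of_imp_convex by (auto simp: collinear_aff_dim)
  then obtain x y where E: "E = closed_segment x y" using compact_convex_collinear_segment by metis
  have "x \<noteq> y" using \<open>aff_dim E = 1\<close> E by auto
  then show thesis using E that by blast
qed

text \<open>The two end points of \<open>E\<close> cannot both lie in \<open>E2\<close>, as distinct edges meet at most once.\<close>

lemma vertex_off_edge:
  assumes "polygon P" "E edge_of P" "E2 edge_of P" "E \<noteq> E2"
  obtains v E' where "v \<in> E" "v \<notin> E2" "E' edge_of P" "E' \<noteq> E" "v \<in> E'"
proof -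
  obtain x y where xy: "x \<noteq> y" "E = closed_segment x y" by (rule edge_eq_segment[OF assms(1,2)])
  then have "\<not> (x \<in> E2 \<and> y \<in> E2)" using edges_meet_at_most_once[OF assms] by auto
  then obtain v where "v = x \<or> v = y" "v \<notin> E2" by blast
  then have "v extreme_point_of E" "v \<in> E" using xy(2) by (auto simp: extreme_point_of_segment)
  then show thesis using second_edge_at_end_point[OF assms(1,2)] that \<open>v \<notin> E2\<close> by metis
qed

lemma vertex_nbhd_iff:
  "p \<in> vertex_nbhd P v \<longleftrightarrow> p \<in> P \<and> (\<forall>E. E edge_of P \<longrightarrow> p \<in> E \<longrightarrow> v \<in> E)"
  by (auto simp: vertex_nbhd_def)

text \<open>Off \<open>E2\<close>, a point is a vertex itself, or lies inside an edge that has a vertex off \<open>E2\<close>, or lies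
  in the interior, where any vertex off \<open>E2\<close> will do.\<close>

lemma vertex_nbhds_cover:
  assumes "polygon P" "E1 edge_of P" "E2 edge_of P" "E1 \<noteq> E2" "p \<in> P" "p \<notin> E2"
  obtains v E E' where "p \<in> vertex_nbhd P v" "v \<notin> E2" "E edge_of P" "E' edge_of P" "E \<noteq> E'"
    "v \<in> E" "v \<in> E'"
proof (cases "\<exists>E. E edge_of P \<and> p \<in> E")
  case True
  then obtain E where E: "E edge_of P" "p \<in> E" by blast
  show ?thesis
  proof (cases "\<exists>E'. E' edge_of P \<and> E' \<noteq> E \<and> p \<in> E'")
    case True
    then obtain E' where "E' edge_of P" "E' \<noteq> E" "p \<in> E'" by blast
    then show ?thesis
      using that[of p E E'] E assms(5,6) by (auto simp: vertex_nbhd_iff)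
  next
    case False
    have "E \<noteq> E2" using E(2) assms(6) by blast
    then obtain v E' where "v \<in> E" "v \<notin> E2" "E' edge_of P" "E' \<noteq> E" "v \<in> E'"
      using vertex_off_edge[OF assms(1) E(1) assms(3)] by blast
    then show ?thesis
      using that[of v E E'] E assms(5) False by (auto simp: vertex_nbhd_iff)
  qed
next
  case False
  obtain v E' where "v \<in> E1" "v \<notin> E2" "E' edge_of P" "E' \<noteq> E1" "v \<in> E'"
    using vertex_off_edge[OF assms(1-4)] by blast
  then show ?thesis
    using that[of v E1 E'] assms(2,5) False by (auto simp: vertex_nbhd_iff)
qed

text \<open>A point in the relative interior of an edge lies on the boundary of \<open>S\<close>, so that one of the functions
  vanishes there, and then on the whole edge. Its zeros form a face of dimension at most one.\<close>

lemma edges_of_halfplane_intersection: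
  assumes "polygon S" "\<And>x. x \<in> S \<longleftrightarrow> (\<forall>i\<in>I. f i x \<ge> 0)" "finite I"
    and "\<And>i. i \<in> I \<Longrightarrow> \<exists>a b. f i = (\<lambda>x. a \<bullet> x + b)" "\<And>i. i \<in> I \<Longrightarrow> \<exists>x\<in>S. f i x > 0"
    and "C edge_of S"
  obtains i where "i \<in> I" "C = {x \<in> S. f i x = 0}"
proof -
  have C: "C face_of S" "aff_dim C = 1" "convex C" "C \<subseteq> S"
    using assms(6) edge_of_imp_subset by (auto simp: edge_of_def face_of_imp_convex)
  have "C \<noteq> {}" using C(2) by auto
  then obtain x where x: "x \<in> rel_interior C" using C(3) rel_interior_eq_empty by blast
  then have "x \<in> C" using rel_interior_subset by blast
  have cont: "continuous_on UNIV (f i)" if "i \<in> I" for i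
    using assms(4)[OF that] by (auto intro!: continuous_intros)
  have "\<exists>i\<in>I. f i x = 0"
  proof (rule ccontr)
    assume "\<not> ?thesis"
    then have pos: "\<forall>i\<in>I. f i x > 0" using \<open>x \<in> C\<close> C(4) assms(2) by fastforce
    have "open (\<Inter>i\<in>I. {x. f i x > 0})"
      using assms(3) cont by (intro open_INT) (auto intro!: open_Collect_less)
    moreover have "(\<Inter>i\<in>I. {x. f i x > 0}) \<subseteq> S" using assms(2) by (auto simp: less_imp_le)
    ultimately have "x \<in> interior S" using pos by (auto simp: interior_def)
    moreover have "C \<noteq> S" using C(2) assms(1) by (auto simp: polygon_def)
    ultimately show False using face_of_disjoint_interior[OF C(1)] \<open>x \<in> C\<close> by blast
  qed
  then obtain i where i: "i \<in> I" "f i x = 0" by blast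
  define C' where "C' = {x \<in> S. f i x = 0}"
  have C': "C' face_of S"
  proof -
    obtain a b where "f i = (\<lambda>x. a \<bullet> x + b)" using assms(4)[OF i(1)] by blast
    then show ?thesis unfolding C'_def
      using assms(2) i(1) by (intro face_of_affine_zeros[OF polygon_convex[OF assms(1)]]) auto
  qed
  have "C \<subseteq> C'"
    by (rule subset_of_face_of[OF C' C(4)]) (use x i(2) \<open>x \<in> C\<close> C(4) in \<open>auto simp: C'_def\<close>)
  then have "C face_of C'" by (rule face_of_subset[OF C(1) _ face_of_imp_subset[OF C']])
  moreover have "C' \<noteq> S"
  proof -
    obtain y where "y \<in> S" "f i y > 0" using assms(5)[OF i(1)] by blast
    then have "y \<notin> C'" by (simp add: C'_def)
    then show ?thesis using \<open>y \<in> S\<close> by blast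
  qed
  then have "aff_dim C' < 2"
    using face_of_aff_dim_lt[OF polygon_convex[OF assms(1)] C'] assms(1) by (auto simp: polygon_def)
  ultimately have "C = C'"
    using face_of_aff_dim_lt[OF face_of_imp_convex[OF C']] C(2) by force
  then show thesis using that i(1) C'_def by blast
qed

section \<open>Collapsing an edge of a polygon\<close>

text \<open>The deleted edge \<open>E2 = [a, b]\<close> is cut off from \<open>Q\<close> by the line \<open>l = 1\<close>, where \<open>l\<close> is the affine
  function with \<open>l w = 0\<close>. The map \<open>\<kappa>\<close> moves each point along the ray through it from \<open>w\<close>,
  changing \<open>l\<close> to \<open>\<theta> l\<close>, where \<open>\<theta>\<close> maps \<open>(1, \<infinity>)\<close> diffeomorphically to \<open>(0, \<infinity>)\<close> and is the
  identity beyond some \<open>L\<close>. Rays from \<open>w\<close> preserve the (prolonged) edges \<open>E1\<close> and \<open>E3\<close>, and \<open>L\<close> is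
  chosen so that all other edges lie in \<open>l \<ge> L\<close>, where \<open>\<kappa>\<close> does not move anything.

  That the prolonged figure is convex, with the expected edges, follows from
  \<open>f w > 0\<close> for the edge functions \<open>f\<close> of the other edges: in barycentric coordinates
  with respect to \<open>a\<close>, \<open>b\<close>, \<open>w\<close>, points of the polygon have a nonpositive coordinate at \<open>w\<close>, so
  with \<open>f a, f b > 0\<close> and \<open>f w \<le> 0\<close> the function \<open>f\<close> would have no zero in the polygon.\<close>

lemma edge_collapse:
  assumes P: "polygon P" and E123: "E1 edge_of P" "E2 edge_of P" "E3 edge_of P"
    and ne: "E1 \<noteq> E2" "E2 \<noteq> E3" "E1 \<noteq> E3" and del: "deletes_edge P E1 E2 E3 w Q"
  obtains hat \<kappa> \<kappa>i where "polygon Q" "w \<in> hat E1" "w \<in> hat E3"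
    "bij_betw hat ({E. E edge_of P} - {E2}) {E. E edge_of Q}"
    "\<And>E. E edge_of P \<Longrightarrow> E \<subseteq> hat E"
    "extends_smoothly P \<kappa>" "extends_smoothly (Q - {w}) \<kappa>i"
    "\<kappa> ` (P - E2) \<subseteq> Q - {w}" "\<kappa>i ` (Q - {w}) \<subseteq> P - E2" "\<And>x. x \<in> E2 \<Longrightarrow> \<kappa> x = w"
    "\<And>x. x \<in> P - E2 \<Longrightarrow> \<kappa>i (\<kappa> x) = x" "\<And>y. y \<in> Q - {w} \<Longrightarrow> \<kappa> (\<kappa>i y) = y"
    "\<And>x E. x \<in> P - E2 \<Longrightarrow> E edge_of P \<Longrightarrow> E \<noteq> E2 \<Longrightarrow> \<kappa> x \<in> hat E \<longleftrightarrow> x \<in> E"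
proof -
  from del obtain a b c d where seg: "E1 = closed_segment c a" "E2 = closed_segment a b"
    "E3 = closed_segment d b" and aw: "a \<in> open_segment c w" and bw: "b \<in> open_segment d w"
    and Q_eq: "Q = P \<union> convex hull {a, b, w}"
    unfolding deletes_edge_def by blast
  have "\<forall>F. \<exists>f. F edge_of P \<longrightarrow> edge_function P F f" using edge_function_exists[OF P] by blast
  then obtain fe where fe: "F edge_of P \<Longrightarrow> edge_function P F (fe F)" for F by metis
  note pos_iff = edge_function_pos_iff[OF P _ fe]
  note nonneg = edge_function_nonneg[OF P fe]
  note zero_iff = edge_function_zero_iff[OF P _ fe]
  have zero: "fe E x = 0" if "E edge_of P" "x \<in> E" for E x
    using fe[OF that(1)] that(2) by (simp add: edge_function_def)
  have inP: "x \<in> P" if "E edge_of P" "x \<in> E" for E x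
    using that edge_of_imp_subset by blast
  have P_iff: "x \<in> P \<longleftrightarrow> (\<forall>E. E edge_of P \<longrightarrow> fe E x \<ge> 0)" for x
    by (rule polygon_eq_halfplanes[OF P fe])
  define f1 f2 f3 where "f1 = fe E1" and "f2 = fe E2" and "f3 = fe E3"
  note ef = fe[OF E123(1), folded f1_def] fe[OF E123(2), folded f2_def] fe[OF E123(3), folded f3_def]
  have mem: "a \<in> E1" "a \<in> E2" "b \<in> E2" "b \<in> E3" "c \<in> E1" "d \<in> E3" by (simp_all add: seg)
  then have memP: "a \<in> P" "b \<in> P" "c \<in> P" "d \<in> P" using inP E123 by blast+
  have "a \<noteq> b" using E123(2) by (auto simp: edge_of_def seg)
  have "a \<noteq> c" "b \<noteq> d" using aw bw by (auto simp: open_segment_def)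
  note once = edges_meet_at_most_once[OF P]
  have "b \<notin> E1" using once[of E1 E2 a b] E123 ne mem \<open>a \<noteq> b\<close> by blast
  have "a \<notin> E3" using once[of E2 E3 a b] E123 ne mem \<open>a \<noteq> b\<close> by blast
  have "c \<notin> E2" using once[of E1 E2 a c] E123 ne mem \<open>a \<noteq> c\<close> by blast
  have f1b: "f1 b > 0" and f3a: "f3 a > 0" and f2c: "f2 c > 0"
    unfolding f1_def f2_def f3_def using pos_iff E123 memP \<open>b \<notin> E1\<close> \<open>a \<notin> E3\<close> \<open>c \<notin> E2\<close> by blast+
  have f0: "f1 a = 0" "f1 c = 0" "f2 a = 0" "f2 b = 0" "f3 b = 0" "f3 d = 0"
    using zero E123 mem by (auto simp: f1_def f2_def f3_def)
  obtain s where s: "0 < s" "s < 1" "a = (1 - s) *\<^sub>R c + s *\<^sub>R w" using aw by (auto simp: in_segment)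
  obtain t where t: "0 < t" "t < 1" "b = (1 - t) *\<^sub>R d + t *\<^sub>R w" using bw by (auto simp: in_segment)
  have f1w: "f1 w = 0"
    using edge_function_affine[OF ef(1), of "1 - s" s c w] s f0 by simp
  have f3w: "f3 w = 0"
    using edge_function_affine[OF ef(3), of "1 - t" t d w] t f0 by simp
  have f2w: "f2 w < 0"
  proof -
    have "(1 - s) * f2 c + s * f2 w = 0"
      using edge_function_affine[OF ef(2), of "1 - s" s c w] s f0 by simp
    moreover have "(1 - s) * f2 c > 0" using s f2c by simp
    ultimately have "s * f2 w < 0" by linarith
    then show ?thesis using s(1) by (simp add: mult_less_0_iff)
  qed
  \<comment> \<open>Each of the three edge functions vanishes at two of \<open>a\<close>, \<open>b\<close>, \<open>w\<close>; normalized at the third,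
    they become the barycentric coordinates.\<close>
  define \<alpha> \<beta> \<gamma> where "\<alpha> x = f3 x / f3 a" and "\<beta> x = f1 x / f1 b" and "\<gamma> x = f2 x / f2 w" for x
  have bary: "x = \<alpha> x *\<^sub>R a + \<beta> x *\<^sub>R b + \<gamma> x *\<^sub>R w" "\<alpha> x + \<beta> x + \<gamma> x = 1" for x
  proof -
    obtain e e' where e: "\<And>x. x = a + f1 x *\<^sub>R e + f2 x *\<^sub>R e'"
      using corner_coordinates[OF P E123(1,2) ne(1) mem(1,2) ef(1,2)] by metis
    have "b - a = f1 b *\<^sub>R e" using e[of b] f0 by (simp add: algebra_simps)
    then have "e = (1 / f1 b) *\<^sub>R (b - a)" using f1b by simp
    moreover have "w - a = f2 w *\<^sub>R e'" using e[of w] f1w by (simp add: algebra_simps)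
    then have "e' = (1 / f2 w) *\<^sub>R (w - a)" using f2w by simp
    ultimately have "x = a + \<beta> x *\<^sub>R (b - a) + \<gamma> x *\<^sub>R (w - a)"
      using e[of x] by (simp add: \<beta>_def \<gamma>_def)
    then have *: "x = (1 - \<beta> x - \<gamma> x) *\<^sub>R a + \<beta> x *\<^sub>R b + \<gamma> x *\<^sub>R w"
      by (simp add: algebra_simps)
    have "f3 ((1 - \<beta> x - \<gamma> x) *\<^sub>R a + \<beta> x *\<^sub>R b + \<gamma> x *\<^sub>R w) = (1 - \<beta> x - \<gamma> x) * f3 a"
      using edge_function_affine3[OF ef(3), of "1 - \<beta> x - \<gamma> x" "\<beta> x" "\<gamma> x" a b w] f0 f3w by simp
    then have "\<alpha> x = 1 - \<beta> x - \<gamma> x" using * f3a by (simp add: \<alpha>_def)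
    then show "x = \<alpha> x *\<^sub>R a + \<beta> x *\<^sub>R b + \<gamma> x *\<^sub>R w" "\<alpha> x + \<beta> x + \<gamma> x = 1" using * by simp_all
  qed
  have fe_bary: "fe E x = \<alpha> x * fe E a + \<beta> x * fe E b + \<gamma> x * fe E w" if "E edge_of P" for E x
    using edge_function_affine3[OF fe[OF that] bary(2)[of x], of a b w] bary(1)[of x] by simp
  have triangle: "x \<in> convex hull {a, b, w} \<longleftrightarrow> \<alpha> x \<ge> 0 \<and> \<beta> x \<ge> 0 \<and> \<gamma> x \<ge> 0" for x
  proof
    assume "\<alpha> x \<ge> 0 \<and> \<beta> x \<ge> 0 \<and> \<gamma> x \<ge> 0"
    then show "x \<in> convex hull {a, b, w}"
      unfolding convex_hull_3 using bary[of x] by blast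
  next
    assume "x \<in> convex hull {a, b, w}"
    then obtain u v r where uvr: "u \<ge> 0" "v \<ge> 0" "r \<ge> 0" "u + v + r = 1"
      "x = u *\<^sub>R a + v *\<^sub>R b + r *\<^sub>R w" unfolding convex_hull_3 by blast
    have "f1 x = v * f1 b" "f2 x = r * f2 w" "f3 x = u * f3 a"
      using uvr(5) edge_function_affine3[OF ef(1) uvr(4), of a b w] edge_function_affine3[OF ef(2) uvr(4), of a b w]
        edge_function_affine3[OF ef(3) uvr(4), of a b w] f0 f1w f3w by simp_all
    then show "\<alpha> x \<ge> 0 \<and> \<beta> x \<ge> 0 \<and> \<gamma> x \<ge> 0"
      using uvr(1-3) f1b f2w f3a by (simp add: \<alpha>_def \<beta>_def \<gamma>_def)
  qed
  define others where "others = {E. E edge_of P} - {E1, E2, E3}"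
  have fin: "finite others" using finite_edges[OF P] by (simp add: others_def)
  have other_pos: "fe E a > 0 \<and> fe E b > 0 \<and> fe E w > 0" if "E \<in> others" for E
  proof -
    have E: "E edge_of P" "E \<noteq> E1" "E \<noteq> E2" "E \<noteq> E3" using that by (auto simp: others_def)
    have "a \<notin> E" "b \<notin> E"
      using at_most_two_edges_at_point[OF P] E E123 ne mem by blast+
    then have ab: "fe E a > 0" "fe E b > 0" using pos_iff[OF E(1) E(1)] memP by auto
    have "fe E w > 0"
    proof (rule ccontr)
      assume w: "\<not> fe E w > 0"
      obtain x where x: "x \<in> E" using edge_nontrivial[OF E(1)] by blast
      then have xP: "x \<in> P" by (rule inP[OF E(1)])
      have "\<alpha> x \<ge> 0" "\<beta> x \<ge> 0" "\<gamma> x \<le> 0"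
        using nonneg[OF E123(1) xP] nonneg[OF E123(2) xP] nonneg[OF E123(3) xP] f1b f2w f3a
        by (simp_all add: \<alpha>_def \<beta>_def \<gamma>_def f1_def f2_def f3_def divide_nonneg_neg)
      moreover from this have "\<alpha> x > 0 \<or> \<beta> x > 0" using bary(2)[of x] by linarith
      ultimately have "\<alpha> x * fe E a + \<beta> x * fe E b > 0" "\<gamma> x * fe E w \<ge> 0"
        using ab w by (auto intro: add_pos_nonneg add_nonneg_pos mult_nonpos_nonpos)
      then show False using fe_bary[OF E(1), of x] zero[OF E(1) x] by linarith
    qed
    then show ?thesis using ab by blast
  qed
  have edges: "{E. E edge_of P} - {E2} = insert E1 (insert E3 others)"
    using E123 ne by (auto simp: others_def)
  have P_iff': "x \<in> P \<longleftrightarrow> f1 x \<ge> 0 \<and> f2 x \<ge> 0 \<and> f3 x \<ge> 0 \<and> (\<forall>E\<in>others. fe E x \<ge> 0)" for x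
    unfolding P_iff f1_def f2_def f3_def others_def using E123 by blast
  have Q_iff: "x \<in> Q \<longleftrightarrow> f1 x \<ge> 0 \<and> f3 x \<ge> 0 \<and> (\<forall>E\<in>others. fe E x \<ge> 0)" for x
  proof
    assume "x \<in> Q"
    then consider "x \<in> P" | "x \<in> convex hull {a, b, w}" unfolding Q_eq by blast
    then show "f1 x \<ge> 0 \<and> f3 x \<ge> 0 \<and> (\<forall>E\<in>others. fe E x \<ge> 0)"
    proof cases
      case 2
      then have nn: "\<alpha> x \<ge> 0" "\<beta> x \<ge> 0" "\<gamma> x \<ge> 0" by (simp_all add: triangle)
      then have "f1 x \<ge> 0" "f3 x \<ge> 0" using f1b f3a by (simp_all add: \<alpha>_def \<beta>_def zero_le_divide_iff)
      moreover have "fe E x \<ge> 0" if "E \<in> others" for E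
        using fe_bary[of E x] other_pos[OF that] that nn by (simp add: others_def)
      ultimately show ?thesis by blast
    qed (simp add: P_iff')
  next
    assume x: "f1 x \<ge> 0 \<and> f3 x \<ge> 0 \<and> (\<forall>E\<in>others. fe E x \<ge> 0)"
    show "x \<in> Q"
    proof (cases "f2 x \<ge> 0")
      case False
      then have "\<gamma> x \<ge> 0" "\<alpha> x \<ge> 0" "\<beta> x \<ge> 0"
        using f2w x f1b f3a by (simp_all add: \<alpha>_def \<beta>_def \<gamma>_def divide_nonpos_neg)
      then show ?thesis by (simp add: Q_eq triangle)
    qed (use x in \<open>simp add: Q_eq P_iff'\<close>)
  qed
  have QE_iff: "x \<in> Q \<longleftrightarrow> (\<forall>E\<in>{E. E edge_of P} - {E2}. fe E x \<ge> 0)" for x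
    unfolding edges by (simp add: Q_iff f1_def f3_def)
  have "P \<subseteq> Q" by (simp add: Q_eq)
  have Q: "polygon Q"
  proof -
    have "polyhedron {x. fe E x \<ge> 0}" if E: "E edge_of P" for E
    proof -
      obtain a b where "fe E = (\<lambda>x. a \<bullet> x + b)" using fe[OF E] by (auto simp: edge_function_def)
      then have "{x. fe E x \<ge> 0} = {x. a \<bullet> x \<ge> - b}" by (auto simp: algebra_simps)
      then show ?thesis using polyhedron_halfspace_ge by metis
    qed
    then have "polyhedron (\<Inter>E\<in>{E. E edge_of P} - {E2}. {x. fe E x \<ge> 0})"
      using finite_edges[OF P] by (intro polyhedron_Inter) auto
    also have "(\<Inter>E\<in>{E. E edge_of P} - {E2}. {x. fe E x \<ge> 0}) = Q" using QE_iff by auto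
    finally have "polyhedron Q" .
    moreover have "compact (convex hull {a, b, w})" by (simp add: finite_imp_compact_convex_hull)
    then have "bounded Q" unfolding Q_eq using compact_imp_bounded polygon_compact[OF P] by blast
    moreover have "aff_dim Q = 2"
      using aff_dim_subset[OF \<open>P \<subseteq> Q\<close>] aff_dim_le_DIM[of Q] P by (simp add: polygon_def)
    ultimately show ?thesis by (simp add: polygon_def polytope_eq_bounded_polyhedron)
  qed
  define hat where "hat E = {x \<in> Q. fe E x = 0}" for E
  have sub_hat: "E \<subseteq> hat E" if "E edge_of P" for E
    using zero that inP \<open>P \<subseteq> Q\<close> by (auto simp: hat_def)
  have hat_P: "E = P \<inter> hat E" if "E edge_of P" for E
    using zero_iff[OF that that] inP[OF that] \<open>P \<subseteq> Q\<close> by (auto simp: hat_def)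
  have ex_pos: "\<exists>x\<in>P. fe E x > 0" if "E edge_of P" for E
    using fe[OF that] polygon_interior[OF P] interior_subset[of P] by (auto simp: edge_function_def)
  have bij: "bij_betw hat ({E. E edge_of P} - {E2}) {E. E edge_of Q}"
    unfolding bij_betw_def
  proof
    show "inj_on hat ({E. E edge_of P} - {E2})" using hat_P by (intro inj_onI) (metis DiffD1 mem_Collect_eq)
    have "hat E edge_of Q" if E: "E edge_of P" "E \<noteq> E2" for E
    proof -
      obtain a b where ab: "fe E = (\<lambda>x. a \<bullet> x + b)" using fe[OF E(1)] by (auto simp: edge_function_def)
      have face: "hat E face_of Q"
        unfolding hat_def by (rule face_of_affine_zeros[OF polygon_convex[OF Q] ab]) (use QE_iff E in blast)
      obtain x where "x \<in> P" "fe E x > 0" using ex_pos[OF E(1)] by blast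
      then have "x \<in> Q" "x \<notin> hat E" using \<open>P \<subseteq> Q\<close> by (auto simp: hat_def)
      then have "hat E \<noteq> Q" by blast
      then have "aff_dim (hat E) < 2"
        using face_of_aff_dim_lt[OF polygon_convex[OF Q] face] Q by (simp add: polygon_def)
      moreover have "aff_dim (hat E) \<ge> 1"
        using aff_dim_subset[OF sub_hat[OF E(1)]] E(1) by (simp add: edge_of_def)
      ultimately show ?thesis using face by (simp add: edge_of_def)
    qed
    moreover have "C \<in> hat ` ({E. E edge_of P} - {E2})" if C: "C edge_of Q" for C
    proof (rule edges_of_halfplane_intersection[OF Q QE_iff _ _ _ C])
      show "finite ({E. E edge_of P} - {E2})" using finite_edges[OF P] by simp
      show "\<exists>a b. fe E = (\<lambda>x. a \<bullet> x + b)" if "E \<in> {E. E edge_of P} - {E2}" for E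
        using fe[of E] that by (auto simp: edge_function_def)
      show "\<exists>x\<in>Q. fe E x > 0" if "E \<in> {E. E edge_of P} - {E2}" for E
        using ex_pos[of E] that \<open>P \<subseteq> Q\<close> by blast
    qed (auto simp: hat_def)
    ultimately show "hat ` ({E. E edge_of P} - {E2}) = {E. E edge_of Q}" by blast
  qed
  have hat_other: "hat E = E" if "E \<in> others" for E
  proof
    have E: "E edge_of P" using that by (simp add: others_def)
    show "E \<subseteq> hat E" by (rule sub_hat[OF E])
    show "hat E \<subseteq> E"
    proof
      fix x assume x: "x \<in> hat E"
      have "x \<notin> convex hull {a, b, w}"
      proof
        assume "x \<in> convex hull {a, b, w}"
        then have nn: "\<alpha> x \<ge> 0" "\<beta> x \<ge> 0" "\<gamma> x \<ge> 0" by (simp_all add: triangle)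
        define m where "m = min (fe E a) (min (fe E b) (fe E w))"
        have "m > 0" using other_pos[OF that] by (simp add: m_def)
        have "m = \<alpha> x * m + \<beta> x * m + \<gamma> x * m" using bary(2)[of x] by (metis distrib_right mult_1)
        also have "\<dots> \<le> fe E x" unfolding fe_bary[OF E, of x]
          using nn by (intro add_mono mult_left_mono) (auto simp: m_def)
        finally show False using x \<open>m > 0\<close> by (simp add: hat_def)
      qed
      then have "x \<in> P" using x by (auto simp: hat_def Q_eq)
      then show "x \<in> E" using hat_P[OF E] x by blast
    qed
  qed
  define l where "l x = 1 - \<gamma> x" for x
  obtain n m where f2_eq: "f2 = (\<lambda>x. n \<bullet> x + m)" using ef(2) by (auto simp: edge_function_def)
  have l_smooth: "smooth_on UNIV l"
  proof -
    have "l = (\<lambda>x. (- (1 / f2 w) *\<^sub>R n) \<bullet> x + (1 - m / f2 w))"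
      by (auto simp: fun_eq_iff l_def \<gamma>_def f2_eq diff_divide_distrib add_divide_distrib)
    then show ?thesis using affine_imp_smooth_on[OF open_UNIV] by metis
  qed
  then have l_cont: "continuous_on S l" for S
    using smooth_on_imp_continuous_on continuous_on_subset by blast
  have l_w: "l w = 0" using f2w by (simp add: l_def \<gamma>_def)
  have l_ray: "l (w + r *\<^sub>R (x - w)) = r * l x" for r x
  proof -
    have "f2 (w + r *\<^sub>R (x - w)) = (1 - r) * f2 w + r * f2 x"
      using edge_function_affine[OF ef(2), of "1 - r" r w x] by (simp add: algebra_simps)
    then have "\<gamma> (w + r *\<^sub>R (x - w)) = (1 - r) + r * \<gamma> x" using f2w by (simp add: \<gamma>_def add_divide_distrib)
    then show ?thesis by (simp add: l_def algebra_simps)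
  qed
  have fe_ray: "fe E (w + r *\<^sub>R (x - w)) = (1 - r) * fe E w + r * fe E x" if "E edge_of P" for E r x
    using edge_function_affine[OF fe[OF that], of "1 - r" r w x] by (simp add: algebra_simps)
  have l_gt: "l x > 1 \<longleftrightarrow> f2 x > 0" for x
    using f2w by (simp add: l_def \<gamma>_def divide_less_0_iff)
  have l_P: "l x \<ge> 1" if "x \<in> P" for x
    using that f2w by (simp add: P_iff' l_def \<gamma>_def divide_nonneg_neg)
  have l_E2: "l x = 1" if "x \<in> E2" for x
    using zero[OF E123(2) that] by (simp add: l_def \<gamma>_def f2_def)
  have l_off: "l x > 1" if "x \<in> P - E2" for x
    unfolding l_gt f2_def using pos_iff[OF E123(2) E123(2)] that by blast
  have l_Q: "l y > 0" if "y \<in> Q - {w}" for y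
  proof (cases "y \<in> P")
    case False
    then have nn: "\<alpha> y \<ge> 0" "\<beta> y \<ge> 0" "\<gamma> y \<ge> 0" using that by (simp_all add: Q_eq triangle)
    have "\<not> (\<alpha> y = 0 \<and> \<beta> y = 0)" using bary[of y] that by auto
    then have "\<alpha> y + \<beta> y > 0" using nn by linarith
    then show ?thesis using bary(2)[of y] by (simp add: l_def)
  qed (use l_P[of y] in simp)
  obtain L where L: "L > 1" "\<And>E x. E \<in> others \<Longrightarrow> x \<in> E \<Longrightarrow> l x \<ge> L"
  proof (cases "\<Union>others = {}")
    case True
    then show thesis using that[of 2] by auto
  next
    case False
    have "compact (\<Union>others)"
      using fin polygon_compact[OF P] polygon_convex[OF P]
      by (intro compact_Union) (auto simp: others_def edge_of_def face_of_imp_compact)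
    then obtain z where z: "z \<in> \<Union>others" "\<And>x. x \<in> \<Union>others \<Longrightarrow> l z \<le> l x"
      using continuous_attains_inf[OF _ False l_cont] by blast
    then obtain E where E: "E \<in> others" "z \<in> E" by blast
    then have "E edge_of P" by (simp add: others_def)
    have "z \<notin> E2"
    proof
      assume "z \<in> E2"
      then obtain u where u: "0 \<le> u" "u \<le> 1" "z = (1 - u) *\<^sub>R a + u *\<^sub>R b"
        by (auto simp: seg closed_segment_def)
      have "fe E z = (1 - u) * fe E a + u * fe E b"
        unfolding u(3) by (rule edge_function_affine[OF fe[OF \<open>E edge_of P\<close>]]) simp
      moreover have "\<dots> > 0"
        using u(1,2) other_pos[OF E(1)]
        by (cases "u = 0") (auto intro!: add_nonneg_pos mult_pos_pos)
      ultimately show False using zero[OF \<open>E edge_of P\<close> E(2)] by simp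
    qed
    then have "l z > 1" using l_off inP[OF \<open>E edge_of P\<close> E(2)] by blast
    then show thesis using that[of "l z"] z(2) by blast
  qed
  obtain \<theta> \<theta>i where \<theta>: "smooth_on UNIV \<theta>" "smooth_on UNIV \<theta>i" "\<And>t. \<theta>i (\<theta> t) = t" "\<And>t. \<theta> (\<theta>i t) = t"
    "strict_mono \<theta>" "\<theta> 1 = 0" "\<And>t. t \<ge> L \<Longrightarrow> \<theta> t = t" "\<And>t. \<theta> t \<le> t"
  proof (rule reparametrization[OF L(1)], goal_cases)
    case (1 \<theta> \<theta>i)
    from 1(2-) show ?case by (rule 1(1))
  qed
  have \<theta>_pos: "\<theta> t > 0 \<longleftrightarrow> t > 1" for t using strict_mono_less[OF \<theta>(5), of 1 t] \<theta>(6) by simp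
  have \<theta>i_gt: "\<theta>i t > 1 \<longleftrightarrow> t > 0" for t using \<theta>_pos[of "\<theta>i t"] \<theta>(4) by simp
  define \<kappa> \<kappa>i where "\<kappa> x = w + (\<theta> (l x) / l x) *\<^sub>R (x - w)" and "\<kappa>i x = w + (\<theta>i (l x) / l x) *\<^sub>R (x - w)" for x
  define H where "H = {x. l x > 0}"
  have "open H" unfolding H_def by (intro open_Collect_less continuous_on_const l_cont)
  have ray_smooth: "smooth_on H (\<lambda>x. w + (\<tau> (l x) / l x) *\<^sub>R (x - w))" if "smooth_on UNIV \<tau>" for \<tau>
    by (intro smooth_on_add smooth_on_scaleR smooth_on_divide smooth_on_diff smooth_on_const
        smooth_on_compose[OF _ _ _ that] smooth_on_subset[OF l_smooth] \<open>open H\<close>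
        smooth_on_bounded_linear bounded_linear_ident open_UNIV) (auto simp: H_def)
  have l_\<kappa>: "l (\<kappa> x) = \<theta> (l x)" "l (\<kappa>i x) = \<theta>i (l x)" if "l x > 0" for x
    using that by (simp_all add: \<kappa>_def \<kappa>i_def l_ray)
  have inv1: "\<kappa>i (\<kappa> x) = x" if "l x > 1" for x
  proof -
    have "\<theta> (l x) > 0" using that \<theta>_pos by simp
    then show ?thesis using l_\<kappa>(1)[of x] that \<theta>(3) by (simp add: \<kappa>i_def[of "\<kappa> x"]) (simp add: \<kappa>_def)
  qed
  have inv2: "\<kappa> (\<kappa>i y) = y" if "l y > 0" for y
  proof -
    have "\<theta>i (l y) > 1" using that \<theta>i_gt by simp
    then show ?thesis using l_\<kappa>(2)[of y] that \<theta>(4) by (simp add: \<kappa>_def[of "\<kappa>i y"]) (simp add: \<kappa>i_def)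
  qed
  have fe_\<kappa>: "fe E (\<kappa> x) = (1 - \<theta> (l x) / l x) * fe E w + \<theta> (l x) / l x * fe E x" if "E edge_of P" for E x
    unfolding \<kappa>_def by (rule fe_ray[OF that])
  have \<kappa>_P: "\<kappa> x \<in> Q - {w}" if x: "x \<in> P - E2" for x
  proof -
    define r where "r = \<theta> (l x) / l x"
    have "l x > 1" using l_off x by blast
    then have r: "0 < r" "r \<le> 1" using \<theta>_pos \<theta>(8)[of "l x"] by (simp_all add: r_def)
    have "fe E (\<kappa> x) \<ge> 0" if "E edge_of P" "fe E w \<ge> 0" for E
      unfolding fe_\<kappa>[OF that(1), of x] r_def[symmetric] using that(2) nonneg[OF that(1)] x r
      by (intro add_nonneg_nonneg mult_nonneg_nonneg) auto
    then have "\<kappa> x \<in> Q" unfolding Q_iff f1_def f3_def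
      using E123 f1w f3w other_pos by (auto simp: f1_def f3_def others_def less_imp_le)
    moreover have "\<kappa> x \<noteq> w" using l_\<kappa>(1)[of x] \<open>l x > 1\<close> \<theta>_pos[of "l x"] l_w by auto
    ultimately show ?thesis by blast
  qed
  \<comment> \<open>Where \<open>l < L\<close>, the region \<open>Q\<close> is the whole cone between \<open>E1\<close> and \<open>E3\<close>: a ray from \<open>w\<close> can
    leave \<open>Q\<close> only through one of the other edges.\<close>
  have cone: "x \<in> Q" if x: "f1 x \<ge> 0" "f3 x \<ge> 0" "l x < L" for x
  proof (rule ccontr)
    assume "x \<notin> Q"
    define G where "G = {x. \<forall>E\<in>others. fe E x \<ge> 0}"
    have "x \<notin> G" using \<open>x \<notin> Q\<close> x by (simp add: Q_iff G_def)
    moreover have "w \<in> G" using other_pos by (simp add: G_def less_imp_le)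
    ultimately have "closed_segment w x \<inter> frontier G \<noteq> {}"
      by (intro connected_Int_frontier connected_segment) auto
    then obtain z where z: "z \<in> closed_segment w x" "z \<in> frontier G" by blast
    have cont: "continuous_on UNIV (fe E)" if "E \<in> others" for E
      using that by (intro edge_function_continuous[OF fe]) (simp add: others_def)
    have "G = (\<Inter>E\<in>others. {x. fe E x \<ge> 0})" by (auto simp: G_def)
    then have "closed G" using cont by (auto intro!: closed_Collect_le)
    then have "z \<in> G" "z \<notin> interior G" using z(2) by (auto simp: frontier_def)
    have "\<exists>E\<in>others. fe E z = 0"
    proof (rule ccontr)
      assume "\<not> ?thesis"
      then have "z \<in> (\<Inter>E\<in>others. {x. fe E x > 0})" using \<open>z \<in> G\<close> by (force simp: G_def)
      moreover have "open (\<Inter>E\<in>others. {x. fe E x > 0})"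
        using fin cont by (intro open_INT) (auto intro!: open_Collect_less)
      moreover have "(\<Inter>E\<in>others. {x. fe E x > 0}) \<subseteq> G" by (auto simp: G_def less_imp_le)
      ultimately have "z \<in> interior G" by (auto simp: interior_def)
      then show False using \<open>z \<notin> interior G\<close> by blast
    qed
    then obtain E where E: "E \<in> others" "fe E z = 0" by blast
    obtain u where u: "0 \<le> u" "u \<le> 1" "z = (1 - u) *\<^sub>R w + u *\<^sub>R x"
      using z(1) by (auto simp: closed_segment_def)
    then have zu: "z = w + u *\<^sub>R (x - w)" by (simp add: algebra_simps)
    have "f1 z = u * f1 x" "f3 z = u * f3 x"
      unfolding zu f1_def f3_def using fe_ray E123 f1w f3w by (simp_all add: f1_def f3_def)
    then have "z \<in> Q" using x u \<open>z \<in> G\<close> by (simp add: Q_iff G_def)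
    then have "z \<in> E" using E hat_other[OF E(1)] by (auto simp: hat_def)
    then have "L \<le> l z" by (rule L(2)[OF E(1)])
    also have "l z = u * l x" unfolding zu by (rule l_ray)
    also have "\<dots> < L"
    proof (cases "l x \<ge> 0")
      case True
      then show ?thesis using x(3) u(2) mult_left_le_one_le[of "l x" u] u(1) by linarith
    next
      case False
      then have "u * l x \<le> 0" using u(1) by (simp add: mult_nonneg_nonpos)
      then show ?thesis using L(1) by linarith
    qed
    finally show False by simp
  qed
  have \<kappa>i_Q: "\<kappa>i y \<in> P - E2" if y: "y \<in> Q - {w}" for y
  proof -
    have ly: "l y > 0" by (rule l_Q[OF y])
    have "l (\<kappa>i y) > 1" using l_\<kappa>(2)[OF ly] \<theta>i_gt ly by simp
    have "\<kappa>i y \<in> Q"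
    proof (cases "l y \<ge> L")
      case True
      then have "\<theta>i (l y) = l y" using \<theta>(3)[of "l y"] \<theta>(7) by simp
      then have "\<kappa>i y = y" using ly by (simp add: \<kappa>i_def)
      then show ?thesis using y by simp
    next
      case False
      have r: "\<theta>i (l y) > 1" using \<theta>i_gt[of "l y"] ly by simp
      have "\<theta>i (l y) < L" using False strict_mono_less[OF \<theta>(5), of "\<theta>i (l y)" L] \<theta>(4) \<theta>(7)[of L] by simp
      moreover have "f1 (\<kappa>i y) = \<theta>i (l y) / l y * f1 y" "f3 (\<kappa>i y) = \<theta>i (l y) / l y * f3 y"
        unfolding \<kappa>i_def f1_def f3_def using fe_ray E123 f1w f3w by (simp_all add: f1_def f3_def)
      moreover have "f1 y \<ge> 0" "f3 y \<ge> 0" using y by (simp_all add: Q_iff)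
      ultimately show ?thesis using l_\<kappa>(2)[OF ly] r ly by (intro cone) simp_all
    qed
    moreover have "f2 (\<kappa>i y) > 0" using \<open>l (\<kappa>i y) > 1\<close> l_gt by simp
    ultimately have "\<kappa>i y \<in> P" by (simp add: P_iff' Q_iff)
    moreover have "\<kappa>i y \<notin> E2" using \<open>f2 (\<kappa>i y) > 0\<close> zero[OF E123(2)] by (auto simp: f2_def)
    ultimately show ?thesis by blast
  qed
  have \<kappa>_hat: "\<kappa> x \<in> hat E \<longleftrightarrow> x \<in> E" if x: "x \<in> P - E2" and E: "E edge_of P" "E \<noteq> E2" for x E
  proof -
    have "l x > 1" using l_off x by blast
    show ?thesis
    proof (cases "E \<in> others")
      case True
      have fixed: "\<kappa> z = z" if "z \<in> E" for z
        using L(2)[OF True that] \<theta>(7) L(1) by (simp add: \<kappa>_def)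
      have "\<kappa> x \<in> E \<Longrightarrow> x \<in> E"
      proof -
        assume *: "\<kappa> x \<in> E"
        have "\<kappa>i (\<kappa> x) = \<kappa>i (\<kappa> (\<kappa> x))" using fixed[OF *] by simp
        moreover have "l (\<kappa> x) > 1" using L(2)[OF True *] L(1) by linarith
        ultimately show "x \<in> E" using inv1[OF \<open>l x > 1\<close>] inv1[of "\<kappa> x"] * by simp
      qed
      then show ?thesis unfolding hat_other[OF True] using fixed by auto
    next
      case False
      then have "fe E w = 0" using E f1w f3w by (auto simp: others_def f1_def f3_def)
      then have "fe E (\<kappa> x) = \<theta> (l x) / l x * fe E x" using fe_\<kappa>[OF E(1), of x] by simp
      then have "fe E (\<kappa> x) = 0 \<longleftrightarrow> fe E x = 0" using \<theta>_pos[of "l x"] \<open>l x > 1\<close> by auto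
      then show ?thesis using \<kappa>_P[OF x] x zero_iff[OF E(1) E(1)] by (auto simp: hat_def)
    qed
  qed
  show thesis
  proof (rule that[OF Q _ _ bij sub_hat])
    show "w \<in> hat E1" "w \<in> hat E3"
      using f1w f3w other_pos by (auto simp: hat_def Q_iff less_imp_le simp flip: f1_def f3_def)
    have "smooth_on H \<kappa>" using ray_smooth[OF \<theta>(1)] by (simp add: \<kappa>_def[abs_def])
    then show "extends_smoothly P \<kappa>"
      unfolding extends_smoothly_def using \<open>open H\<close> l_P
      by (intro exI[of _ H] exI[of _ \<kappa>]) (force simp: H_def)
    have "smooth_on H \<kappa>i" using ray_smooth[OF \<theta>(2)] by (simp add: \<kappa>i_def[abs_def])
    then show "extends_smoothly (Q - {w}) \<kappa>i"
      unfolding extends_smoothly_def using \<open>open H\<close> l_Q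
      by (intro exI[of _ H] exI[of _ \<kappa>i]) (force simp: H_def)
    show "\<kappa> x = w" if "x \<in> E2" for x using l_E2[OF that] \<theta>(6) by (simp add: \<kappa>_def)
    show "\<kappa> ` (P - E2) \<subseteq> Q - {w}" "\<kappa>i ` (Q - {w}) \<subseteq> P - E2" using \<kappa>_P \<kappa>i_Q by blast+
    show "\<kappa>i (\<kappa> x) = x" if "x \<in> P - E2" for x using inv1 l_off that by blast
    show "\<kappa> (\<kappa>i y) = y" if "y \<in> Q - {w}" for y using inv2 l_Q that by blast
  qed (use \<kappa>_hat in auto)
qed

section \<open>Tori and the fibre relation\<close>

definition additive_subgroup :: "(real ^ 2) set \<Rightarrow> bool" where
  "additive_subgroup M \<longleftrightarrow> 0 \<in> M \<and> (\<forall>x\<in>M. \<forall>y\<in>M. x - y \<in> M)"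

lemma additive_subgroupD:
  assumes "additive_subgroup M"
  shows "0 \<in> M" "x \<in> M \<Longrightarrow> y \<in> M \<Longrightarrow> x - y \<in> M" "x \<in> M \<Longrightarrow> - x \<in> M" "x \<in> M \<Longrightarrow> y \<in> M \<Longrightarrow> x + y \<in> M"
proof -
  show 0: "0 \<in> M" using assms by (simp add: additive_subgroup_def)
  show d: "x - y \<in> M" if "x \<in> M" "y \<in> M" for x y
    using assms that by (auto simp: additive_subgroup_def)
  show m: "- x \<in> M" if "x \<in> M" for x using d[OF 0 that] by simp
  show "x + y \<in> M" if "x \<in> M" "y \<in> M" using d[OF that(1) m[OF that(2)]] by simp
qed

lemma coset_eq_iff:
  assumes "additive_subgroup M"
  shows "x +o M = y +o M \<longleftrightarrow> x - y \<in> M"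
proof
  assume "x +o M = y +o M"
  moreover have "x \<in> x +o M" using additive_subgroupD(1)[OF assms] by (force simp: elt_set_plus_def)
  ultimately show "x - y \<in> M" by (auto simp: elt_set_plus_def)
next
  have sub: "x +o M \<subseteq> y +o M" if "x - y \<in> M" for x y
  proof
    fix z assume "z \<in> x +o M"
    then obtain m where m: "m \<in> M" "z = x + m" by (auto simp: elt_set_plus_def)
    have "z = y + ((x - y) + m)" using m by simp
    then show "z \<in> y +o M"
      using additive_subgroupD(4)[OF assms that m(1)] unfolding elt_set_plus_def by blast
  qed
  assume "x - y \<in> M"
  moreover from additive_subgroupD(3)[OF assms this] have "y - x \<in> M" by simp
  ultimately show "x +o M = y +o M" using sub by blast
qed

lemma mem_coset_iff: "y \<in> x +o M \<longleftrightarrow> y - x \<in> M" for x y :: "real ^ 2"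
  unfolding elt_set_plus_def by (auto intro: bexI[of _ "y - x"])

lemma coset_add:
  assumes "additive_subgroup M"
  shows "(x +o M) + (y +o M) = (x + y) +o M"
proof -
  have "M + M = M"
    using additive_subgroupD[OF assms] by (force simp: set_plus_def)
  then show ?thesis by (simp add: set_plus_rearrange)
qed

lemma coset_uminus:
  assumes "additive_subgroup M"
  shows "uminus ` (x +o M) = (- x) +o M"
proof (intro set_eqI iffI)
  fix z assume "z \<in> uminus ` (x +o M)"
  then obtain y where "z = - y" "y - x \<in> M" by (auto simp: mem_coset_iff)
  then show "z \<in> (- x) +o M" using additive_subgroupD(3)[OF assms, of "y - x"] by (simp add: mem_coset_iff)
next
  fix z assume "z \<in> (- x) +o M"
  then have "z + x \<in> M" by (simp add: mem_coset_iff)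
  then have "- z - x \<in> M" using additive_subgroupD(3)[OF assms, of "z + x"] by simp
  then have "- z \<in> x +o M" by (simp add: mem_coset_iff)
  then show "z \<in> uminus ` (x +o M)" by force
qed

lemma torus_hom_coset:
  assumes "additive_subgroup M" "L \<subseteq> M" "0 \<in> L"
  shows "torus_hom M (x +o L) = x +o M"
proof -
  have "L + M = M"
  proof
    show "L + M \<subseteq> M" using additive_subgroupD(4)[OF assms(1)] assms(2) by (auto simp: set_plus_def)
    show "M \<subseteq> L + M" using assms(3) by (force simp: set_plus_def)
  qed
  then show ?thesis by (simp add: torus_hom_def set_plus_rearrange3)
qed

lemma real_vec_simps:
  "real_vec 0 = 0" "real_vec (u + w) = real_vec u + real_vec w" "real_vec (u - w) = real_vec u - real_vec w"
  "real_vec (k *s u) = of_int k *\<^sub>R real_vec u"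
  by (simp_all add: real_vec_def vec_eq_iff)

lemma additive_subgroup_face_lattice: "additive_subgroup (face_lattice P \<Lambda> F)"
  unfolding additive_subgroup_def face_lattice_def
  by (force simp flip: real_vec_simps intro: int_vec.span_zero int_vec.span_diff)

lemma additive_subgroup_NN: "additive_subgroup NN"
  unfolding additive_subgroup_def NN_def by (auto simp flip: real_vec_simps)

lemma face_lattice_subset_NN: "face_lattice P \<Lambda> F \<subseteq> NN"
  by (auto simp: face_lattice_def NN_def)

lemma span_face_lattice:
  "span (face_lattice P \<Lambda> F) = span (real_vec ` \<Lambda> ` {E. E edge_of P \<and> F \<subseteq> E})" (is "_ = span (real_vec ` ?A)")
proof
  have "real_vec u \<in> span (real_vec ` ?A)" if "u \<in> int_vec.span ?A" for u
    using that
  proof (induction rule: int_vec.span_induct_alt)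
    case (step c x y)
    then show ?case unfolding real_vec_simps by (blast intro: span_add span_scale span_base)
  qed (simp add: real_vec_simps span_zero)
  then show "span (face_lattice P \<Lambda> F) \<subseteq> span (real_vec ` ?A)"
    by (intro span_minimal subspace_span) (auto simp: face_lattice_def)
  show "span (real_vec ` ?A) \<subseteq> span (face_lattice P \<Lambda> F)"
    by (intro span_mono) (auto simp: face_lattice_def intro: int_vec.span_base)
qed

text \<open>The face whose relative interior contains \<open>p\<close> is the smallest face containing \<open>p\<close>: a point on
  the relative boundary of a face lies in a facet of it.\<close>

lemma face_at:
  assumes "polygon P" "p \<in> P"
  shows "face_at P p face_of P" "p \<in> rel_interior (face_at P p)"
proof -
  have "finite {F. F face_of P \<and> p \<in> F}"
    using finite_polyhedron_faces[OF polygon_polyhedron[OF assms(1)]] by (rule rev_finite_subset) auto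
  moreover have "P \<in> {F. F face_of P \<and> p \<in> F}" using assms polygon_convex by (simp add: face_of_refl)
  ultimately obtain F where F: "F face_of P" "p \<in> F"
    "\<And>F'. F' face_of P \<Longrightarrow> p \<in> F' \<Longrightarrow> F' \<subseteq> F \<Longrightarrow> F' = F"
    using finite_has_minimal[of "{F. F face_of P \<and> p \<in> F}"] by blast
  have "p \<in> rel_interior F"
  proof (rule ccontr)
    assume "p \<notin> rel_interior F"
    moreover have "polyhedron F"
      using face_of_polyhedron_polyhedron[OF polygon_polyhedron[OF assms(1)] F(1)] .
    ultimately obtain F' where F': "F' facet_of F" "p \<in> F'"
      using F(2) rel_boundary_of_polyhedron[of F] by blast
    then have "F' face_of F" "aff_dim F' < aff_dim F" by (auto simp: facet_of_def)
    moreover from this have "F' = F"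
      using F(3)[OF face_of_trans[OF _ F(1)] F'(2)] face_of_imp_subset by blast
    ultimately show False by simp
  qed
  then have "\<exists>!F. F face_of P \<and> p \<in> rel_interior F"
    using F(1) face_of_eq by blast
  from theI'[OF this] show "face_at P p face_of P" "p \<in> rel_interior (face_at P p)"
    by (simp_all add: face_at_def)
qed

lemma face_lattice_face_at:
  assumes "polygon P" "p \<in> P"
  shows "face_lattice P \<Lambda> (face_at P p) = face_lattice P \<Lambda> {p}"
proof -
  have "face_at P p \<subseteq> E \<longleftrightarrow> p \<in> E" if "E edge_of P" for E
    using face_at[OF assms] that subset_of_face_of[of E P "face_at P p"] face_of_imp_subset rel_interior_subset
    unfolding edge_of_def by blast
  then have "{E. E edge_of P \<and> face_at P p \<subseteq> E} = {E. E edge_of P \<and> {p} \<subseteq> E}" by auto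
  then show ?thesis by (simp add: face_lattice_def)
qed

text \<open>The common properties of the two fibrations \<open>X\<close> (with \<open>U = P\<close>, \<open>M = NN\<close>) and
  $\widetilde X_v$ (with \<open>U = vertex_nbhd P v\<close>, \<open>M = face_lattice P \<Lambda> {v}\<close>).\<close>

locale torus_fibration =
  fixes P U M :: "(real ^ 2) set" and \<Lambda> :: "(real ^ 2) set \<Rightarrow> int ^ 2"
  assumes polygon: "polygon P" and U_sub: "U \<subseteq> P"
    and subgroup_M: "additive_subgroup M" and span_M: "span M = UNIV"
    and lattice_sub: "\<And>p. p \<in> U \<Longrightarrow> face_lattice P \<Lambda> {p} \<subseteq> M"
begin

text \<open>The fibre relation over \<open>p\<close>, for representatives of the cosets in the plane.\<close>

definition fibre_equiv :: "real ^ 2 \<Rightarrow> real ^ 2 \<Rightarrow> real ^ 2 \<Rightarrow> bool" where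
  "fibre_equiv p y y' \<longleftrightarrow> (\<exists>x\<in>span (face_lattice P \<Lambda> {p}). y - y' - x \<in> M)"

definition fibre_class :: "real ^ 2 \<Rightarrow> real ^ 2 \<Rightarrow> point set" where
  "fibre_class p y = fibre_rel P \<Lambda> U M `` {(p, y +o M)}"

lemma torus_M: "torus M = range (\<lambda>y. y +o M)"
  by (simp add: torus_def span_M)

lemma fibre_equiv_refl: "fibre_equiv p y y"
  unfolding fibre_equiv_def
  by (rule bexI[of _ 0]) (simp_all add: span_zero additive_subgroupD(1)[OF subgroup_M])

lemma fibre_equiv_sym:
  assumes "fibre_equiv p y y'" shows "fibre_equiv p y' y"
proof -
  obtain x where x: "x \<in> span (face_lattice P \<Lambda> {p})" "y - y' - x \<in> M"
    using assms by (auto simp: fibre_equiv_def)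
  have "y' - y - (- x) = - (y - y' - x)" by simp
  then have "y' - y - (- x) \<in> M" using additive_subgroupD(3)[OF subgroup_M x(2)] by (simp only:)
  then show ?thesis unfolding fibre_equiv_def using span_neg[OF x(1)] by blast
qed

lemma fibre_equiv_trans:
  assumes "fibre_equiv p y y'" "fibre_equiv p y' y''"
  shows "fibre_equiv p y y''"
proof -
  obtain x x' where x: "x \<in> span (face_lattice P \<Lambda> {p})" "y - y' - x \<in> M"
    and x': "x' \<in> span (face_lattice P \<Lambda> {p})" "y' - y'' - x' \<in> M"
    using assms by (auto simp: fibre_equiv_def)
  have "y - y'' - (x + x') = (y - y' - x) + (y' - y'' - x')" by simp
  then have "y - y'' - (x + x') \<in> M" using additive_subgroupD(4)[OF subgroup_M x(2) x'(2)] by (simp only:)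
  then show ?thesis unfolding fibre_equiv_def using span_add[OF x(1) x'(1)] by blast
qed

lemma fibre_equiv_translate: "fibre_equiv p (x + y) (x + y') \<longleftrightarrow> fibre_equiv p y y'"
  by (simp add: fibre_equiv_def)

lemma fibre_rel_iff:
  assumes "p \<in> U"
  shows "((p, y +o M), (q, y' +o M)) \<in> fibre_rel P \<Lambda> U M \<longleftrightarrow> q = p \<and> fibre_equiv p y y'"
proof -
  have L: "face_lattice P \<Lambda> (face_at P p) = face_lattice P \<Lambda> {p}"
    using face_lattice_face_at[OF polygon] assms U_sub by blast
  have hom: "torus_hom M (x +o face_lattice P \<Lambda> {p}) = x +o M" for x
    by (rule torus_hom_coset[OF subgroup_M lattice_sub[OF assms]
          additive_subgroupD(1)[OF additive_subgroup_face_lattice]])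
  have diff: "uminus ` (y' +o M) + (y +o M) = (y - y') +o M"
    by (simp add: coset_uminus[OF subgroup_M] coset_add[OF subgroup_M])
  have img: "torus_hom M ` torus (face_lattice P \<Lambda> {p}) = (\<lambda>x. x +o M) ` span (face_lattice P \<Lambda> {p})"
    by (simp add: torus_def[of "face_lattice P \<Lambda> {p}"] image_image hom)
  have "((p, y +o M), (q, y' +o M)) \<in> fibre_rel P \<Lambda> U M \<longleftrightarrow>
      q = p \<and> (\<exists>x\<in>span (face_lattice P \<Lambda> {p}). (y - y') +o M = x +o M)"
    using assms L img by (auto simp: fibre_rel_def torus_M diff)
  then show ?thesis by (simp add: fibre_equiv_def coset_eq_iff[OF subgroup_M])
qed

lemma fibre_rel_sub: "fibre_rel P \<Lambda> U M \<subseteq> (U \<times> torus M) \<times> (U \<times> torus M)"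
  by (auto simp: fibre_rel_def)

lemma equiv_fibre_rel: "equiv (U \<times> torus M) (fibre_rel P \<Lambda> U M)"
proof (rule equivI)
  show "fibre_rel P \<Lambda> U M \<subseteq> (U \<times> torus M) \<times> (U \<times> torus M)" by (rule fibre_rel_sub)
  show "refl_on (U \<times> torus M) (fibre_rel P \<Lambda> U M)"
    by (rule refl_onI) (auto simp: torus_M fibre_rel_iff fibre_equiv_refl)
  show "sym (fibre_rel P \<Lambda> U M)"
  proof (rule symI)
    fix a b assume ab: "(a, b) \<in> fibre_rel P \<Lambda> U M"
    then obtain p y q y' where "a = (p, y +o M)" "b = (q, y' +o M)" "p \<in> U" "q \<in> U"
      using fibre_rel_sub unfolding torus_M by blast
    then show "(b, a) \<in> fibre_rel P \<Lambda> U M" using ab by (auto simp: fibre_rel_iff fibre_equiv_sym)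
  qed
  show "trans (fibre_rel P \<Lambda> U M)"
  proof (rule transI)
    fix a b c assume ab: "(a, b) \<in> fibre_rel P \<Lambda> U M" and bc: "(b, c) \<in> fibre_rel P \<Lambda> U M"
    then obtain p y q y' r y'' where "a = (p, y +o M)" "b = (q, y' +o M)" "c = (r, y'' +o M)"
      "p \<in> U" "q \<in> U" "r \<in> U"
      using fibre_rel_sub unfolding torus_M by blast
    then show "(a, c) \<in> fibre_rel P \<Lambda> U M"
      using ab bc by (auto simp: fibre_rel_iff intro: fibre_equiv_trans)
  qed
qed

lemma fibre_class_eq_iff:
  assumes "p \<in> U" "q \<in> U"
  shows "fibre_class p y = fibre_class q y' \<longleftrightarrow> p = q \<and> fibre_equiv p y y'"
  unfolding fibre_class_def
  using eq_equiv_class_iff[OF equiv_fibre_rel, of "(p, y +o M)" "(q, y' +o M)"] assms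
  by (auto simp: fibre_rel_iff torus_M)

lemma fibre_class_eq:
  assumes "p \<in> U"
  shows "fibre_class p y = {(p, y' +o M) | y'. fibre_equiv p y y'}"
proof (intro set_eqI iffI)
  fix a assume a: "a \<in> fibre_class p y"
  then have "(((p, y +o M)), a) \<in> fibre_rel P \<Lambda> U M" by (simp add: fibre_class_def)
  moreover from this obtain q y' where "a = (q, y' +o M)" using fibre_rel_sub unfolding torus_M by blast
  ultimately show "a \<in> {(p, y' +o M) | y'. fibre_equiv p y y'}" using assms by (auto simp: fibre_rel_iff)
qed (auto simp: fibre_class_def fibre_rel_iff assms)

lemma fibre_quotient: "(U \<times> torus M) // fibre_rel P \<Lambda> U M = {fibre_class p y | p y. p \<in> U}"
  unfolding quotient_def fibre_class_def torus_M by blast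

lemma fst_fibre_class:
  assumes "p \<in> U" shows "fst ` fibre_class p y = {p}"
  unfolding fibre_class_eq[OF assms] using fibre_equiv_refl[of p y] by force

lemma orbit_map_fibre_class: "p \<in> U \<Longrightarrow> orbit_map (fibre_class p y) = p"
  by (simp add: orbit_map_def fst_fibre_class)

end

text \<open>A map of fibres that preserves the equivalence induces a map of the classes, since the
  class on the right contains the image of the whole class on the left.\<close>

lemma fibre_class_map:
  assumes "torus_fibration P U M \<Lambda>" "torus_fibration Q V M' \<Lambda>'" and p: "p \<in> U" "q \<in> V"
    and k: "\<And>y. k (p, y +o M) = (q, y +o M')"
    and equiv: "\<And>y'. torus_fibration.fibre_equiv P M \<Lambda> p y y' \<Longrightarrow> torus_fibration.fibre_equiv Q M' \<Lambda>' q y y'"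
  shows "fibre_rel Q \<Lambda>' V M' `` (k ` torus_fibration.fibre_class P U M \<Lambda> p y) =
    torus_fibration.fibre_class Q V M' \<Lambda>' q y"
proof -
  interpret a: torus_fibration P U M \<Lambda> by fact
  interpret b: torus_fibration Q V M' \<Lambda>' by fact
  have "k ` a.fibre_class p y = {(q, y' +o M') | y'. a.fibre_equiv p y y'}"
    unfolding a.fibre_class_eq[OF p(1)] image_def by (auto simp: k)
  then have "fibre_rel Q \<Lambda>' V M' `` (k ` a.fibre_class p y) =
      (\<Union>y'\<in>{y'. a.fibre_equiv p y y'}. b.fibre_class q y')"
    unfolding b.fibre_class_def by auto
  also have "\<dots> = (\<Union>y'\<in>{y'. a.fibre_equiv p y y'}. b.fibre_class q y)"
    by (rule SUP_cong[OF refl]) (use equiv b.fibre_class_eq_iff[OF p(2) p(2)] in \<open>metis mem_Collect_eq\<close>)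
  also have "\<dots> = b.fibre_class q y" using a.fibre_equiv_refl by blast
  finally show ?thesis .
qed

lemma det_cols_eq: "det_cols u v = u $ 1 * v $ 2 - u $ 2 * v $ 1"
  by (simp add: det_cols_def det_2 transpose_def)

lemma real_vec_coordinates:
  assumes "det_cols u v \<noteq> 0"
  shows "\<exists>!q. y = fst q *\<^sub>R real_vec u + snd q *\<^sub>R real_vec v"
proof -
  define D where "D = real_of_int (u $ 1) * v $ 2 - u $ 2 * v $ 1"
  have "D = of_int (det_cols u v)" by (simp add: D_def det_cols_eq)
  then have "D \<noteq> 0" using assms by simp
  let ?q = "((y $ 1 * v $ 2 - y $ 2 * v $ 1) / D, (u $ 1 * y $ 2 - u $ 2 * y $ 1) / D)"
  show ?thesis
  proof (rule ex1I[of _ ?q])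
    show "y = fst ?q *\<^sub>R real_vec u + snd ?q *\<^sub>R real_vec v"
      using \<open>D \<noteq> 0\<close> by (simp add: vec_eq_iff forall_2 real_vec_def field_simps) (simp add: D_def algebra_simps)
    fix q assume "y = fst q *\<^sub>R real_vec u + snd q *\<^sub>R real_vec v"
    then have y: "y $ 1 = fst q * u $ 1 + snd q * v $ 1" "y $ 2 = fst q * u $ 2 + snd q * v $ 2"
      by (simp_all add: real_vec_def)
    have "y $ 1 * v $ 2 - y $ 2 * v $ 1 = fst q * D" "u $ 1 * y $ 2 - u $ 2 * y $ 1 = snd q * D"
      unfolding y D_def by (simp_all add: algebra_simps)
    then show "q = ?q" using \<open>D \<noteq> 0\<close> by (simp add: prod_eq_iff)
  qed
qed

text \<open>If the determinant vanished, the coordinates of each vector would be the coefficients of integral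
  relations between the two.\<close>

lemma primitive_characteristic_det:
  assumes "primitive_characteristic P \<Lambda>" "E edge_of P" "E' edge_of P" "E \<noteq> E'" "E \<inter> E' \<noteq> {}"
  shows "det_cols (\<Lambda> E) (\<Lambda> E') \<noteq> 0"
proof
  assume 0: "det_cols (\<Lambda> E) (\<Lambda> E') = 0"
  have ind: "a = 0 \<and> b = 0" if "a *s \<Lambda> E + b *s \<Lambda> E' = 0" for a b
    using assms that unfolding primitive_characteristic_def by blast
  define x1 x2 y1 y2 where "x1 = \<Lambda> E $ 1" and "x2 = \<Lambda> E $ 2" and "y1 = \<Lambda> E' $ 1" and "y2 = \<Lambda> E' $ 2"
  have D: "x1 * y2 = x2 * y1" using 0 by (simp add: det_cols_eq x1_def x2_def y1_def y2_def)
  have "y1 *s \<Lambda> E + (- x1) *s \<Lambda> E' = 0"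
    using D by (simp add: vec_eq_iff forall_2 algebra_simps flip: x1_def x2_def y1_def y2_def)
  then have "y1 = 0" "x1 = 0" using ind by fastforce+
  moreover have "y2 *s \<Lambda> E + (- x2) *s \<Lambda> E' = 0"
    using D by (simp add: vec_eq_iff forall_2 algebra_simps flip: x1_def x2_def y1_def y2_def)
  then have "y2 = 0" "x2 = 0" using ind by fastforce+
  ultimately have "1 *s \<Lambda> E + 0 *s \<Lambda> E' = 0"
    by (simp add: vec_eq_iff forall_2 flip: x1_def x2_def y1_def y2_def)
  from ind[OF this] show False by simp
qed

lemma span_UNIV_of_det:
  assumes "det_cols u v \<noteq> 0" "real_vec u \<in> S" "real_vec v \<in> S"
  shows "span S = UNIV"
proof -
  have "y \<in> span S" for y
  proof -
    obtain q where "y = fst q *\<^sub>R real_vec u + snd q *\<^sub>R real_vec v"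
      using real_vec_coordinates[OF assms(1), of y] by blast
    then show ?thesis using assms(2,3) by (simp add: span_add span_scale span_base)
  qed
  then show ?thesis by blast
qed

lemma span_NN: "span NN = UNIV"
  by (rule span_UNIV_of_det[of "vector [1, 0]" "vector [0, 1]"]) (auto simp: NN_def det_cols_eq)

lemma torus_fibration_NN:
  assumes "polygon P" shows "torus_fibration P P NN \<Lambda>"
  using assms additive_subgroup_NN span_NN face_lattice_subset_NN by unfold_locales auto

section \<open>Corners of a polygon\<close>

text \<open>The choices on which a chart at \<open>v\<close> depends: the order of the two edges at \<open>v\<close> and their edge
  functions.\<close>

locale polygon_corner =
  fixes P :: "(real ^ 2) set" and v :: "real ^ 2" and E E' :: "(real ^ 2) set" and f f' :: "real ^ 2 \<Rightarrow> real"
  assumes polygon: "polygon P" and edges: "E edge_of P" "E' edge_of P" and distinct: "E \<noteq> E'"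
    and v: "v \<in> E" "v \<in> E'" and ef: "edge_function P E f" "edge_function P E' f'"
begin

abbreviation "U \<equiv> vertex_nbhd P v"

lemma swapped: "polygon_corner P v E' E f' f"
  using polygon edges distinct v ef by unfold_locales auto

lemma U_sub: "U \<subseteq> P"
  by (auto simp: vertex_nbhd_iff)

lemma edge_at_v_iff: "F edge_of P \<Longrightarrow> v \<in> F \<longleftrightarrow> F = E \<or> F = E'"
  using at_most_two_edges_at_point[OF polygon edges _ distinct v] v by blast

lemma edges_at:
  assumes "p \<in> U"
  shows "{F. F edge_of P \<and> p \<in> F} = (if p \<in> E then {E} else {}) \<union> (if p \<in> E' then {E'} else {})"
  using assms edges edge_at_v_iff by (auto simp: vertex_nbhd_iff)

text \<open>For \<open>z\<close> in the chart, the orbit of the point with the coordinates \<open>z\<close>.\<close>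

definition corner_point :: "C2 \<Rightarrow> real ^ 2" where
  "corner_point z = (THE x. f x = (norm (fst z))\<^sup>2 \<and> f' x = (norm (snd z))\<^sup>2)"

text \<open>By \<open>U_iff\<close>, the neighbourhood \<open>U\<close> is the part \<open>f, f' \<ge> 0\<close> of this open set. The choice of the edge functions is
  immaterial, as they are unique up to positive factors.\<close>

definition other_functions_pos :: "(real ^ 2) set" where
  "other_functions_pos = (\<Inter>F\<in>{F. F edge_of P \<and> v \<notin> F}. {x. (SOME g. edge_function P F g) x > 0})"

lemma coordinates:
  obtains a b a' b' e e' where "f = (\<lambda>x. a \<bullet> x + b)" "f' = (\<lambda>x. a' \<bullet> x + b')"
    "a \<bullet> e = 1" "a \<bullet> e' = 0" "a' \<bullet> e = 0" "a' \<bullet> e' = 1"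
    "\<And>x. x = v + f x *\<^sub>R e + f' x *\<^sub>R e'" "\<And>s t. f (v + s *\<^sub>R e + t *\<^sub>R e') = s"
    "\<And>s t. f' (v + s *\<^sub>R e + t *\<^sub>R e') = t"
    "\<And>z. corner_point z = v + (norm (fst z))\<^sup>2 *\<^sub>R e + (norm (snd z))\<^sup>2 *\<^sub>R e'"
proof -
  obtain a b a' b' e e' where f: "f = (\<lambda>x. a \<bullet> x + b)" "f' = (\<lambda>x. a' \<bullet> x + b')"
    and e: "a \<bullet> e = 1" "a \<bullet> e' = 0" "a' \<bullet> e = 0" "a' \<bullet> e' = 1"
    and x: "\<And>x. x = v + f x *\<^sub>R e + f' x *\<^sub>R e'"
    by (rule corner_coordinates[OF polygon edges distinct v ef], rule that)
  have "f v = 0" "f' v = 0" using ef v by (simp_all add: edge_function_def)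
  then have ev: "f (v + s *\<^sub>R e + t *\<^sub>R e') = s" "f' (v + s *\<^sub>R e + t *\<^sub>R e') = t" for s t
    using e by (simp_all add: f inner_add_right)
  have "corner_point z = v + (norm (fst z))\<^sup>2 *\<^sub>R e + (norm (snd z))\<^sup>2 *\<^sub>R e'" for z
    unfolding corner_point_def by (rule the_equality) (use ev x in metis)+
  then show thesis using that f e x ev by blast
qed

lemma f_eq_imp_eq: "f p = f q \<Longrightarrow> f' p = f' q \<Longrightarrow> p = q"
  by (rule coordinates) metis

lemma f_corner_point: "f (corner_point z) = (norm (fst z))\<^sup>2" "f' (corner_point z) = (norm (snd z))\<^sup>2"
  by (rule coordinates, simp)+

lemma open_other_functions_pos: "open other_functions_pos"
  and other_functions_pos_convex: "x \<in> other_functions_pos \<Longrightarrow> 0 \<le> t \<Longrightarrow> t \<le> 1 \<Longrightarrow>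
    (1 - t) *\<^sub>R v + t *\<^sub>R x \<in> other_functions_pos"
  and U_iff: "x \<in> U \<longleftrightarrow> x \<in> other_functions_pos \<and> f x \<ge> 0 \<and> f' x \<ge> 0"
proof -
  define fe where "fe F = (SOME g. edge_function P F g)" for F
  have fe: "F edge_of P \<Longrightarrow> edge_function P F (fe F)" for F
    unfolding fe_def using edge_function_exists[OF polygon] by (rule someI_ex)
  define B where "B = {F. F edge_of P \<and> v \<notin> F}"
  have O: "other_functions_pos = (\<Inter>F\<in>B. {x. fe F x > 0})"
    by (simp add: other_functions_pos_def B_def fe_def)
  have "finite B" using finite_edges[OF polygon] by (simp add: B_def)
  then show "open other_functions_pos"
    unfolding O using edge_function_continuous[OF fe]
    by (intro open_INT) (auto simp: B_def intro!: open_Collect_less)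
  have vP: "v \<in> P" using v edges edge_of_imp_subset by blast
  show "(1 - t) *\<^sub>R v + t *\<^sub>R x \<in> other_functions_pos"
    if "x \<in> other_functions_pos" "0 \<le> t" "t \<le> 1"
  proof -
    have "fe F ((1 - t) *\<^sub>R v + t *\<^sub>R x) > 0" if F: "F \<in> B" for F
    proof -
      have F': "F edge_of P" "v \<notin> F" using F by (auto simp: B_def)
      have "fe F v > 0" using edge_function_pos_iff[OF polygon F'(1) fe[OF F'(1)] vP] F'(2) by simp
      moreover have "fe F x > 0" using \<open>x \<in> other_functions_pos\<close> F unfolding O by blast
      ultimately have "(1 - t) * fe F v + t * fe F x > 0"
        using \<open>0 \<le> t\<close> \<open>t \<le> 1\<close>
        by (cases "t = 0") (auto intro!: add_nonneg_pos mult_pos_pos)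
      then show ?thesis using edge_function_affine[OF fe[OF F'(1)], of "1 - t" t v x] by simp
    qed
    then show ?thesis unfolding O by blast
  qed
  show "x \<in> U \<longleftrightarrow> x \<in> other_functions_pos \<and> f x \<ge> 0 \<and> f' x \<ge> 0"
  proof
    assume x: "x \<in> U"
    then have "x \<in> P" using U_sub by blast
    moreover have "fe F x > 0" if "F \<in> B" for F
      using that x edge_function_pos_iff[OF polygon _ fe \<open>x \<in> P\<close>] by (auto simp: B_def vertex_nbhd_iff)
    ultimately show "x \<in> other_functions_pos \<and> f x \<ge> 0 \<and> f' x \<ge> 0"
      unfolding O using edge_function_nonneg[OF polygon] ef by blast
  next
    assume x: "x \<in> other_functions_pos \<and> f x \<ge> 0 \<and> f' x \<ge> 0"
    define ge where "ge F = (if F = E then f else if F = E' then f' else fe F)" for F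
    have ge: "F edge_of P \<Longrightarrow> edge_function P F (ge F)" for F using ef fe by (simp add: ge_def)
    have "ge F x \<ge> 0" if "F edge_of P" for F
    proof (cases "F \<in> B")
      case True
      then have "fe F x > 0" using x unfolding O by blast
      then show ?thesis using x by (simp add: ge_def)
    next
      case False
      then show ?thesis using that edge_at_v_iff x by (auto simp: B_def ge_def)
    qed
    then have "x \<in> P" using polygon_eq_halfplanes[OF polygon ge] by blast
    moreover have "x \<notin> F" if "F \<in> B" for F
    proof -
      have "F edge_of P" "fe F x > 0" using that x unfolding O by (auto simp: B_def)
      then show ?thesis using edge_function_pos_iff[OF polygon _ fe \<open>x \<in> P\<close>] by blast
    qed
    ultimately show "x \<in> U" by (auto simp: vertex_nbhd_iff B_def)
  qed
qed

lemma f_zero_iff: "p \<in> U \<Longrightarrow> f p = 0 \<longleftrightarrow> p \<in> E" "p \<in> U \<Longrightarrow> f' p = 0 \<longleftrightarrow> p \<in> E'"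
  using edge_function_zero_iff[OF polygon edges(1) ef(1)] edge_function_zero_iff[OF polygon edges(2) ef(2)] U_sub
  by blast+

lemma f_nonneg: "p \<in> U \<Longrightarrow> f p \<ge> 0" "p \<in> U \<Longrightarrow> f' p \<ge> 0"
  by (simp_all add: U_iff)

lemma v_in_U: "v \<in> U"
  using edges v edge_of_imp_subset by (auto simp: vertex_nbhd_iff)

definition corner_domain :: "C2 set" where
  "corner_domain = {z. corner_point z \<in> U}"

lemma corner_domain_eq: "corner_domain = corner_point -` other_functions_pos"
  by (auto simp: corner_domain_def U_iff f_corner_point)

lemma smooth_corner_point: "open S \<Longrightarrow> smooth_on S corner_point"
proof (rule coordinates)
  fix e e' assume S: "open S"
    and eq: "\<And>z. corner_point z = v + (norm (fst z))\<^sup>2 *\<^sub>R e + (norm (snd z))\<^sup>2 *\<^sub>R e'"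
  have "smooth_on S (\<lambda>z. v + (fst z \<bullet> fst z) *\<^sub>R e + (snd z \<bullet> snd z) *\<^sub>R e')"
    by (intro smooth_on_add smooth_on_scaleR smooth_on_const smooth_on_bounded_linear S
        smooth_on_bounded_bilinear[OF bounded_bilinear_inner] bounded_linear_fst bounded_linear_snd)
  then show ?thesis by (simp add: eq[abs_def] power2_norm_eq_inner)
qed

lemma open_corner_domain: "open corner_domain"
  unfolding corner_domain_eq
  using open_other_functions_pos smooth_on_imp_continuous_on[OF smooth_corner_point[OF open_UNIV]]
  by (rule open_vimage)

text \<open>Scaling \<open>z\<close> by \<open>t\<close> moves \<open>corner_point z\<close> towards \<open>v\<close> by the factor \<open>t\<^sup>2\<close>, so the domain is
  star-shaped.\<close>

lemma connected_corner_domain: "connected corner_domain"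
proof -
  have "closed_segment 0 z \<subseteq> corner_domain" if "z \<in> corner_domain" for z
  proof
    fix x assume "x \<in> closed_segment 0 z"
    then obtain t where t: "0 \<le> t" "t \<le> 1" "x = t *\<^sub>R z" by (auto simp: closed_segment_def)
    have "corner_point x = (1 - t\<^sup>2) *\<^sub>R v + t\<^sup>2 *\<^sub>R corner_point z"
      by (rule coordinates) (simp add: t(3) power_mult_distrib algebra_simps)
    moreover have "t\<^sup>2 \<le> 1" using t by (simp add: power_le_one)
    ultimately show "x \<in> corner_domain"
      using that other_functions_pos_convex[of "corner_point z" "t\<^sup>2"] by (simp add: corner_domain_eq)
  qed
  moreover have "0 \<in> corner_domain"
  proof -
    have "corner_point 0 = v" by (rule coordinates) simp
    then show ?thesis using v_in_U by (simp add: corner_domain_def)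
  qed
  ultimately have "starlike corner_domain" unfolding starlike_def by blast
  then show ?thesis by (rule starlike_imp_connected)
qed

end

text \<open>The map of charts that covers a map \<open>h\<close> of polygons and keeps the angles; \<open>cp\<close> is the projection of the chart to the
  polygon. Where $z_a = 0$, the default value \<open>0\<close> of the quotient does no harm, as it is multiplied by $z_a$.\<close>

definition corner_lift :: "(C2 \<Rightarrow> real ^ 2) \<Rightarrow> (real ^ 2 \<Rightarrow> real) \<Rightarrow> (real ^ 2 \<Rightarrow> real) \<Rightarrow>
    (real ^ 2 \<Rightarrow> real ^ 2) \<Rightarrow> C2 \<Rightarrow> C2" where
  "corner_lift cp g g' h z =
     ((sqrt (g (h (cp z))) / norm (fst z)) *\<^sub>R fst z, (sqrt (g' (h (cp z))) / norm (snd z)) *\<^sub>R snd z)"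

text \<open>The situation is symmetric in \<open>h\<close> and its inverse \<open>hi\<close>, and in the two edges at each vertex; so every
  statement about \<open>h\<close> and the first edge yields three more.\<close>

locale corner_diffeo = c: polygon_corner P v E E' f f' + d: polygon_corner Q w F F' g g'
  for P v E E' f f' Q w F F' g g' +
  fixes h hi :: "real ^ 2 \<Rightarrow> real ^ 2"
  assumes h_in: "\<And>p. p \<in> vertex_nbhd P v \<Longrightarrow> h p \<in> vertex_nbhd Q w"
    and hi_in: "\<And>q. q \<in> vertex_nbhd Q w \<Longrightarrow> hi q \<in> vertex_nbhd P v"
    and hi_h: "\<And>p. p \<in> vertex_nbhd P v \<Longrightarrow> hi (h p) = p"
    and h_hi: "\<And>q. q \<in> vertex_nbhd Q w \<Longrightarrow> h (hi q) = q"
    and h_smooth: "extends_smoothly (vertex_nbhd P v) h"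
    and hi_smooth: "extends_smoothly (vertex_nbhd Q w) hi"
    and h_edge: "\<And>p. p \<in> vertex_nbhd P v \<Longrightarrow> h p \<in> F \<longleftrightarrow> p \<in> E"
    and h_edge': "\<And>p. p \<in> vertex_nbhd P v \<Longrightarrow> h p \<in> F' \<longleftrightarrow> p \<in> E'"
begin

lemma inverse: "corner_diffeo Q w F F' g g' P v E E' f f' hi h"
proof unfold_locales
  show "hi q \<in> E \<longleftrightarrow> q \<in> F" "hi q \<in> E' \<longleftrightarrow> q \<in> F'" if "q \<in> vertex_nbhd Q w" for q
    using h_edge[OF hi_in[OF that]] h_edge'[OF hi_in[OF that]] h_hi[OF that] by simp_all
qed (use h_in hi_in hi_h h_hi h_smooth hi_smooth in auto)

lemma swapped: "corner_diffeo P v E' E f' f Q w F' F g' g h hi"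
  using c.swapped d.swapped unfolding corner_diffeo_def corner_diffeo_axioms_def
  using h_in hi_in hi_h h_hi h_smooth hi_smooth h_edge h_edge' by blast

lemma Hadamard_quotient:
  assumes "p \<in> vertex_nbhd P v" "f p = 0"
  obtains V u where "open V" "p \<in> V" "smooth_on V u" "\<And>x. x \<in> V \<Longrightarrow> x \<in> vertex_nbhd P v \<Longrightarrow> g (h x) = f x * u x"
proof (rule c.coordinates)
  fix a b e e' a' b' assume f: "f = (\<lambda>x. a \<bullet> x + b)" "f' = (\<lambda>x. a' \<bullet> x + b')"
    and e: "a \<bullet> e = 1" "a' \<bullet> e = 0"
  obtain W H where W: "open W" "vertex_nbhd P v \<subseteq> W" "smooth_on W H" "\<And>x. x \<in> vertex_nbhd P v \<Longrightarrow> H x = h x"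
    using h_smooth unfolding extends_smoothly_def by blast
  obtain n m where g: "g = (\<lambda>x. n \<bullet> x + m)" using d.ef(1) by (auto simp: edge_function_def)
  define W' where "W' = W \<inter> c.other_functions_pos"
  have W': "open W'" "p \<in> W'"
    using W(1,2) c.open_other_functions_pos assms(1) c.U_iff[of p] by (auto simp: W'_def)
  have G: "smooth_on W' (\<lambda>x. g (H x))"
    by (rule smooth_on_compose[of _ UNIV, OF W'(1) open_UNIV smooth_on_subset[OF W(3)]])
      (auto simp: W'_def g intro: affine_imp_smooth_on)
  have fp: "a \<bullet> p + b = 0" using assms(2) f by simp
  obtain V u where V: "open V" "p \<in> V" "V \<subseteq> W'" "smooth_on V u"
    "\<And>x. x \<in> V \<Longrightarrow> x - (a \<bullet> x + b) *\<^sub>R e \<in> W'"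
    "\<And>x. x \<in> V \<Longrightarrow> g (H x) - g (H (x - (a \<bullet> x + b) *\<^sub>R e)) = (a \<bullet> x + b) * u x"
    using Hadamard_division[OF W' G fp e(1)] by metis
  have "g (h x) = f x * u x" if x: "x \<in> V" "x \<in> vertex_nbhd P v" for x
  proof -
    define y where "y = x - f x *\<^sub>R e"
    have "f y = 0" "f' y = f' x" using e by (simp_all add: y_def f inner_diff_right)
    moreover have "y \<in> c.other_functions_pos" using V(5)[OF x(1)] by (simp add: y_def f W'_def)
    ultimately have y: "y \<in> vertex_nbhd P v" using x(2) by (simp add: c.U_iff)
    then have "h y \<in> F" using \<open>f y = 0\<close> h_edge c.f_zero_iff by blast
    then have "g (h y) = 0" using d.ef(1) by (simp add: edge_function_def)
    then show ?thesis using V(6)[OF x(1)] W(4)[OF x(2)] W(4)[OF y] by (simp add: y_def f)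
  qed
  then show thesis using that V by blast
qed

text \<open>The quotient \<open>(g \<circ> h) / f\<close> extends smoothly across \<open>E\<close> by Hadamard's lemma. So does the
  corresponding quotient for \<open>hi\<close>; the product of the two is one off \<open>E\<close>, hence also on \<open>E\<close>, so that
  neither vanishes.\<close>

lemma smooth_positive_quotient:
  assumes p: "p \<in> vertex_nbhd P v"
  obtains V u where "open V" "p \<in> V" "smooth_on V u" "\<And>x. x \<in> V \<Longrightarrow> u x > 0"
    "\<And>x. x \<in> V \<Longrightarrow> x \<in> vertex_nbhd P v \<Longrightarrow> g (h x) = f x * u x"
proof -
  obtain W H where W: "open W" "vertex_nbhd P v \<subseteq> W" "smooth_on W H" "\<And>x. x \<in> vertex_nbhd P v \<Longrightarrow> H x = h x"
    using h_smooth unfolding extends_smoothly_def by blast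
  note contH = smooth_on_imp_continuous_on[OF W(3)]
  show thesis
  proof (cases "f p = 0")
    case False
    obtain n m where g: "g = (\<lambda>x. n \<bullet> x + m)" using d.ef(1) by (auto simp: edge_function_def)
    obtain a b where f: "f = (\<lambda>x. a \<bullet> x + b)" using c.ef(1) by (auto simp: edge_function_def)
    define V where "V = W \<inter> {x. f x > 0} \<inter> (W \<inter> (\<lambda>x. g (H x)) -` {0<..})"
    have "open V" unfolding V_def
      by (intro open_Int W(1) open_Collect_less continuous_on_const edge_function_continuous[OF c.ef(1)]
          continuous_open_preimage continuous_on_compose2[OF edge_function_continuous[OF d.ef(1)] contH]) auto
    have "h p \<notin> F" using False h_edge[OF p] c.f_zero_iff[OF p] by simp
    then have "g (h p) > 0" using d.f_zero_iff[OF h_in[OF p]] d.f_nonneg[OF h_in[OF p]] by simp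
    then have "p \<in> V" using p W(2,4) False c.f_nonneg[OF p] by (auto simp: V_def)
    have "smooth_on V (\<lambda>x. g (H x))"
      by (rule smooth_on_compose[of _ UNIV, OF \<open>open V\<close> open_UNIV smooth_on_subset[OF W(3)]])
        (auto simp: V_def g intro: affine_imp_smooth_on)
    moreover have "smooth_on V f" using affine_imp_smooth_on[OF \<open>open V\<close>] by (simp add: f)
    ultimately have "smooth_on V (\<lambda>x. g (H x) / f x)"
      using \<open>open V\<close> by (intro smooth_on_divide) (auto simp: V_def)
    then show thesis
      by (rule that[OF \<open>open V\<close> \<open>p \<in> V\<close>]) (use W(4) in \<open>auto simp: V_def\<close>)
  next
    case True
    interpret inv: corner_diffeo Q w F F' g g' P v E E' f f' hi h by (rule inverse)
    have "g (h p) = 0" using True h_edge[OF p] c.f_zero_iff[OF p] d.ef(1) by (simp add: edge_function_def)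
    obtain V u where V: "open V" "p \<in> V" "smooth_on V u"
      "\<And>x. x \<in> V \<Longrightarrow> x \<in> vertex_nbhd P v \<Longrightarrow> g (h x) = f x * u x"
      using Hadamard_quotient[OF p True] by metis
    obtain V' u' where V': "open V'" "h p \<in> V'" "smooth_on V' u'"
      "\<And>x. x \<in> V' \<Longrightarrow> x \<in> vertex_nbhd Q w \<Longrightarrow> f (hi x) = g x * u' x"
      using inv.Hadamard_quotient[OF h_in[OF p] \<open>g (h p) = 0\<close>] by metis
    obtain e e' where e: "\<And>x. x = v + f x *\<^sub>R e + f' x *\<^sub>R e'" "\<And>s t. f (v + s *\<^sub>R e + t *\<^sub>R e') = s"
      "\<And>s t. f' (v + s *\<^sub>R e + t *\<^sub>R e') = t"
    proof (rule c.coordinates, goal_cases)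
      case (1 a b a' b' e e')
      from 1(8-10) show ?case by (rule 1(1))
    qed
    define z where "z t = v + t *\<^sub>R e + f' p *\<^sub>R e'" for t
    have z0: "z 0 = p" using e(1)[of p] True by (simp add: z_def)
    have fz: "f (z t) = t" "f' (z t) = f' p" for t using e by (simp_all add: z_def)
    have z_lim: "(z \<longlongrightarrow> p) (at_right 0)"
    proof -
      have "(z \<longlongrightarrow> z 0) (at_right 0)" unfolding z_def by (intro tendsto_intros)
      then show ?thesis by (simp only: z0)
    qed
    have pW: "p \<in> W" using p W(2) by blast
    have H_lim: "((\<lambda>t. H (z t)) \<longlongrightarrow> h p) (at_right 0)"
      using continuous_on_tendsto_compose[OF contH z_lim pW] topological_tendstoD[OF z_lim W(1) pW] W(4)[OF p]
      by simp
    have u_lim: "((\<lambda>t. u (z t)) \<longlongrightarrow> u p) (at_right 0)"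
      by (rule continuous_on_tendsto_compose[OF smooth_on_imp_continuous_on[OF V(3)] z_lim V(2)
            topological_tendstoD[OF z_lim V(1,2)]])
    have u'_lim: "((\<lambda>t. u' (H (z t))) \<longlongrightarrow> u' (h p)) (at_right 0)"
      by (rule continuous_on_tendsto_compose[OF smooth_on_imp_continuous_on[OF V'(3)] H_lim V'(2)
            topological_tendstoD[OF H_lim V'(1,2)]])
    have "eventually (\<lambda>t. t > (0::real)) (at_right 0)" by (simp add: eventually_at_right_less)
    moreover have "eventually (\<lambda>t. z t \<in> V) (at_right 0)" by (rule topological_tendstoD[OF z_lim V(1,2)])
    moreover have "eventually (\<lambda>t. H (z t) \<in> V') (at_right 0)" by (rule topological_tendstoD[OF H_lim V'(1,2)])
    moreover have "eventually (\<lambda>t. z t \<in> c.other_functions_pos) (at_right 0)"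
      using topological_tendstoD[OF z_lim c.open_other_functions_pos] p c.U_iff by blast
    ultimately have ev: "eventually (\<lambda>t. u (z t) \<ge> 0 \<and> u (z t) * u' (H (z t)) = 1) (at_right 0)"
    proof eventually_elim
      case (elim t)
      have zU: "z t \<in> vertex_nbhd P v" using elim c.f_nonneg[OF p] by (simp add: c.U_iff fz)
      have g1: "g (h (z t)) = t * u (z t)" using V(4)[OF elim(2) zU] fz by simp
      have "t = g (h (z t)) * u' (h (z t))"
        using V'(4)[of "h (z t)"] elim(3) h_in[OF zU] W(4)[OF zU] hi_h[OF zU] fz by simp
      then have "t * (u (z t) * u' (H (z t))) = t" unfolding g1 W(4)[OF zU] by (simp add: mult_ac)
      moreover have "t * u (z t) \<ge> 0" using g1 d.f_nonneg[OF h_in[OF zU]] by simp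
      ultimately show ?case using elim(1) by (simp add: zero_le_mult_iff)
    qed
    have "((\<lambda>t. u (z t) * u' (H (z t))) \<longlongrightarrow> u p * u' (h p)) (at_right 0)"
      by (rule tendsto_mult[OF u_lim u'_lim])
    moreover have "((\<lambda>t. u (z t) * u' (H (z t))) \<longlongrightarrow> 1) (at_right 0)"
      by (rule tendsto_eventually) (use ev in \<open>auto elim: eventually_mono\<close>)
    ultimately have "u p * u' (h p) = 1"
      by (rule tendsto_unique[OF trivial_limit_at_right_real])
    moreover have "u p \<ge> 0"
      by (rule tendsto_lowerbound[OF u_lim _ trivial_limit_at_right_real]) (use ev in \<open>auto elim: eventually_mono\<close>)
    ultimately have "u p > 0" by (cases "u p = 0") auto
    define V1 where "V1 = V \<inter> u -` {0<..}"
    have "open V1" unfolding V1_def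
      by (rule continuous_open_preimage[OF smooth_on_imp_continuous_on[OF V(3)] V(1)]) simp
    then show thesis
      using that[of V1 u] V smooth_on_subset[OF V(3)] \<open>u p > 0\<close> by (auto simp: V1_def)
  qed
qed

text \<open>As \<open>f\<close> is the squared norm of the coordinate \<open>C z\<close>, the factor is the square root of the smooth positive quotient of
  \<open>g \<circ> h\<close> by \<open>f\<close>.\<close>

lemma smooth_lift_component:
  assumes C: "bounded_linear C" and CN: "\<And>z. f (c.corner_point z) = (norm (C z))\<^sup>2"
  shows "smooth_on c.corner_domain (\<lambda>z. (sqrt (g (h (c.corner_point z))) / norm (C z)) *\<^sub>R (C z :: complex))"
proof (rule smooth_on_local)
  fix z0 assume "z0 \<in> c.corner_domain"
  then have p: "c.corner_point z0 \<in> vertex_nbhd P v" by (simp add: c.corner_domain_def)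
  obtain V u where V: "open V" "c.corner_point z0 \<in> V" "smooth_on V u" "\<And>x. x \<in> V \<Longrightarrow> u x > 0"
    "\<And>x. x \<in> V \<Longrightarrow> x \<in> vertex_nbhd P v \<Longrightarrow> g (h x) = f x * u x"
    using smooth_positive_quotient[OF p] by metis
  define N where "N = c.corner_domain \<inter> c.corner_point -` V"
  have "open N" unfolding N_def
    by (rule continuous_open_preimage[OF smooth_on_imp_continuous_on[OF c.smooth_corner_point] c.open_corner_domain V(1)])
      (rule c.open_corner_domain)
  have sub: "c.corner_point ` N \<subseteq> V" by (auto simp: N_def)
  have "smooth_on N (\<lambda>z. sqrt (u (c.corner_point z)) *\<^sub>R C z)"
    by (intro smooth_on_scaleR \<open>open N\<close> smooth_on_bounded_linear[OF C]
        smooth_on_compose[OF \<open>open N\<close> _ _ smooth_on_sqrt]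
        smooth_on_compose[OF \<open>open N\<close> V(1) c.smooth_corner_point[OF \<open>open N\<close>] V(3) sub]) (use V(4) sub in auto)
  moreover have "(sqrt (g (h (c.corner_point z))) / norm (C z)) *\<^sub>R C z = sqrt (u (c.corner_point z)) *\<^sub>R C z"
    if "z \<in> N" for z
  proof (cases "C z = 0")
    case False
    have "g (h (c.corner_point z)) = (norm (C z))\<^sup>2 * u (c.corner_point z)"
      using that V(5)[of "c.corner_point z"] CN by (auto simp: N_def c.corner_domain_def)
    then show ?thesis using False by (simp add: real_sqrt_mult)
  qed simp
  ultimately have "smooth_on N (\<lambda>z. (sqrt (g (h (c.corner_point z))) / norm (C z)) *\<^sub>R C z)"
    by (subst smooth_on_cong[OF \<open>open N\<close>]) auto
  moreover have "z0 \<in> N" using \<open>z0 \<in> c.corner_domain\<close> V(2) by (simp add: N_def)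
  ultimately show "\<exists>V. open V \<and> z0 \<in> V \<and>
      smooth_on V (\<lambda>z. (sqrt (g (h (c.corner_point z))) / norm (C z)) *\<^sub>R C z)"
    using \<open>open N\<close> by blast
qed

lemma smooth_corner_lift: "smooth_on c.corner_domain (corner_lift c.corner_point g g' h)"
proof -
  interpret sw: corner_diffeo P v E' E f' f Q w F' F g' g h hi by (rule swapped)
  have cp: "sw.c.corner_point z = c.corner_point (snd z, fst z)" for z
    by (rule c.f_eq_imp_eq) (simp_all add: sw.c.f_corner_point c.f_corner_point)
  define S where "S z = (snd z, fst z)" for z :: C2
  have S: "bounded_linear S" unfolding S_def
    by (intro bounded_linear_Pair bounded_linear_fst bounded_linear_snd)
  have "smooth_on sw.c.corner_domain (\<lambda>z. (sqrt (g' (h (sw.c.corner_point z))) / norm (fst z)) *\<^sub>R fst z)"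
    by (rule sw.smooth_lift_component[OF bounded_linear_fst]) (simp add: sw.c.f_corner_point)
  moreover have "S ` c.corner_domain \<subseteq> sw.c.corner_domain"
    by (auto simp: S_def c.corner_domain_def sw.c.corner_domain_def cp)
  ultimately have "smooth_on c.corner_domain (\<lambda>z. (sqrt (g' (h (sw.c.corner_point (S z)))) / norm (fst (S z))) *\<^sub>R fst (S z))"
    using smooth_on_compose[OF c.open_corner_domain sw.c.open_corner_domain
          smooth_on_bounded_linear[OF S c.open_corner_domain], of
          "\<lambda>z. (sqrt (g' (h (sw.c.corner_point z))) / norm (fst z)) *\<^sub>R fst z"]
    by blast
  then have "smooth_on c.corner_domain (\<lambda>z. (sqrt (g' (h (c.corner_point z))) / norm (snd z)) *\<^sub>R snd z)"
    by (simp add: S_def cp)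
  moreover have "smooth_on c.corner_domain (\<lambda>z. (sqrt (g (h (c.corner_point z))) / norm (fst z)) *\<^sub>R fst z)"
    by (rule smooth_lift_component[OF bounded_linear_fst]) (simp add: c.f_corner_point)
  ultimately show ?thesis
    unfolding corner_lift_def[abs_def] by (intro smooth_on_Pair c.open_corner_domain)
qed

end

section \<open>The charts at the vertices\<close>

lemma exp_2pi_eq_iff:
  "exp (2 * complex_of_real pi * \<i> * complex_of_real \<alpha>) =
    exp (2 * complex_of_real pi * \<i> * complex_of_real \<beta>) \<longleftrightarrow> \<alpha> - \<beta> \<in> \<int>"
proof -
  have A: "2 * complex_of_real pi * \<i> * complex_of_real t = complex_of_real (2 * pi * t) * \<i>" for t
    unfolding of_real_mult of_real_numeral by (simp only: mult_ac)
  have B: "complex_of_real (2 * pi * \<alpha>) * \<i> = complex_of_real (2 * pi * \<beta>) * \<i> + of_int (2 * n) * pi * \<i> \<longleftrightarrow>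
      \<alpha> - \<beta> = of_int n" for n
  proof -
    have sum: "complex_of_real (2 * pi * \<beta>) * \<i> + of_int (2 * n) * pi * \<i> =
        complex_of_real (2 * pi * \<beta> + of_int (2 * n) * pi) * \<i>"
      unfolding of_real_add of_real_mult of_real_of_int_eq by (rule distrib_right[symmetric])
    have "2 * pi * \<alpha> = 2 * pi * \<beta> + of_int (2 * n) * pi \<longleftrightarrow> 2 * pi * (\<alpha> - \<beta> - of_int n) = 0"
      unfolding right_diff_distrib by (simp only: of_int_mult of_int_numeral) argo
    then have real: "2 * pi * \<alpha> = 2 * pi * \<beta> + of_int (2 * n) * pi \<longleftrightarrow> \<alpha> - \<beta> = of_int n" by simp
    have "complex_of_real s * \<i> = complex_of_real t * \<i> \<longleftrightarrow> s = t" for s t by simp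
    then show ?thesis unfolding sum real[symmetric] by blast
  qed
  show ?thesis unfolding exp_eq A B by (auto elim: Ints_cases)
qed

locale characteristic_corner = polygon_corner +
  fixes \<Lambda> :: "(real ^ 2) set \<Rightarrow> int ^ 2"
  assumes det: "det_cols (\<Lambda> E) (\<Lambda> E') \<noteq> 0"
begin

abbreviation "M \<equiv> face_lattice P \<Lambda> {v}"
abbreviation "angle y \<equiv> fst (angular_coords \<Lambda> E E' y)"
abbreviation "angle' y \<equiv> snd (angular_coords \<Lambda> E E' y)"

lemma angular_coords_eq: "y = angle y *\<^sub>R real_vec (\<Lambda> E) + angle' y *\<^sub>R real_vec (\<Lambda> E')"
  unfolding angular_coords_def using theI'[OF real_vec_coordinates[OF det]] .

lemma angular_coords_unique:
  assumes "y = s *\<^sub>R real_vec (\<Lambda> E) + t *\<^sub>R real_vec (\<Lambda> E')"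
  shows "angle y = s" "angle' y = t"
proof -
  have "angular_coords \<Lambda> E E' y = (s, t)"
    unfolding angular_coords_def
    by (rule the1_equality[OF real_vec_coordinates[OF det]]) (simp add: assms)
  then show "angle y = s" "angle' y = t" by simp_all
qed

lemma angle_diff: "angle (y - y') = angle y - angle y'" "angle' (y - y') = angle' y - angle' y'"
proof -
  have "y - y' = (angle y - angle y') *\<^sub>R real_vec (\<Lambda> E) + (angle' y - angle' y') *\<^sub>R real_vec (\<Lambda> E')"
    by (subst angular_coords_eq[of y], subst angular_coords_eq[of y']) (simp add: algebra_simps)
  then show "angle (y - y') = angle y - angle y'" "angle' (y - y') = angle' y - angle' y'"
    by (rule angular_coords_unique)+
qed

lemma edges_at_v: "{F. F edge_of P \<and> {v} \<subseteq> F} = {E, E'}"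
  using edges_at[OF v_in_U] v by auto

lemma mem_M_iff: "x \<in> M \<longleftrightarrow> angle x \<in> \<int> \<and> angle' x \<in> \<int>"
proof
  assume "x \<in> M"
  then obtain u where u: "u \<in> int_vec.span {\<Lambda> E, \<Lambda> E'}" "x = real_vec u"
    unfolding face_lattice_def edges_at_v by auto
  then obtain k l where "u = k *s \<Lambda> E + l *s \<Lambda> E'"
    by (auto simp: int_vec.span_insert algebra_simps)
  then have "x = of_int k *\<^sub>R real_vec (\<Lambda> E) + of_int l *\<^sub>R real_vec (\<Lambda> E')"
    using u(2) by (simp add: real_vec_simps)
  from angular_coords_unique[OF this] show "angle x \<in> \<int> \<and> angle' x \<in> \<int>" by simp
next
  assume "angle x \<in> \<int> \<and> angle' x \<in> \<int>"
  then obtain k l where "angle x = of_int k" "angle' x = of_int l" by (auto elim!: Ints_cases)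
  then have "x = real_vec (k *s \<Lambda> E + l *s \<Lambda> E')"
    using angular_coords_eq[of x] by (simp add: real_vec_simps)
  moreover have "k *s \<Lambda> E + l *s \<Lambda> E' \<in> int_vec.span {\<Lambda> E, \<Lambda> E'}"
    by (intro int_vec.span_add int_vec.span_scale int_vec.span_base) auto
  ultimately show "x \<in> M" unfolding face_lattice_def edges_at_v by auto
qed

lemma mem_span_face_lattice_iff:
  assumes "p \<in> U"
  shows "x \<in> span (face_lattice P \<Lambda> {p}) \<longleftrightarrow> (p \<notin> E \<longrightarrow> angle x = 0) \<and> (p \<notin> E' \<longrightarrow> angle' x = 0)"
proof -
  let ?a = "real_vec (\<Lambda> E)" and ?b = "real_vec (\<Lambda> E')"
  have "{F. F edge_of P \<and> {p} \<subseteq> F} = (if p \<in> E then {E} else {}) \<union> (if p \<in> E' then {E'} else {})"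
    using edges_at[OF assms] by simp
  then have span: "span (face_lattice P \<Lambda> {p}) = span ((if p \<in> E then {?a} else {}) \<union> (if p \<in> E' then {?b} else {}))"
    by (simp add: span_face_lattice image_Un split: if_splits)
  show ?thesis
  proof
    assume "x \<in> span (face_lattice P \<Lambda> {p})"
    then obtain s t where "x = s *\<^sub>R ?a + t *\<^sub>R ?b" "p \<notin> E \<longrightarrow> s = 0" "p \<notin> E' \<longrightarrow> t = 0"
    proof -
      obtain x1 x2 where x: "x = x1 + x2" "x1 \<in> span (if p \<in> E then {?a} else {})"
        "x2 \<in> span (if p \<in> E' then {?b} else {})"
        using \<open>x \<in> span (face_lattice P \<Lambda> {p})\<close> unfolding span span_Un by blast
      have "\<exists>s. x1 = s *\<^sub>R ?a \<and> (p \<notin> E \<longrightarrow> s = 0)"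
        using x(2) by (cases "p \<in> E") (auto simp: span_singleton)
      moreover have "\<exists>t. x2 = t *\<^sub>R ?b \<and> (p \<notin> E' \<longrightarrow> t = 0)"
        using x(3) by (cases "p \<in> E'") (auto simp: span_singleton)
      ultimately show thesis using that x(1) by blast
    qed
    then show "(p \<notin> E \<longrightarrow> angle x = 0) \<and> (p \<notin> E' \<longrightarrow> angle' x = 0)"
      using angular_coords_unique by blast
  next
    assume *: "(p \<notin> E \<longrightarrow> angle x = 0) \<and> (p \<notin> E' \<longrightarrow> angle' x = 0)"
    have "angle x *\<^sub>R ?a \<in> span (face_lattice P \<Lambda> {p})"
      using * unfolding span by (cases "p \<in> E") (simp_all add: span_scale span_base span_zero)
    moreover have "angle' x *\<^sub>R ?b \<in> span (face_lattice P \<Lambda> {p})"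
      using * unfolding span by (cases "p \<in> E'") (simp_all add: span_scale span_base span_zero)
    ultimately show "x \<in> span (face_lattice P \<Lambda> {p})"
      by (subst angular_coords_eq[of x]) (rule span_add)
  qed
qed

sublocale fib: torus_fibration P U M \<Lambda>
proof
  show "polygon P" by (rule polygon)
  show "U \<subseteq> P" by (rule U_sub)
  show "additive_subgroup M" by (rule additive_subgroup_face_lattice)
  show "span M = UNIV" using mem_span_face_lattice_iff[OF v_in_U] v by auto
  show "face_lattice P \<Lambda> {p} \<subseteq> M" if "p \<in> U" for p
  proof -
    have "{F. F edge_of P \<and> {p} \<subseteq> F} \<subseteq> {F. F edge_of P \<and> {v} \<subseteq> F}"
      using that by (auto simp: vertex_nbhd_iff)
    then show ?thesis unfolding face_lattice_def by (intro image_mono int_vec.span_mono)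
  qed
qed

text \<open>The subtorus over \<open>p\<close> consists of those angles that belong to the edges through \<open>p\<close>; only the other
  angles are retained, and these up to integers.\<close>

lemma fibre_equiv_iff:
  assumes "p \<in> U"
  shows "fib.fibre_equiv p y y' \<longleftrightarrow>
    (p \<notin> E \<longrightarrow> angle y - angle y' \<in> \<int>) \<and> (p \<notin> E' \<longrightarrow> angle' y - angle' y' \<in> \<int>)"
proof
  assume "fib.fibre_equiv p y y'"
  then show "(p \<notin> E \<longrightarrow> angle y - angle y' \<in> \<int>) \<and> (p \<notin> E' \<longrightarrow> angle' y - angle' y' \<in> \<int>)"
    using mem_span_face_lattice_iff[OF assms]
    unfolding fib.fibre_equiv_def mem_M_iff angle_diff by fastforce
next
  assume *: "(p \<notin> E \<longrightarrow> angle y - angle y' \<in> \<int>) \<and> (p \<notin> E' \<longrightarrow> angle' y - angle' y' \<in> \<int>)"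
  define s t where "s = (if p \<in> E then angle y - angle y' else 0)"
    and "t = (if p \<in> E' then angle' y - angle' y' else 0)"
  define x where "x = s *\<^sub>R real_vec (\<Lambda> E) + t *\<^sub>R real_vec (\<Lambda> E')"
  have x: "angle x = s" "angle' x = t" by (rule angular_coords_unique[OF x_def])+
  then have "x \<in> span (face_lattice P \<Lambda> {p})"
    by (simp add: mem_span_face_lattice_iff[OF assms] s_def t_def)
  moreover have "y - y' - x \<in> M"
    using * x by (auto simp: mem_M_iff angle_diff s_def t_def)
  ultimately show "fib.fibre_equiv p y y'" unfolding fib.fibre_equiv_def by blast
qed

text \<open>The coordinates of the point of $\widetilde X_v$ that is represented by \<open>(p, y + M)\<close>.\<close>

definition polar :: "real ^ 2 \<Rightarrow> real ^ 2 \<Rightarrow> C2" where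
  "polar p y = (sqrt (f p) * exp (2 * pi * \<i> * angle y), sqrt (f' p) * exp (2 * pi * \<i> * angle' y))"

lemma norm_polar:
  assumes "p \<in> U"
  shows "norm (fst (polar p y)) = sqrt (f p)" "norm (snd (polar p y)) = sqrt (f' p)"
proof -
  have "norm (exp (complex_of_real (2 * pi) * \<i> * complex_of_real s)) = 1" for s
  proof -
    have "complex_of_real (2 * pi) * \<i> * complex_of_real s = \<i> * complex_of_real (2 * pi * s)"
      unfolding of_real_mult[of "2 * pi" s] by (simp only: mult_ac)
    then show ?thesis by (simp only: norm_exp_i_times)
  qed
  then show "norm (fst (polar p y)) = sqrt (f p)" "norm (snd (polar p y)) = sqrt (f' p)"
    using f_nonneg[OF assms] unfolding polar_def fst_conv snd_conv norm_mult norm_of_real by simp_all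
qed

lemma corner_point_polar:
  assumes "p \<in> U" shows "corner_point (polar p y) = p"
proof (rule f_eq_imp_eq)
  show "f (corner_point (polar p y)) = f p" "f' (corner_point (polar p y)) = f' p"
    unfolding f_corner_point norm_polar[OF assms] using f_nonneg[OF assms] by simp_all
qed

text \<open>The angles that are lost over \<open>p\<close> are those that are multiplied by a vanishing radius.\<close>

lemma polar_eq_iff:
  assumes "p \<in> U" "q \<in> U"
  shows "polar p y = polar q y' \<longleftrightarrow> p = q \<and> fib.fibre_equiv p y y'"
proof -
  have "p = q" if "polar p y = polar q y'"
    using that corner_point_polar[OF assms(1)] corner_point_polar[OF assms(2)] by metis
  moreover have "polar p y = polar p y' \<longleftrightarrow> fib.fibre_equiv p y y'"
    using f_zero_iff[OF assms(1)]
    by (simp add: polar_def fibre_equiv_iff[OF assms(1)] exp_2pi_eq_iff) blast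
  ultimately show ?thesis by auto
qed

lemma polar_corner_point: "\<exists>y. polar (corner_point z) y = z"
proof -
  define s t where "s = Arg (fst z) / (2 * pi)" and "t = Arg (snd z) / (2 * pi)"
  define y where "y = s *\<^sub>R real_vec (\<Lambda> E) + t *\<^sub>R real_vec (\<Lambda> E')"
  have polar: "complex_of_real (sqrt ((norm c)\<^sup>2)) * exp (complex_of_real (2 * pi) * \<i> * complex_of_real (Arg c / (2 * pi))) = c" for c :: complex
  proof (cases "c = 0")
    case False
    have "complex_of_real (2 * pi) * \<i> * complex_of_real (Arg c / (2 * pi)) =
        \<i> * complex_of_real (2 * pi * (Arg c / (2 * pi)))"
      unfolding of_real_mult[of "2 * pi" "Arg c / (2 * pi)"] by (simp only: mult_ac)
    moreover have "2 * pi * (Arg c / (2 * pi)) = Arg c" by simp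
    moreover have "sqrt ((norm c)\<^sup>2) = norm c" by simp
    ultimately show ?thesis using Arg_eq[OF False] by (simp only:)
  qed simp
  have "angle y = s" "angle' y = t" by (rule angular_coords_unique[OF y_def])+
  then have "polar (corner_point z) y = z"
    by (simp only: polar_def f_corner_point polar s_def t_def prod.collapse)
  then show ?thesis by blast
qed

lemma corner_domain_polar: "corner_domain = {polar p y | p y. p \<in> U}"
proof (intro set_eqI iffI)
  fix z assume "z \<in> corner_domain"
  then have "corner_point z \<in> U" by (simp add: corner_domain_def)
  moreover obtain y where "polar (corner_point z) y = z" using polar_corner_point[of z] by blast
  ultimately show "z \<in> {polar p y | p y. p \<in> U}" by (intro CollectI exI[of _ "corner_point z"] exI[of _ y]) simp
next
  fix z assume "z \<in> {polar p y | p y. p \<in> U}"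
  then show "z \<in> corner_domain" by (auto simp: corner_domain_def corner_point_polar)
qed

lemma vertex_coords_fibre_class:
  assumes "p \<in> U"
  shows "vertex_coords \<Lambda> E E' f f' (fib.fibre_class p y) = polar p y"
  unfolding vertex_coords_def
proof (rule the_equality)
  have "fib.fibre_equiv p y y" by (rule fib.fibre_equiv_refl)
  moreover have "y \<in> y +o M" using additive_subgroupD(1)[OF fib.subgroup_M] by (simp add: mem_coset_iff)
  ultimately show "\<exists>q t y'. (q, t) \<in> fib.fibre_class p y \<and> y' \<in> t \<and>
      polar p y = (sqrt (f q) * exp (2 * pi * \<i> * angle y'), sqrt (f' q) * exp (2 * pi * \<i> * angle' y'))"
    unfolding fib.fibre_class_eq[OF assms] polar_def by blast
next
  fix z assume "\<exists>q t y'. (q, t) \<in> fib.fibre_class p y \<and> y' \<in> t \<and>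
      z = (sqrt (f q) * exp (2 * pi * \<i> * angle y'), sqrt (f' q) * exp (2 * pi * \<i> * angle' y'))"
  then obtain y' y'' where y: "fib.fibre_equiv p y y'" "y'' \<in> y' +o M" "z = polar p y''"
    unfolding fib.fibre_class_eq[OF assms] polar_def by blast
  have "fib.fibre_equiv p y'' y'"
    unfolding fib.fibre_equiv_def using y(2) by (intro bexI[of _ 0]) (simp_all add: mem_coset_iff span_zero)
  then have "fib.fibre_equiv p y y''"
    using y(1) fib.fibre_equiv_sym fib.fibre_equiv_trans by blast
  then show "z = polar p y" using polar_eq_iff[OF assms assms, of y y''] y(3) by simp
qed

lemma vertex_cover_eq: "vertex_cover P \<Lambda> v = {fib.fibre_class p y | p y. p \<in> U}"
  unfolding vertex_cover_def Let_def by (rule fib.fibre_quotient)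

definition chart_inverse :: "C2 \<Rightarrow> point set" where
  "chart_inverse = the_inv_into (vertex_cover P \<Lambda> v) (vertex_coords \<Lambda> E E' f f')"

lemma chart_inverse_polar:
  assumes "p \<in> U" shows "chart_inverse (polar p y) = fib.fibre_class p y"
proof -
  have "inj_on (vertex_coords \<Lambda> E E' f f') (vertex_cover P \<Lambda> v)"
    unfolding vertex_cover_eq
  proof (rule inj_onI)
    fix c c' assume cc': "c \<in> {fib.fibre_class p y | p y. p \<in> U}" "c' \<in> {fib.fibre_class p y | p y. p \<in> U}"
      and eq: "vertex_coords \<Lambda> E E' f f' c = vertex_coords \<Lambda> E E' f f' c'"
    obtain p y where p: "c = fib.fibre_class p y" "p \<in> U" using cc'(1) by auto
    obtain q y' where q: "c' = fib.fibre_class q y'" "q \<in> U" using cc'(2) by auto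
    note c = p(1) q(1) p(2) q(2)
    have "polar p y = polar q y'"
      using eq by (simp only: c(1,2) vertex_coords_fibre_class[OF c(3)] vertex_coords_fibre_class[OF c(4)])
    then show "c = c'"
      unfolding c(1,2) polar_eq_iff[OF c(3,4)] fib.fibre_class_eq_iff[OF c(3,4)] .
  qed
  moreover have "fib.fibre_class p y \<in> vertex_cover P \<Lambda> v" using assms vertex_cover_eq by blast
  ultimately have "chart_inverse (vertex_coords \<Lambda> E E' f f' (fib.fibre_class p y)) = fib.fibre_class p y"
    unfolding chart_inverse_def by (rule the_inv_into_f_f)
  then show ?thesis by (simp only: vertex_coords_fibre_class[OF assms])
qed

definition chart_action :: "(real ^ 2) set \<Rightarrow> C2 \<Rightarrow> C2" where
  "chart_action g = restrict (vertex_coords \<Lambda> E E' f f' \<circ> vertex_action g \<circ> chart_inverse) corner_domain"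

lemma vertex_chart_eq:
  "vertex_chart P \<Lambda> v E E' f f' =
    (corner_domain, chart_action ` vertex_group P \<Lambda> v, vertex_fold P \<Lambda> \<circ> chart_inverse)"
proof -
  have "vertex_coords \<Lambda> E E' f f' ` vertex_cover P \<Lambda> v = {polar p y | p y. p \<in> U}"
  proof
    show "vertex_coords \<Lambda> E E' f f' ` vertex_cover P \<Lambda> v \<subseteq> {polar p y | p y. p \<in> U}"
    proof
      fix z assume "z \<in> vertex_coords \<Lambda> E E' f f' ` vertex_cover P \<Lambda> v"
      then obtain p y where "p \<in> U" "z = vertex_coords \<Lambda> E E' f f' (fib.fibre_class p y)"
        unfolding vertex_cover_eq by auto
      then show "z \<in> {polar p y | p y. p \<in> U}" using vertex_coords_fibre_class by blast
    qed
    show "{polar p y | p y. p \<in> U} \<subseteq> vertex_coords \<Lambda> E E' f f' ` vertex_cover P \<Lambda> v"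
    proof
      fix z assume "z \<in> {polar p y | p y. p \<in> U}"
      then obtain p y where z: "p \<in> U" "z = polar p y" by auto
      then have "fib.fibre_class p y \<in> vertex_cover P \<Lambda> v" unfolding vertex_cover_eq by blast
      then show "z \<in> vertex_coords \<Lambda> E E' f f' ` vertex_cover P \<Lambda> v"
        using vertex_coords_fibre_class[OF z(1)] z(2) by (metis image_eqI)
    qed
  qed
  then have D: "vertex_coords \<Lambda> E E' f f' ` vertex_cover P \<Lambda> v = corner_domain"
    by (simp add: corner_domain_polar)
  show ?thesis unfolding vertex_chart_def Let_def D chart_action_def[abs_def] chart_inverse_def ..
qed

lemma polar_in_domain: "p \<in> U \<Longrightarrow> polar p y \<in> corner_domain"
  by (auto simp: corner_domain_polar)

lemma chart_action_polar:
  assumes "p \<in> U"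
  shows "chart_action (x +o M) (polar p y) = polar p (x + y)"
proof -
  have "vertex_action (x +o M) (fib.fibre_class p y) = fib.fibre_class p (x + y)"
  proof -
    have "vertex_action (x +o M) (fib.fibre_class p y) =
        {(p, (x +o M) + (y' +o M)) | y'. fib.fibre_equiv p y y'}"
      unfolding vertex_action_def fib.fibre_class_eq[OF assms] image_def by auto
    also have "\<dots> = {(p, (x + y') +o M) | y'. fib.fibre_equiv p y y'}"
      by (simp only: coset_add[OF fib.subgroup_M])
    also have "\<dots> = {(p, y' +o M) | y'. fib.fibre_equiv p (x + y) y'}"
    proof (intro set_eqI iffI)
      fix c assume "c \<in> {(p, y' +o M) | y'. fib.fibre_equiv p (x + y) y'}"
      then obtain y' where y': "c = (p, y' +o M)" "fib.fibre_equiv p (x + y) y'" by blast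
      then have "fib.fibre_equiv p y (y' - x)" using fib.fibre_equiv_translate[of p x y "y' - x"] by simp
      then show "c \<in> {(p, (x + y') +o M) | y'. fib.fibre_equiv p y y'}"
        using y'(1) by (intro CollectI exI[of _ "y' - x"]) simp
    qed (use fib.fibre_equiv_translate in blast)
    finally show ?thesis unfolding fib.fibre_class_eq[OF assms] .
  qed
  then show ?thesis
    unfolding chart_action_def restrict_apply'[OF polar_in_domain[OF assms]] comp_apply
    by (simp only: chart_inverse_polar[OF assms] vertex_coords_fibre_class[OF assms])
qed

lemma vertex_group_cases:
  assumes "g \<in> vertex_group P \<Lambda> v"
  obtains x where "g = x +o M"
  using assms by (auto simp: vertex_group_def fib.torus_M)

lemma chart_action_image:
  assumes "g \<in> vertex_group P \<Lambda> v"
  shows "chart_action g ` corner_domain = corner_domain"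
proof -
  obtain x where x: "g = x +o M" using assms by (rule vertex_group_cases)
  show ?thesis
  proof
    show "chart_action g ` corner_domain \<subseteq> corner_domain"
    proof
      fix z assume "z \<in> chart_action g ` corner_domain"
      then obtain p y where "p \<in> U" "z = chart_action g (polar p y)" by (auto simp: corner_domain_polar)
      then show "z \<in> corner_domain" using chart_action_polar[of p x y] polar_in_domain x by simp
    qed
    show "corner_domain \<subseteq> chart_action g ` corner_domain"
    proof
      fix z assume "z \<in> corner_domain"
      then obtain p y where z: "z = polar p y" "p \<in> U" by (auto simp: corner_domain_polar)
      have "z = chart_action g (polar p (y - x))" using chart_action_polar[OF z(2), of x "y - x"] z x by simp
      then show "z \<in> chart_action g ` corner_domain" using polar_in_domain[OF z(2)] by blast
    qed
  qed
qed

lemma subchart_vertex_chart: "subchart (vertex_chart P \<Lambda> v E E' f f') (vertex_chart P \<Lambda> v E E' f f')"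
proof -
  have restrict: "restrict (chart_action g) corner_domain = chart_action g" for g
    by (simp add: chart_action_def fun_eq_iff restrict_def)
  have "chart_action ` vertex_group P \<Lambda> v =
      {restrict g corner_domain | g. g \<in> chart_action ` vertex_group P \<Lambda> v \<and> g ` corner_domain = corner_domain}"
    (is "?G = ?G'")
  proof
    show "?G \<subseteq> ?G'"
    proof
      fix \<gamma> assume "\<gamma> \<in> ?G"
      then obtain g where g: "\<gamma> = chart_action g" "g \<in> vertex_group P \<Lambda> v" by blast
      then show "\<gamma> \<in> ?G'"
        using restrict[of g] chart_action_image[OF g(2)] by (intro CollectI exI[of _ \<gamma>]) simp
    qed
    show "?G' \<subseteq> ?G" using restrict by auto
  qed
  moreover have "corner_domain \<noteq> {}" using v_in_U polar_in_domain by blast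
  moreover have "\<forall>\<gamma>\<in>?G. \<gamma> ` corner_domain = corner_domain \<or> \<gamma> ` corner_domain \<inter> corner_domain = {}"
    using chart_action_image by blast
  ultimately show ?thesis
    unfolding vertex_chart_eq subchart.simps using open_corner_domain connected_corner_domain by blast
qed

lemma vertex_fold_polar:
  assumes "p \<in> U"
  shows "(vertex_fold P \<Lambda> \<circ> chart_inverse) (polar p y) = torus_fibration.fibre_class P P NN \<Lambda> p y"
proof -
  interpret X: torus_fibration P P NN \<Lambda> by (rule torus_fibration_NN[OF polygon])
  have pP: "p \<in> P" using assms U_sub by blast
  have hom: "torus_hom NN (x +o M) = x +o NN" for x
    by (rule torus_hom_coset[OF additive_subgroup_NN face_lattice_subset_NN additive_subgroupD(1)[OF fib.subgroup_M]])
  have "X.fibre_equiv p y y'" if "fib.fibre_equiv p y y'" for y'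
    using that face_lattice_subset_NN unfolding X.fibre_equiv_def fib.fibre_equiv_def by blast
  then show ?thesis
    unfolding comp_apply chart_inverse_polar[OF assms] vertex_fold_def
    by (intro fibre_class_map[OF fib.torus_fibration_axioms X.torus_fibration_axioms assms pP])
      (simp_all add: hom)
qed

lemma chart_image_vertex_chart:
  "chart_image (vertex_chart P \<Lambda> v E E' f f') = {torus_fibration.fibre_class P P NN \<Lambda> p y | p y. p \<in> U}"
proof -
  have "(vertex_fold P \<Lambda> \<circ> chart_inverse) ` {polar p y | p y. p \<in> U} =
      {(vertex_fold P \<Lambda> \<circ> chart_inverse) (polar p y) | p y. p \<in> U}"
    unfolding image_def by blast
  also have "\<dots> = {torus_fibration.fibre_class P P NN \<Lambda> p y | p y. p \<in> U}"
    using vertex_fold_polar by (intro Collect_cong) metis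
  finally show ?thesis by (simp only: chart_image_def vertex_chart_eq prod.case corner_domain_polar)
qed

end

text \<open>As the edges at \<open>v\<close> and \<open>w\<close> carry the same vectors, the lattices, groups and angular coordinates of the
  two corners agree, and \<open>corner_lift\<close>, which preserves the angles, is equivariant.\<close>

lemma lifts_to_diffeo_vertex_charts:
  assumes diffeo: "corner_diffeo P v E E' f f' Q w F F' g g' h hi"
    and det: "det_cols (\<Lambda> E) (\<Lambda> E') \<noteq> 0" and same: "\<Lambda>h F = \<Lambda> E" "\<Lambda>h F' = \<Lambda> E'"
    and \<rho>: "\<And>p y. p \<in> vertex_nbhd P v \<Longrightarrow>
      \<rho> (torus_fibration.fibre_class P P NN \<Lambda> p y) = torus_fibration.fibre_class Q Q NN \<Lambda>h (h p) y"
  shows "lifts_to_diffeo \<rho> (vertex_chart P \<Lambda> v E E' f f') (vertex_chart Q \<Lambda>h w F F' g g')"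
proof -
  interpret corner_diffeo P v E E' f f' Q w F F' g g' h hi by (rule diffeo)
  interpret inv: corner_diffeo Q w F F' g g' P v E E' f f' hi h by (rule inverse)
  interpret C: characteristic_corner P v E E' f f' \<Lambda> by unfold_locales (rule det)
  interpret D: characteristic_corner Q w F F' g g' \<Lambda>h by unfold_locales (simp add: same det)
  have ac: "angular_coords \<Lambda>h F F' = angular_coords \<Lambda> E E'"
    by (simp add: fun_eq_iff angular_coords_def same)
  have M: "D.M = C.M"
    unfolding face_lattice_def C.edges_at_v D.edges_at_v by (simp add: same)
  then have grp: "vertex_group Q \<Lambda>h w = vertex_group P \<Lambda> v" by (simp add: vertex_group_def)
  define L Li where "L = corner_lift c.corner_point g g' h" and "Li = corner_lift d.corner_point f f' hi"
  \<comment> \<open>The case \<open>b = 0\<close> concerns the points over the edges, where \<open>corner_lift\<close> divides by zero.\<close>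
  have sq: "(sqrt a / b) *\<^sub>R (complex_of_real b * z) = complex_of_real (sqrt a) * z"
    if "b = 0 \<longrightarrow> a = 0" for a b :: real and z
    using that by (cases "b = 0") (auto simp: scaleR_conv_of_real)
  have L: "L (C.polar p y) = D.polar (h p) y" if p: "p \<in> vertex_nbhd P v" for p y
  proof -
    have "g (h p) = 0 \<longleftrightarrow> f p = 0" "g' (h p) = 0 \<longleftrightarrow> f' p = 0"
      using c.f_zero_iff[OF p] d.f_zero_iff[OF h_in[OF p]] h_edge[OF p] h_edge'[OF p] by simp_all
    then show ?thesis
      unfolding L_def corner_lift_def C.corner_point_polar[OF p] C.norm_polar[OF p]
      unfolding C.polar_def D.polar_def ac by (simp add: sq)
  qed
  have Li: "Li (D.polar q y) = C.polar (hi q) y" if q: "q \<in> vertex_nbhd Q w" for q y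
  proof -
    have "f (hi q) = 0 \<longleftrightarrow> g q = 0" "f' (hi q) = 0 \<longleftrightarrow> g' q = 0"
      using d.f_zero_iff[OF q] c.f_zero_iff[OF hi_in[OF q]] inv.h_edge[OF q] inv.h_edge'[OF q] by simp_all
    then show ?thesis
      unfolding Li_def corner_lift_def D.corner_point_polar[OF q] D.norm_polar[OF q]
      unfolding C.polar_def D.polar_def ac by (simp add: sq)
  qed
  have L_in: "L z \<in> d.corner_domain" and Li_L: "Li (L z) = z" if z_in: "z \<in> c.corner_domain" for z
  proof -
    obtain p y where z: "z = C.polar p y" and p: "p \<in> vertex_nbhd P v"
      using z_in unfolding C.corner_domain_polar by blast
    show "L z \<in> d.corner_domain" unfolding z L[OF p] by (rule D.polar_in_domain[OF h_in[OF p]])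
    show "Li (L z) = z" unfolding z L[OF p] Li[OF h_in[OF p]] hi_h[OF p] ..
  qed
  have Li_in: "Li z \<in> c.corner_domain" and L_Li: "L (Li z) = z" if z_in: "z \<in> d.corner_domain" for z
  proof -
    obtain q y where z: "z = D.polar q y" and q: "q \<in> vertex_nbhd Q w"
      using z_in unfolding D.corner_domain_polar by blast
    show "Li z \<in> c.corner_domain" unfolding z Li[OF q] by (rule C.polar_in_domain[OF hi_in[OF q]])
    show "L (Li z) = z" unfolding z Li[OF q] L[OF hi_in[OF q]] h_hi[OF q] ..
  qed
  have bij: "bij_betw L c.corner_domain d.corner_domain"
    by (rule bij_betw_byWitness[of _ Li]) (use L_in Li_L Li_in L_Li in auto)
  have "the_inv_into c.corner_domain L z = Li z" if "z \<in> d.corner_domain" for z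
    by (rule the_inv_into_f_eq[OF bij_betw_imp_inj_on[OF bij] L_Li[OF that] Li_in[OF that]])
  then have "smooth_on d.corner_domain (the_inv_into c.corner_domain L)"
    using inv.smooth_corner_lift smooth_on_cong[OF d.open_corner_domain] unfolding Li_def by metis
  then have diff: "diffeo_on c.corner_domain d.corner_domain L"
    unfolding diffeo_on_def using c.open_corner_domain d.open_corner_domain bij smooth_corner_lift
    by (simp add: L_def)
  have fold: "(vertex_fold Q \<Lambda>h \<circ> D.chart_inverse) (L z) = \<rho> ((vertex_fold P \<Lambda> \<circ> C.chart_inverse) z)"
    if z: "z \<in> c.corner_domain" for z
  proof -
    obtain p y where "z = C.polar p y" "p \<in> vertex_nbhd P v" using z by (auto simp: C.corner_domain_polar)
    then show ?thesis by (simp only: L C.vertex_fold_polar D.vertex_fold_polar[OF h_in] \<rho>)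
  qed
  define conj where "conj \<gamma> = restrict (L \<circ> \<gamma> \<circ> Li) d.corner_domain" for \<gamma>
  have conj: "conj (C.chart_action x) = D.chart_action x" if x: "x \<in> vertex_group P \<Lambda> v" for x
  proof
    fix z
    obtain x' where x': "x = x' +o C.M" using x by (rule C.vertex_group_cases)
    show "conj (C.chart_action x) z = D.chart_action x z"
    proof (cases "z \<in> d.corner_domain")
      case True
      then obtain q y where z: "z = D.polar q y" "q \<in> vertex_nbhd Q w" by (auto simp: D.corner_domain_polar)
      have "conj (C.chart_action x) z = D.polar q (x' + y)"
        using True z by (simp add: conj_def Li L x' C.chart_action_polar hi_in h_hi)
      also have "\<dots> = D.chart_action x z" using D.chart_action_polar[OF z(2), of x' y] by (simp add: x' M z)
      finally show ?thesis .
    qed (simp add: conj_def D.chart_action_def)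
  qed
  have act_in: "C.chart_action x z \<in> c.corner_domain" if "x \<in> vertex_group P \<Lambda> v" "z \<in> c.corner_domain" for x z
    using C.chart_action_image[OF that(1)] that(2) by blast
  have conj_L: "conj \<gamma> (L z) = L (\<gamma> z)" if "z \<in> c.corner_domain" for \<gamma> z
    using that L_in Li_L by (simp add: conj_def)
  have bij_conj: "bij_betw conj (C.chart_action ` vertex_group P \<Lambda> v) (D.chart_action ` vertex_group Q \<Lambda>h w)"
    unfolding bij_betw_def
  proof
    show "inj_on conj (C.chart_action ` vertex_group P \<Lambda> v)"
    proof (rule inj_onI, clarify)
      fix x x' assume x: "x \<in> vertex_group P \<Lambda> v" "x' \<in> vertex_group P \<Lambda> v"
        and eq: "conj (C.chart_action x) = conj (C.chart_action x')"
      show "C.chart_action x = C.chart_action x'"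
      proof
        fix z
        show "C.chart_action x z = C.chart_action x' z"
        proof (cases "z \<in> c.corner_domain")
          case True
          have "L (C.chart_action x z) = L (C.chart_action x' z)"
            using conj_L[OF True] eq by metis
          then show ?thesis using Li_L act_in[OF x(1) True] act_in[OF x(2) True] by metis
        qed (simp add: C.chart_action_def)
      qed
    qed
    show "conj ` C.chart_action ` vertex_group P \<Lambda> v = D.chart_action ` vertex_group Q \<Lambda>h w"
      unfolding image_image grp by (rule image_cong[OF refl conj])
  qed
  show ?thesis
    unfolding C.vertex_chart_eq D.vertex_chart_eq lifts_to_diffeo.simps
  proof (intro exI[of _ L] exI[of _ conj] conjI ballI)
    show "L (\<gamma> z) = conj \<gamma> (L z)" if "z \<in> c.corner_domain" for \<gamma> z using conj_L[OF that] ..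
  qed (fact diff bij_conj fold)+
qed

section \<open>The map of quasitoric orbifolds\<close>

lemma extends_smoothly_imp_continuous_on: "extends_smoothly S f \<Longrightarrow> continuous_on S f"
  unfolding extends_smoothly_def
  by (metis continuous_on_cong continuous_on_subset smooth_on_imp_continuous_on)

lemma extends_smoothly_subset: "extends_smoothly S f \<Longrightarrow> T \<subseteq> S \<Longrightarrow> extends_smoothly T f"
  unfolding extends_smoothly_def by (meson subset_iff)

lemma extends_smoothly_compose:
  assumes "extends_smoothly S f" "extends_smoothly T g" "f ` S \<subseteq> T"
  shows "extends_smoothly S (g \<circ> f)"
proof -
  obtain U f' where f': "open U" "S \<subseteq> U" "smooth_on U f'" "\<forall>x\<in>S. f' x = f x"
    using assms(1) unfolding extends_smoothly_def by blast
  obtain V g' where g': "open V" "T \<subseteq> V" "smooth_on V g'" "\<forall>x\<in>T. g' x = g x"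
    using assms(2) unfolding extends_smoothly_def by blast
  define W where "W = U \<inter> f' -` V"
  have "open W" unfolding W_def
    by (rule continuous_open_preimage[OF smooth_on_imp_continuous_on[OF f'(3)] f'(1) g'(1)])
  moreover have "S \<subseteq> W"
  proof
    fix x assume x: "x \<in> S"
    then have "f' x \<in> V" using f'(4) g'(2) assms(3) by auto
    then show "x \<in> W" using x f'(2) by (auto simp: W_def)
  qed
  moreover have "smooth_on W (\<lambda>x. g' (f' x))"
    by (rule smooth_on_compose[OF \<open>open W\<close> g'(1) smooth_on_subset[OF f'(3)] g'(3)]) (auto simp: W_def)
  moreover have "\<forall>x\<in>S. g' (f' x) = (g \<circ> f) x" using f'(4) g'(4) assms(3) by auto
  ultimately show ?thesis unfolding extends_smoothly_def by blast
qed

text \<open>A map \<open>h\<close> of polygons that contracts the edge \<open>E2\<close> to the vertex \<open>w\<close> and is a diffeomorphism, with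
  inverse \<open>hi\<close>, elsewhere; \<open>hat\<close> is the induced correspondence of edges.\<close>

locale edge_contraction =
  fixes P Q E1 E2 E3 :: "(real ^ 2) set" and \<Lambda> \<Lambda>h :: "(real ^ 2) set \<Rightarrow> int ^ 2" and w :: "real ^ 2"
    and hat :: "(real ^ 2) set \<Rightarrow> (real ^ 2) set" and h hi :: "real ^ 2 \<Rightarrow> real ^ 2"
  assumes P: "polygon P" and Q: "polygon Q" and characteristic: "primitive_characteristic P \<Lambda>"
    and E123: "E1 edge_of P" "E2 edge_of P" "E3 edge_of P" and ne: "E1 \<noteq> E2" "E2 \<noteq> E3" "E1 \<noteq> E3"
    and det13: "det_cols (\<Lambda> E1) (\<Lambda> E3) \<noteq> 0"
    and hat_bij: "bij_betw hat ({E. E edge_of P} - {E2}) {E. E edge_of Q}"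
    and \<Lambda>h: "\<And>E. E edge_of P \<Longrightarrow> E \<noteq> E2 \<Longrightarrow> \<Lambda>h (hat E) = \<Lambda> E"
    and w: "w \<in> hat E1" "w \<in> hat E3"
    and h_smooth: "extends_smoothly P h" and hi_smooth: "extends_smoothly (Q - {w}) hi"
    and h_in: "\<And>p. p \<in> P - E2 \<Longrightarrow> h p \<in> Q - {w}" and hi_in: "\<And>q. q \<in> Q - {w} \<Longrightarrow> hi q \<in> P - E2"
    and h_E2: "\<And>p. p \<in> E2 \<Longrightarrow> h p = w"
    and hi_h: "\<And>p. p \<in> P - E2 \<Longrightarrow> hi (h p) = p" and h_hi: "\<And>q. q \<in> Q - {w} \<Longrightarrow> h (hi q) = q"
    and h_edge: "\<And>p E. p \<in> P - E2 \<Longrightarrow> E edge_of P \<Longrightarrow> E \<noteq> E2 \<Longrightarrow> h p \<in> hat E \<longleftrightarrow> p \<in> E"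
begin

sublocale X: torus_fibration P P NN \<Lambda> by (rule torus_fibration_NN[OF P])
sublocale Y: torus_fibration Q Q NN \<Lambda>h by (rule torus_fibration_NN[OF Q])

lemma hat_edge: "E edge_of P \<Longrightarrow> E \<noteq> E2 \<Longrightarrow> hat E edge_of Q"
  using hat_bij by (auto simp: bij_betw_def)

lemma hat_eq_iff: "E edge_of P \<Longrightarrow> E \<noteq> E2 \<Longrightarrow> F edge_of P \<Longrightarrow> F \<noteq> E2 \<Longrightarrow> hat E = hat F \<longleftrightarrow> E = F"
  using hat_bij by (auto simp: bij_betw_def inj_on_def)

lemma edge_of_Q_cases:
  assumes "F edge_of Q"
  obtains E where "E edge_of P" "E \<noteq> E2" "F = hat E"
proof -
  have "F \<in> hat ` ({E. E edge_of P} - {E2})" using assms hat_bij by (simp add: bij_betw_def)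
  then show thesis using that by blast
qed

lemma w_in_Q: "w \<in> Q"
  using w(1) hat_edge[OF E123(1) ne(1)] edge_of_imp_subset by blast

lemma h_in_Q: "p \<in> P \<Longrightarrow> h p \<in> Q"
  using h_in h_E2 w_in_Q by (cases "p \<in> E2") auto

lemma face_lattice_h:
  assumes p: "p \<in> P - E2"
  shows "face_lattice Q \<Lambda>h {h p} = face_lattice P \<Lambda> {p}"
proof -
  have "\<Lambda>h ` {F. F edge_of Q \<and> {h p} \<subseteq> F} = \<Lambda> ` {E. E edge_of P \<and> {p} \<subseteq> E}"
  proof
    show "\<Lambda>h ` {F. F edge_of Q \<and> {h p} \<subseteq> F} \<subseteq> \<Lambda> ` {E. E edge_of P \<and> {p} \<subseteq> E}"
    proof clarify
      fix F assume F: "F edge_of Q" "{h p} \<subseteq> F"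
      obtain E where "E edge_of P" "E \<noteq> E2" "F = hat E" by (rule edge_of_Q_cases[OF F(1)])
      then show "\<Lambda>h F \<in> \<Lambda> ` {E. E edge_of P \<and> {p} \<subseteq> E}"
        using F(2) h_edge[OF p, of E] \<Lambda>h[of E] by auto
    qed
    show "\<Lambda> ` {E. E edge_of P \<and> {p} \<subseteq> E} \<subseteq> \<Lambda>h ` {F. F edge_of Q \<and> {h p} \<subseteq> F}"
    proof clarify
      fix E assume E: "E edge_of P" "{p} \<subseteq> E"
      then have "E \<noteq> E2" using p by auto
      then have "hat E edge_of Q" "h p \<in> hat E" "\<Lambda> E = \<Lambda>h (hat E)"
        using E hat_edge h_edge[OF p] \<Lambda>h by auto
      then show "\<Lambda> E \<in> \<Lambda>h ` {F. F edge_of Q \<and> {h p} \<subseteq> F}" by auto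
    qed
  qed
  then show ?thesis by (simp add: face_lattice_def)
qed

text \<open>As \<open>w\<close> lies on \<open>hat E1\<close> and \<open>hat E3\<close>, whose vectors are linearly independent, the whole torus is divided
  out over \<open>w\<close>.\<close>

lemma span_face_lattice_w: "span (face_lattice Q \<Lambda>h {w}) = UNIV"
proof (rule span_UNIV_of_det[OF det13])
  have *: "real_vec (\<Lambda> E) \<in> face_lattice Q \<Lambda>h {w}" if E: "E edge_of P" "E \<noteq> E2" "w \<in> hat E" for E
  proof -
    have "\<Lambda> E \<in> \<Lambda>h ` {F. F edge_of Q \<and> {w} \<subseteq> F}" using hat_edge[OF E(1,2)] \<Lambda>h[OF E(1,2)] E(3) by force
    then show ?thesis unfolding face_lattice_def by (intro imageI int_vec.span_base)
  qed
  show "real_vec (\<Lambda> E1) \<in> face_lattice Q \<Lambda>h {w}" "real_vec (\<Lambda> E3) \<in> face_lattice Q \<Lambda>h {w}"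
    using * E123 ne w by auto
qed

text \<open>Off \<open>E2\<close> the same subtorus is divided out over \<open>p\<close> and over \<open>h p\<close>; on \<open>E2\<close>, the subtorus grows to the whole
  torus.\<close>

lemma fibre_equiv_h:
  assumes "p \<in> P" "X.fibre_equiv p y y'"
  shows "Y.fibre_equiv (h p) y y'"
proof (cases "p \<in> E2")
  case True
  have "y - y' - (y - y') \<in> NN" using additive_subgroupD(1)[OF additive_subgroup_NN] by simp
  then show ?thesis unfolding Y.fibre_equiv_def h_E2[OF True] span_face_lattice_w by blast
next
  case False
  then show ?thesis
    using assms face_lattice_h[of p] by (simp add: X.fibre_equiv_def Y.fibre_equiv_def)
qed

lemma fibre_equiv_hi:
  assumes "q \<in> Q - {w}" "Y.fibre_equiv q y y'"
  shows "X.fibre_equiv (hi q) y y'"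
  using assms face_lattice_h[OF hi_in[OF assms(1)]] h_hi[OF assms(1)]
  by (simp add: X.fibre_equiv_def Y.fibre_equiv_def)

definition \<rho> :: "point set \<Rightarrow> point set" where
  "\<rho> c = fibre_rel Q \<Lambda>h Q NN `` ((\<lambda>(p, t). (h p, t)) ` c)"

definition \<sigma> :: "point set \<Rightarrow> point set" where
  "\<sigma> c = fibre_rel P \<Lambda> P NN `` ((\<lambda>(q, t). (hi q, t)) ` c)"

lemma \<rho>_fibre_class: "p \<in> P \<Longrightarrow> \<rho> (X.fibre_class p y) = Y.fibre_class (h p) y"
  unfolding \<rho>_def
  by (intro fibre_class_map X.torus_fibration_axioms Y.torus_fibration_axioms h_in_Q)
    (simp_all add: fibre_equiv_h)

lemma \<sigma>_fibre_class:
  assumes "q \<in> Q - {w}" shows "\<sigma> (Y.fibre_class q y) = X.fibre_class (hi q) y"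
  unfolding \<sigma>_def
  by (intro fibre_class_map X.torus_fibration_axioms Y.torus_fibration_axioms)
    (use assms hi_in[OF assms] fibre_equiv_hi[OF assms] in simp_all)

definition A :: "point set set" where
  "A = topspace (qt_space P \<Lambda>) - {x. orbit_map x \<in> E2}"

definition B :: "point set set" where
  "B = topspace (qt_space Q \<Lambda>h) - {y. orbit_map y = w}"

lemma topspace_torus: "topspace (torus_topology NN) = torus NN"
  by (simp add: torus_topology_def torus_def)

lemma topspace_qt_space:
  "topspace (qt_space P \<Lambda>) = {X.fibre_class p y | p y. p \<in> P}"
  "topspace (qt_space Q \<Lambda>h) = {Y.fibre_class q y | q y. q \<in> Q}"
  unfolding qt_space_def topspace_quot_topology topspace_prod_topology topspace_torus
    topspace_euclidean_subtopology X.torus_M X.fibre_class_def Y.fibre_class_def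
  by (auto simp: image_iff)

lemma A_eq: "A = {X.fibre_class p y | p y. p \<in> P - E2}"
  unfolding A_def topspace_qt_space using X.orbit_map_fibre_class by auto

lemma B_eq: "B = {Y.fibre_class q y | q y. q \<in> Q - {w}}"
  unfolding B_def topspace_qt_space using Y.orbit_map_fibre_class by auto

lemma X_quotient_class:
  assumes "p \<in> P" "t \<in> torus NN"
  obtains y where "fibre_rel P \<Lambda> P NN `` {(p, t)} = X.fibre_class p y" "t = y +o NN"
  using assms unfolding X.torus_M X.fibre_class_def by blast

lemma Y_quotient_class:
  assumes "q \<in> Q" "t \<in> torus NN"
  obtains y where "fibre_rel Q \<Lambda>h Q NN `` {(q, t)} = Y.fibre_class q y" "t = y +o NN"
  using assms unfolding Y.torus_M Y.fibre_class_def by blast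

lemma continuous_map_\<rho>: "continuous_map (qt_space P \<Lambda>) (qt_space Q \<Lambda>h) \<rho>"
  unfolding qt_space_def
proof (rule continuous_compose_quotient_map[OF quotient_map_quot_topology])
  let ?TP = "prod_topology (top_of_set P) (torus_topology NN)"
  let ?TQ = "prod_topology (top_of_set Q) (torus_topology NN)"
  let ?qQ = "\<lambda>x. fibre_rel Q \<Lambda>h Q NN `` {x}"
  have "continuous_map (top_of_set P) (top_of_set Q) h"
    using extends_smoothly_imp_continuous_on[OF h_smooth] h_in_Q by auto
  then have "continuous_map ?TP ?TQ (\<lambda>(p, t). (h p, t))"
    using continuous_map_prod_top[of "top_of_set P" "torus_topology NN" "top_of_set Q" "torus_topology NN" h "\<lambda>t. t"] by simp
  then have "continuous_map ?TP (quot_topology ?TQ ?qQ) (?qQ \<circ> (\<lambda>(p, t). (h p, t)))"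
    using quotient_imp_continuous_map[OF quotient_map_quot_topology] by (rule continuous_map_compose)
  then show "continuous_map ?TP (quot_topology ?TQ ?qQ) (\<rho> \<circ> (\<lambda>x. fibre_rel P \<Lambda> P NN `` {x}))"
  proof (rule continuous_map_eq)
    fix x assume "x \<in> topspace ?TP"
    then obtain p t where x: "x = (p, t)" "p \<in> P" "t \<in> torus NN" by (auto simp: topspace_torus)
    obtain y where y: "fibre_rel P \<Lambda> P NN `` {(p, t)} = X.fibre_class p y" "t = y +o NN"
      by (rule X_quotient_class[OF x(2,3)])
    show "(?qQ \<circ> (\<lambda>(p, t). (h p, t))) x = (\<rho> \<circ> (\<lambda>x. fibre_rel P \<Lambda> P NN `` {x})) x"
      using \<rho>_fibre_class[OF x(2), of y] by (simp add: x(1) y(1)) (simp add: y(2) Y.fibre_class_def)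
  qed
qed

text \<open>\<open>B\<close> is open, so that the topology on \<open>B\<close> is the quotient topology of \<open>(Q - {w}) \<times> torus NN\<close>.\<close>

lemma continuous_map_\<sigma>: "continuous_map (subtopology (qt_space Q \<Lambda>h) B) (qt_space P \<Lambda>) \<sigma>"
proof -
  let ?TP = "prod_topology (top_of_set P) (torus_topology NN)"
  let ?TQ = "prod_topology (top_of_set Q) (torus_topology NN)"
  let ?qP = "\<lambda>x. fibre_rel P \<Lambda> P NN `` {x}" and ?qQ = "\<lambda>x. fibre_rel Q \<Lambda>h Q NN `` {x}"
  let ?W = "(Q - {w}) \<times> torus NN"
  have pre: "{x \<in> topspace ?TQ. ?qQ x \<in> B} = ?W"
  proof -
    have "?qQ (q, t) \<in> B \<longleftrightarrow> q \<noteq> w" if qt: "q \<in> Q" "t \<in> torus NN" for q t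
    proof -
      obtain y where "?qQ (q, t) = Y.fibre_class q y" by (rule Y_quotient_class[OF qt])
      then show ?thesis using qt(1) Y.orbit_map_fibre_class[OF qt(1), of y]
        unfolding B_def topspace_qt_space by auto
    qed
    then show ?thesis by (auto simp: topspace_torus)
  qed
  have "openin (top_of_set Q) (Q - {w})"
    by (intro openin_delete openin_subtopology_self)
  then have "openin ?TQ ?W"
    using openin_prod_Times_iff openin_topspace[of "torus_topology NN"] topspace_torus by metis
  then have "openin (quot_topology ?TQ ?qQ) B"
    unfolding openin_quot_topology pre by (auto simp: B_def qt_space_def)
  then have quot: "quotient_map (subtopology ?TQ ?W) (subtopology (quot_topology ?TQ ?qQ) B) ?qQ"
    using quotient_map_restriction[OF quotient_map_quot_topology pre] by blast
  have "subtopology ?TQ ?W = prod_topology (top_of_set (Q - {w})) (torus_topology NN)"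
    by (simp add: subtopology_Times subtopology_subtopology Int_absorb1 flip: topspace_torus)
  moreover have "continuous_map (top_of_set (Q - {w})) (top_of_set P) hi"
    using extends_smoothly_imp_continuous_on[OF hi_smooth] hi_in by auto
  then have "continuous_map (prod_topology (top_of_set (Q - {w})) (torus_topology NN)) ?TP (\<lambda>(q, t). (hi q, t))"
    using continuous_map_prod_top[of "top_of_set (Q - {w})" "torus_topology NN" "top_of_set P" "torus_topology NN" hi "\<lambda>t. t"] by simp
  ultimately have "continuous_map (subtopology ?TQ ?W) (quot_topology ?TP ?qP) (?qP \<circ> (\<lambda>(q, t). (hi q, t)))"
    using continuous_map_compose[OF _ quotient_imp_continuous_map[OF quotient_map_quot_topology]] by metis
  then have "continuous_map (subtopology ?TQ ?W) (quot_topology ?TP ?qP) (\<sigma> \<circ> ?qQ)"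
  proof (rule continuous_map_eq)
    fix x assume "x \<in> topspace (subtopology ?TQ ?W)"
    then obtain q t where x: "x = (q, t)" "q \<in> Q - {w}" "t \<in> torus NN" by auto
    obtain y where y: "?qQ (q, t) = Y.fibre_class q y" "t = y +o NN"
      using Y_quotient_class[of q t] x by blast
    show "(?qP \<circ> (\<lambda>(q, t). (hi q, t))) x = (\<sigma> \<circ> ?qQ) x"
      using \<sigma>_fibre_class[OF x(2), of y] by (simp add: x(1) y(1)) (simp add: y(2) X.fibre_class_def)
  qed
  then show ?thesis
    unfolding qt_space_def by (rule continuous_compose_quotient_map[OF quot])
qed

lemma homeomorphic_map_\<rho>:
  "homeomorphic_map (subtopology (qt_space P \<Lambda>) A) (subtopology (qt_space Q \<Lambda>h) B) \<rho>"
proof -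
  have top: "topspace (subtopology (qt_space P \<Lambda>) A) = A" "topspace (subtopology (qt_space Q \<Lambda>h) B) = B"
    by (auto simp: A_def B_def)
  have \<rho>: "\<rho> x \<in> B \<and> \<sigma> (\<rho> x) = x" if x: "x \<in> A" for x
  proof -
    obtain p y where p: "x = X.fibre_class p y" "p \<in> P - E2" using x by (auto simp: A_eq)
    then have "\<rho> x = Y.fibre_class (h p) y" using \<rho>_fibre_class by simp
    then show ?thesis using p \<sigma>_fibre_class[OF h_in[OF p(2)]] hi_h[OF p(2)] h_in[OF p(2)] unfolding B_eq by auto
  qed
  have \<sigma>: "\<sigma> x \<in> A \<and> \<rho> (\<sigma> x) = x" if x: "x \<in> B" for x
  proof -
    obtain q y where q: "x = Y.fibre_class q y" "q \<in> Q - {w}" using x by (auto simp: B_eq)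
    then have "\<sigma> x = X.fibre_class (hi q) y" using \<sigma>_fibre_class by simp
    then show ?thesis using q \<rho>_fibre_class[of "hi q"] h_hi[OF q(2)] hi_in[OF q(2)] unfolding A_eq by auto
  qed
  have "homeomorphic_maps (subtopology (qt_space P \<Lambda>) A) (subtopology (qt_space Q \<Lambda>h) B) \<rho> \<sigma>"
    unfolding homeomorphic_maps_def continuous_map_in_subtopology top
    using \<rho> \<sigma> continuous_map_from_subtopology[OF continuous_map_\<rho>] continuous_map_\<sigma> by auto
  then show ?thesis using homeomorphic_maps_map by blast
qed

text \<open>For a vertex \<open>v\<close> off \<open>E2\<close>, the whole chart at \<open>v\<close> is mapped to the whole chart at \<open>h v\<close>. The latter does
  not meet the fibre over \<open>w\<close>, as \<open>w\<close> is the only common point of \<open>hat E1\<close> and \<open>hat E3\<close>.\<close>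

lemma corner_diffeo_h:
  assumes v: "v \<notin> E2" and E: "E edge_of P" "E' edge_of P" "E \<noteq> E'" "v \<in> E" "v \<in> E'"
    and ef: "edge_function P E f" "edge_function P E' f'"
    and eg: "edge_function Q (hat E) g" "edge_function Q (hat E') g'"
  shows "corner_diffeo P v E E' f f' Q (h v) (hat E) (hat E') g g' h hi"
    and "vertex_nbhd P v \<subseteq> P - E2" "vertex_nbhd Q (h v) \<subseteq> Q - {w}"
proof -
  have vP: "v \<in> P - E2" using E(1,4) v edge_of_imp_subset by blast
  have ne2: "E \<noteq> E2" "E' \<noteq> E2" using E v by auto
  show U: "vertex_nbhd P v \<subseteq> P - E2" using v E123(2) by (auto simp: vertex_nbhd_iff)
  have hv: "h v \<in> hat F \<longleftrightarrow> v \<in> F" if "F edge_of P" "F \<noteq> E2" for F using h_edge[OF vP that] .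
  show U': "vertex_nbhd Q (h v) \<subseteq> Q - {w}"
  proof -
    have "\<not> (h v \<in> hat E1 \<and> h v \<in> hat E3)"
    proof
      assume *: "h v \<in> hat E1 \<and> h v \<in> hat E3"
      have "hat E1 \<noteq> hat E3" using hat_eq_iff E123 ne by blast
      then have "h v = w"
        using edges_meet_at_most_once[OF Q hat_edge hat_edge, of E1 E3 "h v" w] E123 ne * w by blast
      then show False using h_in[OF vP] by blast
    qed
    moreover have "hat E1 edge_of Q" "hat E3 edge_of Q" using hat_edge[OF E123(1) ne(1)] hat_edge[OF E123(3)] ne(2) by auto
    ultimately have "w \<notin> vertex_nbhd Q (h v)" using w unfolding vertex_nbhd_iff by blast
    then show ?thesis unfolding vertex_nbhd_def by blast
  qed
  have nbhd: "h p \<in> vertex_nbhd Q (h v) \<longleftrightarrow> p \<in> vertex_nbhd P v" if p: "p \<in> P - E2" for p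
  proof
    assume "h p \<in> vertex_nbhd Q (h v)"
    then have "v \<in> F" if "F edge_of P" "p \<in> F" for F
      using that hat_edge[of F] h_edge[OF p, of F] hv[of F] p by (auto simp: vertex_nbhd_iff)
    then show "p \<in> vertex_nbhd P v" using p by (auto simp: vertex_nbhd_iff)
  next
    assume p': "p \<in> vertex_nbhd P v"
    have "h v \<in> F" if F: "F edge_of Q" "h p \<in> F" for F
    proof -
      obtain F' where F': "F' edge_of P" "F' \<noteq> E2" "F = hat F'" by (rule edge_of_Q_cases[OF F(1)])
      then show ?thesis using F(2) h_edge[OF p F'(1,2)] hv[OF F'(1,2)] p' by (auto simp: vertex_nbhd_iff)
    qed
    then show "h p \<in> vertex_nbhd Q (h v)" using h_in[OF p] by (auto simp: vertex_nbhd_iff)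
  qed
  have hiU: "hi q \<in> vertex_nbhd P v" if "q \<in> vertex_nbhd Q (h v)" for q
    using nbhd[of "hi q"] hi_in[of q] h_hi[of q] that U' by (metis subsetD)
  interpret c: polygon_corner P v E E' f f' using P E ef by unfold_locales
  interpret d: polygon_corner Q "h v" "hat E" "hat E'" g g'
  proof unfold_locales
    show "hat E edge_of Q" "hat E' edge_of Q" using hat_edge E ne2 by auto
    show "hat E \<noteq> hat E'" using hat_eq_iff E ne2 by blast
    show "h v \<in> hat E" "h v \<in> hat E'" using hv E ne2 by auto
  qed (use Q eg in auto)
  show "corner_diffeo P v E E' f f' Q (h v) (hat E) (hat E') g g' h hi"
  proof unfold_locales
    show "h p \<in> vertex_nbhd Q (h v)" if "p \<in> vertex_nbhd P v" for p using nbhd[of p] that U by blast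
    show "hi q \<in> vertex_nbhd P v" if "q \<in> vertex_nbhd Q (h v)" for q by (rule hiU[OF that])
    show "hi (h p) = p" if "p \<in> vertex_nbhd P v" for p using hi_h that U by blast
    show "h (hi q) = q" if "q \<in> vertex_nbhd Q (h v)" for q using h_hi that U' by blast
    show "extends_smoothly (vertex_nbhd P v) h" using extends_smoothly_subset[OF h_smooth] U by blast
    show "extends_smoothly (vertex_nbhd Q (h v)) hi" using extends_smoothly_subset[OF hi_smooth U'] .
    show "h p \<in> hat E \<longleftrightarrow> p \<in> E" if "p \<in> vertex_nbhd P v" for p using h_edge[of p E] that U E ne2 by blast
    show "h p \<in> hat E' \<longleftrightarrow> p \<in> E'" if "p \<in> vertex_nbhd P v" for p using h_edge[of p E'] that U E ne2 by blast
  qed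
qed

text \<open>The charts at the vertices off \<open>E2\<close> cover \<open>A\<close>, and on each of them \<open>\<rho>\<close> lifts.\<close>

lemma orbifold_diffeomorphism_\<rho>:
  "orbifold_diffeomorphism (open_suborbifold (quasitoric_orbifold P \<Lambda>) A)
    (open_suborbifold (quasitoric_orbifold Q \<Lambda>h) B) \<rho>"
  unfolding orbifold_diffeomorphism_def
proof (intro conjI ballI)
  show "homeomorphic_map (fst (open_suborbifold (quasitoric_orbifold P \<Lambda>) A))
      (fst (open_suborbifold (quasitoric_orbifold Q \<Lambda>h) B)) \<rho>"
    using homeomorphic_map_\<rho> by (simp add: open_suborbifold_def quasitoric_orbifold_def)
next
  fix x assume "x \<in> topspace (fst (open_suborbifold (quasitoric_orbifold P \<Lambda>) A))"
  then have "x \<in> A" by (simp add: open_suborbifold_def)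
  then obtain p y where x: "x = X.fibre_class p y" "p \<in> P" "p \<notin> E2" unfolding A_eq by blast
  obtain v E E' where v: "p \<in> vertex_nbhd P v" "v \<notin> E2"
    and E: "E edge_of P" "E' edge_of P" "E \<noteq> E'" "v \<in> E" "v \<in> E'"
    by (rule vertex_nbhds_cover[OF P E123(1,2) ne(1) x(2,3)])
  have ne2: "E \<noteq> E2" "E' \<noteq> E2" using E v by auto
  have edges': "hat E edge_of Q" "hat E' edge_of Q" using hat_edge E ne2 by auto
  obtain f f' where ef: "edge_function P E f" "edge_function P E' f'"
    using edge_function_exists[OF P E(1)] edge_function_exists[OF P E(2)] by metis
  obtain g g' where eg: "edge_function Q (hat E) g" "edge_function Q (hat E') g'"
    using edge_function_exists[OF Q edges'(1)] edge_function_exists[OF Q edges'(2)] by metis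
  note diffeo = corner_diffeo_h[OF v(2) E ef eg]
  interpret corner_diffeo P v E E' f f' Q "h v" "hat E" "hat E'" g g' h hi by (rule diffeo(1))
  have det: "det_cols (\<Lambda> E) (\<Lambda> E') \<noteq> 0"
    using primitive_characteristic_det[OF characteristic E(1-3)] E(4,5) by blast
  have same: "\<Lambda>h (hat E) = \<Lambda> E" "\<Lambda>h (hat E') = \<Lambda> E'" using \<Lambda>h E ne2 by auto
  interpret C: characteristic_corner P v E E' f f' \<Lambda> by unfold_locales (rule det)
  interpret D: characteristic_corner Q "h v" "hat E" "hat E'" g g' \<Lambda>h by unfold_locales (simp add: same det)
  let ?c = "vertex_chart P \<Lambda> v E E' f f'" and ?d = "vertex_chart Q \<Lambda>h (h v) (hat E) (hat E') g g'"
  have in_suborbifold: "\<exists>c'\<in>snd (open_suborbifold (quasitoric_orbifold R \<Lambda>r) S). subchart c c'"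
    if "c \<in> qt_atlas R \<Lambda>r" "chart_image c \<subseteq> S" "subchart c c" for c R \<Lambda>r S
    using that unfolding open_suborbifold_def quasitoric_orbifold_def
    by (intro bexI[of _ c]) (simp_all only: snd_conv mem_Collect_eq, blast)
  have "?c \<in> qt_atlas P \<Lambda>"
    unfolding qt_atlas_def using E ef edges_meet_in_extreme_point[OF P E] by blast
  moreover have "chart_image ?c \<subseteq> A"
    unfolding C.chart_image_vertex_chart A_eq using diffeo(2) by blast
  ultimately have c: "\<exists>c'\<in>snd (open_suborbifold (quasitoric_orbifold P \<Lambda>) A). subchart ?c c'"
    using C.subchart_vertex_chart in_suborbifold by blast
  have "?d \<in> qt_atlas Q \<Lambda>h"
    unfolding qt_atlas_def
    using d.edges d.distinct d.v eg edges_meet_in_extreme_point[OF Q d.edges d.distinct d.v] by blast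
  moreover have "chart_image ?d \<subseteq> B"
    unfolding D.chart_image_vertex_chart B_eq using diffeo(3) by blast
  ultimately have d: "\<exists>d'\<in>snd (open_suborbifold (quasitoric_orbifold Q \<Lambda>h) B). subchart ?d d'"
    using D.subchart_vertex_chart in_suborbifold by blast
  have "x \<in> chart_image ?c" unfolding C.chart_image_vertex_chart x(1) using v(1) by blast
  moreover have "\<rho> x \<in> chart_image ?d"
    unfolding D.chart_image_vertex_chart x(1) \<rho>_fibre_class[OF x(2)] using corner_diffeo.h_in[OF diffeo(1) v(1)] by blast
  moreover have "lifts_to_diffeo \<rho> ?c ?d"
    by (rule lifts_to_diffeo_vertex_charts[OF diffeo(1) det same]) (use \<rho>_fibre_class diffeo(2) in blast)
  ultimately show "\<exists>c d. (\<exists>c'\<in>snd (open_suborbifold (quasitoric_orbifold P \<Lambda>) A). subchart c c') \<and>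
      (\<exists>d'\<in>snd (open_suborbifold (quasitoric_orbifold Q \<Lambda>h) B). subchart d d') \<and>
      x \<in> chart_image c \<and> \<rho> x \<in> chart_image d \<and> lifts_to_diffeo \<rho> c d"
    using c d by blast
qed

end

text \<open>Composing the diffeomorphism from \<open>P\<close> to the polygon \<open>P'\<close> with the collapse of the edge of \<open>P'\<close>
  yields the contraction.\<close>

lemma edge_deletion_imp_contraction:
  assumes P: "polygon P" "primitive_characteristic P \<Lambda>"
    and E: "E1 edge_of P" "E2 edge_of P" "E3 edge_of P" and ne: "E1 \<noteq> E2" "E2 \<noteq> E3" "E1 \<noteq> E3"
    and del: "edge_deletion P \<Lambda> E1 E2 E3 w Q \<Lambda>h" and det: "det_cols (\<Lambda> E1) (\<Lambda> E3) \<noteq> 0"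
  obtains hat h hi where "edge_contraction P Q E1 E2 E3 \<Lambda> \<Lambda>h w hat h hi"
proof -
  from del obtain P' \<phi> where P': "polygon P'" and \<phi>: "polygon_diffeo P P' \<phi>"
    and del': "deletes_edge P' (\<phi> ` E1) (\<phi> ` E2) (\<phi> ` E3) w Q"
    and \<Lambda>h: "\<And>E E'. E edge_of P \<Longrightarrow> E' edge_of Q \<Longrightarrow> \<phi> ` E \<subseteq> E' \<Longrightarrow> \<Lambda>h E' = \<Lambda> E"
    unfolding edge_deletion_def by blast
  define \<psi> where "\<psi> = the_inv_into P \<phi>"
  have bij: "bij_betw \<phi> P P'" and \<phi>_smooth: "extends_smoothly P \<phi>" and \<psi>_smooth: "extends_smoothly P' \<psi>"
    and img: "\<And>E. E edge_of P \<Longrightarrow> \<phi> ` E edge_of P'"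
    and surj: "\<And>E'. E' edge_of P' \<Longrightarrow> \<exists>E. E edge_of P \<and> E' = \<phi> ` E"
    using \<phi> unfolding polygon_diffeo_def \<psi>_def by blast+
  have inj: "inj_on \<phi> P" using bij by (rule bij_betw_imp_inj_on)
  have \<phi>_in: "\<phi> p \<in> P'" and \<psi>_\<phi>: "\<psi> (\<phi> p) = p" if "p \<in> P" for p
    using bij inj that by (auto simp: \<psi>_def bij_betw_def the_inv_into_f_f)
  have \<psi>_in: "\<psi> p \<in> P" and \<phi>_\<psi>: "\<phi> (\<psi> p) = p" if "p \<in> P'" for p
    using bij that bij_betw_the_inv_into[OF bij] f_the_inv_into_f_bij_betw[OF bij]
    by (auto simp: \<psi>_def bij_betw_def)
  have inP: "E \<subseteq> P" if "E edge_of P" for E using that by (rule edge_of_imp_subset)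
  have mem: "\<phi> p \<in> \<phi> ` E \<longleftrightarrow> p \<in> E" if "p \<in> P" "E edge_of P" for p E
    using inj_on_image_mem_iff[OF inj that(1) inP[OF that(2)]] .
  have img_eq: "\<phi> ` E = \<phi> ` F \<longleftrightarrow> E = F" if "E edge_of P" "F edge_of P" for E F
    using inj_on_image_eq_iff[OF inj inP[OF that(1)] inP[OF that(2)]] .
  have ne': "\<phi> ` E1 \<noteq> \<phi> ` E2" "\<phi> ` E2 \<noteq> \<phi> ` E3" "\<phi> ` E1 \<noteq> \<phi> ` E3" using img_eq E ne by auto
  show thesis
  proof (rule edge_collapse[OF P' img[OF E(1)] img[OF E(2)] img[OF E(3)] ne' del'])
    fix hat \<kappa> \<kappa>i
    assume Q: "polygon Q" and w: "w \<in> hat (\<phi> ` E1)" "w \<in> hat (\<phi> ` E3)"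
      and hat: "bij_betw hat ({E. E edge_of P'} - {\<phi> ` E2}) {E. E edge_of Q}"
      and sub: "\<And>E. E edge_of P' \<Longrightarrow> E \<subseteq> hat E"
      and \<kappa>_smooth: "extends_smoothly P' \<kappa>" and \<kappa>i_smooth: "extends_smoothly (Q - {w}) \<kappa>i"
      and \<kappa>: "\<kappa> ` (P' - \<phi> ` E2) \<subseteq> Q - {w}" and \<kappa>i: "\<kappa>i ` (Q - {w}) \<subseteq> P' - \<phi> ` E2"
      and \<kappa>_w: "\<And>x. x \<in> \<phi> ` E2 \<Longrightarrow> \<kappa> x = w"
      and inv: "\<And>x. x \<in> P' - \<phi> ` E2 \<Longrightarrow> \<kappa>i (\<kappa> x) = x" "\<And>y. y \<in> Q - {w} \<Longrightarrow> \<kappa> (\<kappa>i y) = y"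
      and \<kappa>_hat: "\<And>x E. x \<in> P' - \<phi> ` E2 \<Longrightarrow> E edge_of P' \<Longrightarrow> E \<noteq> \<phi> ` E2 \<Longrightarrow> \<kappa> x \<in> hat E \<longleftrightarrow> x \<in> E"
    have off: "\<phi> p \<in> P' - \<phi> ` E2" if "p \<in> P - E2" for p using that \<phi>_in mem[OF _ E(2)] by blast
    have off': "\<psi> p \<in> P - E2" if "p \<in> P' - \<phi> ` E2" for p using that \<psi>_in \<phi>_\<psi> by force
    have "bij_betw ((`) \<phi>) ({E. E edge_of P} - {E2}) ({E. E edge_of P'} - {\<phi> ` E2})"
      unfolding bij_betw_def
    proof
      show "inj_on ((`) \<phi>) ({E. E edge_of P} - {E2})" using img_eq by (intro inj_onI) blast
      show "(`) \<phi> ` ({E. E edge_of P} - {E2}) = {E. E edge_of P'} - {\<phi> ` E2}"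
      proof
        show "(`) \<phi> ` ({E. E edge_of P} - {E2}) \<subseteq> {E. E edge_of P'} - {\<phi> ` E2}"
          using img img_eq[OF _ E(2)] by auto
        show "{E. E edge_of P'} - {\<phi> ` E2} \<subseteq> (`) \<phi> ` ({E. E edge_of P} - {E2})"
        proof
          fix F assume F: "F \<in> {E. E edge_of P'} - {\<phi> ` E2}"
          then obtain F' where "F' edge_of P" "F = \<phi> ` F'" using surj[of F] by auto
          then show "F \<in> (`) \<phi> ` ({E. E edge_of P} - {E2})" using F by auto
        qed
      qed
    qed
    then have hat': "bij_betw (hat \<circ> (`) \<phi>) ({E. E edge_of P} - {E2}) {E. E edge_of Q}"
      using hat by (rule bij_betw_trans)
    have "edge_contraction P Q E1 E2 E3 \<Lambda> \<Lambda>h w (hat \<circ> (`) \<phi>) (\<kappa> \<circ> \<phi>) (\<psi> \<circ> \<kappa>i)"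
    proof
      show "\<Lambda>h ((hat \<circ> (`) \<phi>) F) = \<Lambda> F" if F: "F edge_of P" "F \<noteq> E2" for F
      proof (rule \<Lambda>h[OF F(1)])
        show "(hat \<circ> (`) \<phi>) F edge_of Q" using hat' F by (auto simp: bij_betw_def)
        show "\<phi> ` F \<subseteq> (hat \<circ> (`) \<phi>) F" using sub[OF img[OF F(1)]] by simp
      qed
      show "extends_smoothly P (\<kappa> \<circ> \<phi>)" using \<phi>_in by (intro extends_smoothly_compose[OF \<phi>_smooth \<kappa>_smooth]) blast
      show "extends_smoothly (Q - {w}) (\<psi> \<circ> \<kappa>i)"
        using \<kappa>i by (intro extends_smoothly_compose[OF \<kappa>i_smooth \<psi>_smooth]) blast
      show "(\<kappa> \<circ> \<phi>) p \<in> Q - {w}" if "p \<in> P - E2" for p using off[OF that] \<kappa> by auto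
      show "(\<psi> \<circ> \<kappa>i) q \<in> P - E2" if "q \<in> Q - {w}" for q using off' \<kappa>i that by auto
      show "(\<psi> \<circ> \<kappa>i) ((\<kappa> \<circ> \<phi>) p) = p" if "p \<in> P - E2" for p using inv(1)[OF off[OF that]] \<psi>_\<phi> that by simp
      show "(\<kappa> \<circ> \<phi>) ((\<psi> \<circ> \<kappa>i) q) = q" if "q \<in> Q - {w}" for q
        using inv(2)[OF that] \<phi>_\<psi>[of "\<kappa>i q"] \<kappa>i that by auto
      show "(\<kappa> \<circ> \<phi>) p \<in> (hat \<circ> (`) \<phi>) F \<longleftrightarrow> p \<in> F" if "p \<in> P - E2" "F edge_of P" "F \<noteq> E2" for p F
        using \<kappa>_hat[OF off[OF that(1)] img[OF that(2)]] img_eq[OF that(2) E(2)] mem[OF _ that(2)] that by simp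
    qed (use P Q E ne det hat' w \<kappa>_w in auto)
    then show thesis by (rule that)
  qed
qed

theorem theorem4p1:
  fixes P Q E1 E2 E3 :: "(real ^ 2) set"
    and \<Lambda> \<Lambda>hat :: "(real ^ 2) set \<Rightarrow> int ^ 2"
    and w :: "real ^ 2"
  assumes "polygon P" and "primitive_characteristic P \<Lambda>"
    and "card {E. E edge_of P} \<ge> 4"
    and "E1 edge_of P" and "E2 edge_of P" and "E3 edge_of P"
    and "E1 \<noteq> E2" and "E2 \<noteq> E3" and "E1 \<noteq> E3"
    and "E1 \<inter> E2 \<noteq> {}" and "E2 \<inter> E3 \<noteq> {}"
    and "edge_deletion P \<Lambda> E1 E2 E3 w Q \<Lambda>hat"
    and "det_cols (\<Lambda> E1) (\<Lambda> E2) = 1"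
    and "0 < det_cols (\<Lambda> E2) (\<Lambda> E3)"
    and "det_cols (\<Lambda> E2) (\<Lambda> E3) \<le> det_cols (\<Lambda> E1) (\<Lambda> E3)"
  shows "\<exists>\<rho>. continuous_map (qt_space P \<Lambda>) (qt_space Q \<Lambda>hat) \<rho> \<and>
    orbifold_diffeomorphism
      (open_suborbifold (quasitoric_orbifold P \<Lambda>)
        (topspace (qt_space P \<Lambda>) - {x. orbit_map x \<in> E2}))
      (open_suborbifold (quasitoric_orbifold Q \<Lambda>hat)
        (topspace (qt_space Q \<Lambda>hat) - {y. orbit_map y = w}))
      \<rho>"
proof -
  have "det_cols (\<Lambda> E1) (\<Lambda> E3) \<noteq> 0" using assms(14,15) by linarith
  then obtain hat h hi where "edge_contraction P Q E1 E2 E3 \<Lambda> \<Lambda>hat w hat h hi"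
    using edge_deletion_imp_contraction[OF assms(1,2,4-9,12)] by blast
  then interpret edge_contraction P Q E1 E2 E3 \<Lambda> \<Lambda>hat w hat h hi .
  show ?thesis
    using continuous_map_\<rho> orbifold_diffeomorphism_\<rho> unfolding A_def B_def by blast
qed

end
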